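(* Let $X$ be either (a) a scaled Brownian motion $\sigma W$ with $\sigma>0$, or (b) the Ornstein--Uhlenbeck process $\mathrm{d}X_t=-\theta X_t\,\mathrm{d}t+\sigma\,\mathrm{d}W_t$ with $\theta,\sigma>0$; in either case $X_0=x_0$ and the target is the bridge law on $[0,T]$ conditioned on $X_T=x_T$. Let $C_{\mathrm{rej}}:(0,\infty)\to(0,\infty)$ be the expected-cost function of the bridge sampler used inside each Gibbs step, and assume there are constants $K,t_0>0$ with $C_{\mathrm{rej}}(t)\le Kt$ for all $0<t\le t_0$; in case (a) assume $C_{\mathrm{rej}}(t)=c_5t$ for all $t>0$, for some constant $c_5>0$. For $m\ge1$ let $\rho_{m,T}$ be the $\mathcal L^2$-convergence rate of the checkerboard (equivalently, the lexicographic) Gibbs sampler on the knot vector $\mathcal G$, let $\mathcal T(T,m)=-1/\log\rho_{m,T}$, and define $$C_{\mathrm{blocking}}(T,m):=\mathcal T(T,m)\cdot m\cdot C_{\mathrm{rej}}\!\left(\tfrac{2T}{m+1}\right).$$ Then for every $c_1>0$ and $\chi_1>0$, with $m(T)=\lceil c_1T^{1+\chi_1}\rceil$, $$C_{\mathrm{blocking}}(T,m(T))=\mathcal O\!\left(T^{3+2\chi_1}\right)\quad\text{as }T\to\infty$$ (in particular $\mathcal O(T^{3+\chi_2})$ for arbitrarily small $\chi_2>0$). In case (a) the same holds with $\chi_1=0$, i.e. with $m(T)=\lceil c_1T\rceil$ one has $C_{\mathrm{blocking}}(T,m(T))=\mathcal O(T^3)$.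
   Context: Knots: fix $m\ge1$, $\delta=\delta_{m,T}:=T/(m+1)$, anchors $k_i=i\delta$, $i=1,\dots,m$. The knot vector $\mathcal G=(X_{k_1},\dots,X_{k_m})$ conditioned on $(X_0,X_T)=(x_0,x_T)$ is a nondegenerate Gaussian vector in $\mathbb R^m$ with law $\pi$. Checkerboard Gibbs sweep: first update all odd-indexed coordinates of $\mathcal G$ jointly from their conditional law given the even-indexed ones, then all even-indexed coordinates from their conditional law given the odd-indexed ones. Lexicographic Gibbs sweep: update coordinate $1$ from its full conditional law given the others, then coordinate $2$, ..., then coordinate $m$. A sweep defines a Markov kernel $P$ with invariant law $\pi$. $\mathcal L^2$-convergence rate: the smallest $\rho$ such that for every $f\in L^2(\pi)$ and every $r>\rho$ there is $V_f>0$ with $\int\left[P^nf(x)-\pi(f)\right]^2\pi(\mathrm dx)\le V_f r^n$ for all $n$, where $P^nf(x)=\mathbb E[f(\mathcal G^{(n)})\mid\mathcal G^{(0)}=x]$. *)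

theory Defs
  imports "HOL-Probability.Probability" "HOL-Library.Landau_Symbols"
begin

text \<open>Transition density p(t,a,b) of X_t at b given X_0 = a.
  (a) scaled Brownian motion sigma W: N(a, sigma^2 t).
  (b) Ornstein-Uhlenbeck dX = -theta X dt + sigma dW:
      N(a e^{-theta t}, sigma^2 (1 - e^{-2 theta t}) / (2 theta)).
  Note normal_density takes the standard deviation as second argument.\<close>

definition bm_trans :: "real \<Rightarrow> real \<Rightarrow> real \<Rightarrow> real \<Rightarrow> real" where
  "bm_trans \<sigma> t a b = normal_density a (\<sigma> * sqrt t) b"

definition ou_trans :: "real \<Rightarrow> real \<Rightarrow> real \<Rightarrow> real \<Rightarrow> real \<Rightarrow> real" where
  "ou_trans \<theta> \<sigma> t a b =
     normal_density (a * exp (- \<theta> * t)) (\<sigma> * sqrt ((1 - exp (- 2 * \<theta> * t)) / (2 * \<theta>))) b"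

text \<open>Knot vectors (X_{k_1},...,X_{k_m}) are functions nat => real, extensional on {1..m}
  (coordinate i is X at time k_i = i * delta, delta = T/(m+1)).\<close>

definition knot_space :: "nat \<Rightarrow> (nat \<Rightarrow> real) measure" where
  "knot_space m = PiM {1..m} (\<lambda>_. lborel)"

definition knot_delta :: "real \<Rightarrow> nat \<Rightarrow> real" where
  "knot_delta T m = T / (real m + 1)"

text \<open>Unnormalised density (w.r.t. Lebesgue measure on R^m) of the knot vector
  conditioned on X_0 = x0, X_T = xT, for a Markov process with transition density p:
  the product of transition densities along 0 = k_0 < k_1 < ... < k_m < k_{m+1} = T.\<close>

definition bridge_dens ::
  "(real \<Rightarrow> real \<Rightarrow> real \<Rightarrow> real) \<Rightarrow> real \<Rightarrow> nat \<Rightarrow> real \<Rightarrow> real \<Rightarrow> (nat \<Rightarrow> real) \<Rightarrow> real" where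
  "bridge_dens p T m x0 xT x =
     (let y = (\<lambda>i. if i = 0 then x0 else if i = Suc m then xT else x i)
      in \<Prod>i\<in>{0..m}. p (knot_delta T m) (y i) (y (Suc i)))"

definition normalised :: "'a measure \<Rightarrow> ('a \<Rightarrow> real) \<Rightarrow> 'a measure" where
  "normalised M g = density M (\<lambda>x. ennreal (g x) / (\<integral>\<^sup>+ y. ennreal (g y) \<partial>M))"

definition bridge_law ::
  "(real \<Rightarrow> real \<Rightarrow> real \<Rightarrow> real) \<Rightarrow> real \<Rightarrow> nat \<Rightarrow> real \<Rightarrow> real \<Rightarrow> (nat \<Rightarrow> real) measure" where
  "bridge_law p T m x0 xT = normalised (knot_space m) (bridge_dens p T m x0 xT)"

text \<open>Joint update of the block A of coordinates from its conditional law given the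
  other coordinates of the current state x, for a target with (unnormalised) density g
  on R^m: the new block has density proportional to y |-> g(y on A, x off A),
  the other coordinates are kept.\<close>

definition block_update ::
  "nat \<Rightarrow> ((nat \<Rightarrow> real) \<Rightarrow> real) \<Rightarrow> nat set \<Rightarrow> (nat \<Rightarrow> real) \<Rightarrow> (nat \<Rightarrow> real) measure" where
  "block_update m g A x =
     distr (normalised (PiM A (\<lambda>_. lborel)) (\<lambda>y. g (merge A ({1..m} - A) (y, x))))
           (knot_space m) (\<lambda>y. merge A ({1..m} - A) (y, x))"

fun gibbs_sweep ::
  "nat \<Rightarrow> ((nat \<Rightarrow> real) \<Rightarrow> real) \<Rightarrow> nat set list \<Rightarrow> (nat \<Rightarrow> real) \<Rightarrow> (nat \<Rightarrow> real) measure" where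
  "gibbs_sweep m g [] x = return (knot_space m) x"
| "gibbs_sweep m g (A # As) x = block_update m g A x \<bind> gibbs_sweep m g As"

definition checkerboard_blocks :: "nat \<Rightarrow> nat set list" where
  "checkerboard_blocks m = [{i\<in>{1..m}. odd i}, {i\<in>{1..m}. even i}]"

definition lexicographic_blocks :: "nat \<Rightarrow> nat set list" where
  "lexicographic_blocks m = map (\<lambda>i. {i}) [1..<Suc m]"

fun kernel_pow ::
  "'a measure \<Rightarrow> ('a \<Rightarrow> 'a measure) \<Rightarrow> nat \<Rightarrow> 'a \<Rightarrow> 'a measure" where
  "kernel_pow M K 0 x = return M x"
| "kernel_pow M K (Suc n) x = kernel_pow M K n x \<bind> K"

definition kernel_apply ::
  "'a measure \<Rightarrow> ('a \<Rightarrow> 'a measure) \<Rightarrow> nat \<Rightarrow> ('a \<Rightarrow> real) \<Rightarrow> 'a \<Rightarrow> real" where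
  "kernel_apply M K n f x = (\<integral>y. f y \<partial>(kernel_pow M K n x))"

definition l2_rate_ok :: "'a measure \<Rightarrow> ('a \<Rightarrow> 'a measure) \<Rightarrow> real \<Rightarrow> bool" where
  "l2_rate_ok \<pi> K \<rho> \<longleftrightarrow>
     (\<forall>f. f \<in> borel_measurable \<pi> \<and> integrable \<pi> (\<lambda>x. (f x)\<^sup>2) \<longrightarrow>
        (\<forall>r>\<rho>. \<exists>V>0. \<forall>n.
           0 \<le> V * r ^ n \<and>
           (\<integral>\<^sup>+ x. ennreal ((kernel_apply \<pi> K n f x - (\<integral>y. f y \<partial>\<pi>))\<^sup>2) \<partial>\<pi>)
             \<le> ennreal (V * r ^ n)))"

definition l2_rate :: "'a measure \<Rightarrow> ('a \<Rightarrow> 'a measure) \<Rightarrow> real" where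
  "l2_rate \<pi> K = Inf {\<rho>. l2_rate_ok \<pi> K \<rho>}"

definition gibbs_rate ::
  "(real \<Rightarrow> real \<Rightarrow> real \<Rightarrow> real) \<Rightarrow> (nat \<Rightarrow> nat set list) \<Rightarrow> real \<Rightarrow> real \<Rightarrow> real \<Rightarrow> nat \<Rightarrow> real" where
  "gibbs_rate p blocks x0 xT T m =
     l2_rate (bridge_law p T m x0 xT) (gibbs_sweep m (bridge_dens p T m x0 xT) (blocks m))"

definition relax_time ::
  "(real \<Rightarrow> real \<Rightarrow> real \<Rightarrow> real) \<Rightarrow> (nat \<Rightarrow> nat set list) \<Rightarrow> real \<Rightarrow> real \<Rightarrow> real \<Rightarrow> nat \<Rightarrow> real" where
  "relax_time p blocks x0 xT T m = - 1 / ln (gibbs_rate p blocks x0 xT T m)"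

definition C_blocking ::
  "(real \<Rightarrow> real) \<Rightarrow> (real \<Rightarrow> real \<Rightarrow> real \<Rightarrow> real) \<Rightarrow> (nat \<Rightarrow> nat set list) \<Rightarrow> real \<Rightarrow> real \<Rightarrow> real \<Rightarrow> nat \<Rightarrow> real" where
  "C_blocking C_rej p blocks x0 xT T m =
     relax_time p blocks x0 xT T m * real m * C_rej (2 * T / (real m + 1))"

end

theory Submission
  imports Defs
begin

text \<open>The number of sweeps needed is bounded by a spectral gap estimate \<open>\<rho> \<le> 1 - 1 / (8 m\<^sup>2)\<close>, uniform in
  \<open>T\<close>, in the process and in the order of the updates; the cost is then \<open>O(m\<^sup>2 T)\<close>.

  A block update is affine in the current state with noise independent of it, so two copies driven by
  the same noise differ by a Gauss--Seidel iterate for a tridiagonal matrix dominating the discrete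
  Laplacian. One sweep, in whatever order, contracts the energy of this matrix by \<open>1 - 1 / (8 m\<^sup>2)\<close>.
  Hence Lipschitz functions are contracted by the sweep. To pass to all of \<open>L\<^sup>2\<close> without Hermite
  expansions, let \<open>P\<close> be the sweep operator, a product of self-adjoint operators, and \<open>Q = P\<^sup>* P\<close> the
  symmetrised sweep. The sequence \<open>\<parallel>Q\<^sup>j f\<parallel>\<close> is log-convex, so its asymptotic decay rate for Lipschitz
  \<open>f\<close> already bounds \<open>\<parallel>Q f\<parallel>\<close>, hence \<open>\<parallel>P f\<parallel>\<^sup>2 \<le> (1 - 1 / (8 m\<^sup>2)) \<parallel>f\<parallel>\<^sup>2\<close> for centred Lipschitz \<open>f\<close>; such
  functions are dense.\<close>

subsection \<open>Gauss--Seidel sweeps\<close>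

text \<open>The rate quantifies over all of L^2 with a constant depending on f, so decay for
  Lipschitz functions proves nothing about it by itself: their constants blow up along an
  approximating sequence. What survives the limit is a one-step bound with a factor independent of
  f, and log-convexity is the device that discards the constant. It needs a self-adjoint operator,
  which a sweep in general is not. The detour through Q is lossless: the forward and the reversed
  sweep each contract the energy by r = 1 - 1/(8 m^2), so Q contracts the square root of the energy,
  a Lipschitz modulus, by r, and \<parallel>P f\<parallel>^2 = <Q f, f> \<le> \<parallel>Q
  f\<parallel> \<parallel>f\<parallel> is again bounded with factor r. This is the squared norm in
  which the rate is measured. The endpoints cancel in differences of coupled states, and T and the
  parameters of the process enter the linear part only through \<kappa>, the weight of the
  neighbours in a conditional mean. All that is used of it is 0 \<le> \<kappa> \<le> 1/2, whence the
  uniformity.\<close>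

text \<open>\<open>gs_update\<close> is the linear part of the Gibbs update of the block \<open>A\<close>: it acts on the difference of
  two coupled states, so the boundary entries at \<open>0\<close> and \<open>m + 1\<close> vanish.\<close>

definition gs_update :: "real \<Rightarrow> nat set \<Rightarrow> (nat \<Rightarrow> real) \<Rightarrow> nat \<Rightarrow> real" where
  "gs_update \<kappa> A e i = (if i \<in> A then \<kappa> * (e (i - 1) + e (Suc i)) else e i)"

definition residual :: "real \<Rightarrow> (nat \<Rightarrow> real) \<Rightarrow> nat \<Rightarrow> real" where
  "residual \<kappa> e i = e i - \<kappa> * (e (i - 1) + e (Suc i))"

text \<open>The quadratic form of the identity minus \<kappa> times the adjacency matrix of a path.
  Up to a scalar it is the precision form of the knot vector (\<open>action_bilinear\<close>), and
  updating an independent block minimises it over that block.\<close>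

definition energy :: "real \<Rightarrow> nat \<Rightarrow> (nat \<Rightarrow> real) \<Rightarrow> real" where
  "energy \<kappa> m e = (\<Sum>i=1..m. e i * residual \<kappa> e i)"

text \<open>Coordinates of such a block are conditionally independent given the rest, and updating
  them jointly equals updating them in turn.\<close>

definition independent_set :: "nat set \<Rightarrow> bool" where
  "independent_set A \<longleftrightarrow> (\<forall>i\<in>A. Suc i \<notin> A)"

text \<open>Differences of two bridges vanish at both pinned endpoints, so the outer neighbours
  \<open>0\<close> and \<open>Suc m\<close> contribute nothing to the energy.\<close>

definition supported :: "nat \<Rightarrow> (nat \<Rightarrow> real) \<Rightarrow> bool" where
  "supported m e \<longleftrightarrow> (\<forall>i. i \<notin> {1..m} \<longrightarrow> e i = 0)"

lemma supportedD: "supported m e \<Longrightarrow> e 0 = 0" "supported m e \<Longrightarrow> e (Suc m) = 0"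
  by (auto simp: supported_def)

lemma sum_squares_shift:
  assumes d: "supported m d"
  shows "(\<Sum>i=1..m. (d (i-1))\<^sup>2) \<le> (\<Sum>i=1..m. (d i)\<^sup>2)"
    and "(\<Sum>i=1..m. (d (Suc i))\<^sup>2) \<le> (\<Sum>i=1..m. (d i)\<^sup>2)"
proof -
  have "(\<Sum>i=1..m. (d (i-1))\<^sup>2) = (\<Sum>i=0..<m. (d i)\<^sup>2)"
    using sum.shift_bounds_Suc_ivl[of "\<lambda>i. (d (i-1))\<^sup>2" 0 m] by (simp add: atLeastLessThanSuc_atLeastAtMost)
  also have "\<dots> \<le> (\<Sum>i=0..m. (d i)\<^sup>2)" by (rule sum_mono2) auto
  also have "\<dots> = (\<Sum>i=1..m. (d i)\<^sup>2)" using supportedD[OF d] by (simp add: sum.atLeast_Suc_atMost)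
  finally show "(\<Sum>i=1..m. (d (i-1))\<^sup>2) \<le> (\<Sum>i=1..m. (d i)\<^sup>2)" .
  have "(\<Sum>i=1..m. (d (Suc i))\<^sup>2) = (\<Sum>i=Suc 1..Suc m. (d i)\<^sup>2)"
    by (simp only: sum.shift_bounds_cl_Suc_ivl)
  also have "\<dots> \<le> (\<Sum>i=1..Suc m. (d i)\<^sup>2)" by (rule sum_mono2) auto
  also have "\<dots> = (\<Sum>i=1..m. (d i)\<^sup>2)" using supportedD[OF d] by simp
  finally show "(\<Sum>i=1..m. (d (Suc i))\<^sup>2) \<le> (\<Sum>i=1..m. (d i)\<^sup>2)" .
qed

text \<open>Regroups a sum over knots as a sum over the edges j, j + 1. Only \<open>u\<close> has to
  vanish at the ends: \<open>v\<close> will later carry the pinned values of the bridge.\<close>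

lemma sum_neighbours:
  fixes u v :: "nat \<Rightarrow> real"
  assumes "u 0 = 0" "u (Suc m) = 0"
  shows "(\<Sum>i=1..m. u i * (v (i - 1) + v (Suc i))) = (\<Sum>j=0..m. u j * v (Suc j) + v j * u (Suc j))"
proof -
  have 1: "(\<Sum>j=0..m. u j * v (Suc j)) = (\<Sum>i=1..m. u i * v (Suc i))"
    using assms by (simp add: sum.atLeast_Suc_atMost)
  have "(\<Sum>j=0..m. v j * u (Suc j)) = (\<Sum>i=Suc 0..Suc m. v (i - 1) * u i)"
    by (subst sum.shift_bounds_cl_Suc_ivl) simp
  also have "\<dots> = (\<Sum>i=1..m. u i * v (i - 1))"
    using assms by (simp add: mult.commute)
  finally show ?thesis using 1
    by (simp add: sum.distrib distrib_left)
qed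

lemma sum_neighbours_commute:
  fixes u v :: "nat \<Rightarrow> real"
  assumes "supported m u" "supported m v"
  shows "(\<Sum>i=1..m. u i * (v (i - 1) + v (Suc i))) = (\<Sum>i=1..m. v i * (u (i - 1) + u (Suc i)))"
  using supportedD[OF assms(1)] supportedD[OF assms(2)]
  by (simp only: sum_neighbours) (simp add: add.commute mult.commute)

lemma supported_gs_update:
  "supported m e \<Longrightarrow> A \<subseteq> {1..m} \<Longrightarrow> supported m (gs_update \<kappa> A e)"
  by (auto simp: supported_def gs_update_def)

text \<open>Pythagoras for the energy form. After the update the residual vanishes on
  \<open>A\<close>, which carries the displacement, so displacement and new state are orthogonal;
  and on an independent set the form is the plain sum of squares.\<close>

lemma energy_gs_update:
  assumes e: "supported m e" and A: "A \<subseteq> {1..m}" "independent_set A"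
  shows "energy \<kappa> m e - energy \<kappa> m (gs_update \<kappa> A e) = (\<Sum>i\<in>A. (e i - gs_update \<kappa> A e i)\<^sup>2)"
proof -
  define e' where "e' = gs_update \<kappa> A e"
  define u where "u i = e i - e' i" for i
  have e': "supported m e'" unfolding e'_def using e A(1) by (rule supported_gs_update)
  have u: "supported m u" using e e' by (auto simp: supported_def u_def)
  have uA: "u i = (if i \<in> A then residual \<kappa> e i else 0)" for i
    by (simp add: u_def e'_def gs_update_def residual_def)
  have cross: "u i * (u (i - 1) + u (Suc i)) = 0" if "i \<in> {1..m}" for i
    using A(2) that unfolding independent_set_def uA by (cases i) auto
  have res: "residual \<kappa> e' i = residual \<kappa> e i - residual \<kappa> u i" for i
    by (simp add: residual_def u_def algebra_simps)
  have "energy \<kappa> m e - energy \<kappa> m e' = (\<Sum>i=1..m. e i * residual \<kappa> u i + u i * residual \<kappa> e i - u i * residual \<kappa> u i)"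
    unfolding energy_def sum_subtractf[symmetric]
    by (rule sum.cong) (auto simp: res u_def algebra_simps)
  also have "\<dots> = (\<Sum>i=1..m. e i * residual \<kappa> u i) + (\<Sum>i=1..m. u i * residual \<kappa> e i)
      - (\<Sum>i=1..m. u i * residual \<kappa> u i)"
    by (simp add: sum.distrib sum_subtractf)
  \<comment> \<open>Symmetry of the form moves the residual from \<open>u\<close> to
    \<open>e\<close>, where it coincides with \<open>u\<close> on \<open>A\<close>. Each of the
    three sums is then the squared length of \<open>u\<close>.\<close>
  also have "(\<Sum>i=1..m. e i * residual \<kappa> u i) = (\<Sum>i=1..m. u i * residual \<kappa> e i)"
  proof -
    have "(\<Sum>i=1..m. a i * residual \<kappa> b i) = (\<Sum>i=1..m. a i * b i) - \<kappa> * (\<Sum>i=1..m. a i * (b (i - 1) + b (Suc i)))" for a b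
      unfolding residual_def sum_distrib_left sum_subtractf[symmetric]
      by (rule sum.cong) (auto simp: algebra_simps)
    then show ?thesis using sum_neighbours_commute[OF e u] by (simp add: mult.commute)
  qed
  also have "(\<Sum>i=1..m. u i * residual \<kappa> e i) = (\<Sum>i=1..m. (u i)\<^sup>2)"
    by (rule sum.cong) (auto simp: uA power2_eq_square)
  also have "(\<Sum>i=1..m. u i * residual \<kappa> u i) = (\<Sum>i=1..m. (u i)\<^sup>2)"
  proof (rule sum.cong)
    fix i assume "i \<in> {1..m}"
    have "u i * residual \<kappa> u i = (u i)\<^sup>2 - \<kappa> * (u i * (u (i - 1) + u (Suc i)))"
      by (simp add: residual_def power2_eq_square algebra_simps)
    then show "u i * residual \<kappa> u i = (u i)\<^sup>2" using cross[OF \<open>i \<in> {1..m}\<close>] by simp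
  qed simp
  also have "(\<Sum>i=1..m. (u i)\<^sup>2) = (\<Sum>i\<in>A. (u i)\<^sup>2)"
    using A(1) by (intro sum.mono_neutral_right) (auto simp: uA)
  finally show ?thesis by (simp add: u_def e'_def)
qed

text \<open>No coordinate moves twice, so the energy drops add up to one sum over the total
  displacement. For the last bound: a coordinate's displacement is its residual at the moment of its
  update, and this differs from the initial residual only by \<kappa> times the moves of neighbours
  updated earlier.\<close>

lemma gs_sweep_increments:
  assumes "0 \<le> \<kappa>" "supported m e" "sorted_wrt (\<lambda>A B. A \<inter> B = {}) As"
    and "\<forall>A\<in>set As. A \<subseteq> {1..m} \<and> independent_set A"
  defines "f \<equiv> fold (gs_update \<kappa>) As e"
  shows "supported m f" and "\<And>i. i \<notin> \<Union>(set As) \<Longrightarrow> f i = e i"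
    and "energy \<kappa> m e - energy \<kappa> m f = (\<Sum>i\<in>\<Union>(set As). (e i - f i)\<^sup>2)"
    and "\<And>i. i \<in> \<Union>(set As) \<Longrightarrow> \<bar>residual \<kappa> e i\<bar> \<le> \<bar>e i - f i\<bar> + \<kappa> * (\<bar>e (i - 1) - f (i - 1)\<bar> + \<bar>e (Suc i) - f (Suc i)\<bar>)"
proof -
  have "supported m f \<and> (\<forall>i. i \<notin> \<Union>(set As) \<longrightarrow> f i = e i) \<and>
    energy \<kappa> m e - energy \<kappa> m f = (\<Sum>i\<in>\<Union>(set As). (e i - f i)\<^sup>2) \<and>
    (\<forall>i. i \<in> \<Union>(set As) \<longrightarrow> \<bar>residual \<kappa> e i\<bar> \<le> \<bar>e i - f i\<bar> + \<kappa> * (\<bar>e (i - 1) - f (i - 1)\<bar> + \<bar>e (Suc i) - f (Suc i)\<bar>))"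
    using assms(2-4) unfolding f_def
  proof (induction As arbitrary: e)
    case Nil then show ?case by simp
  next
    case (Cons A As)
    define e1 where "e1 = gs_update \<kappa> A e"
    define f where "f = fold (gs_update \<kappa>) As e1"
    define U where "U = \<Union>(set As)"
    have A: "A \<subseteq> {1..m}" "independent_set A" using Cons.prems by auto
    have e1: "supported m e1" unfolding e1_def using Cons.prems A by (intro supported_gs_update)
    have disj: "A \<inter> U = {}" using Cons.prems by (auto simp: U_def)
    have "U \<subseteq> {1..m}" using Cons.prems by (auto simp: U_def)
    then have fin: "finite A" "finite U" using A(1) by (blast intro: finite_subset finite_atLeastAtMost)+
    have IH: "supported m f" "\<And>i. i \<notin> U \<Longrightarrow> f i = e1 i"
      "energy \<kappa> m e1 - energy \<kappa> m f = (\<Sum>i\<in>U. (e1 i - f i)\<^sup>2)"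
      "\<And>i. i \<in> U \<Longrightarrow> \<bar>residual \<kappa> e1 i\<bar> \<le> \<bar>e1 i - f i\<bar> + \<kappa> * (\<bar>e1 (i - 1) - f (i - 1)\<bar> + \<bar>e1 (Suc i) - f (Suc i)\<bar>)"
      using Cons.IH[OF e1] Cons.prems unfolding f_def U_def by auto
    have off: "e1 i = e i" if "i \<notin> A" for i using that by (simp add: e1_def gs_update_def)
    have on: "f i = e1 i" if "i \<in> A" for i using that disj IH(2) by auto
    \<comment> \<open>At each coordinate one of the two moves is zero, so their absolute values add
      exactly; the triangle inequality alone points the wrong way.\<close>
    have split: "\<bar>e1 i - f i\<bar> + \<bar>e i - e1 i\<bar> = \<bar>e i - f i\<bar>" for i
      using on off by (cases "i \<in> A") auto
    have 3: "energy \<kappa> m e - energy \<kappa> m f = (\<Sum>i\<in>A\<union>U. (e i - f i)\<^sup>2)"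
    proof -
      have "energy \<kappa> m e - energy \<kappa> m f = (\<Sum>i\<in>A. (e i - e1 i)\<^sup>2) + (\<Sum>i\<in>U. (e1 i - f i)\<^sup>2)"
        using energy_gs_update[OF Cons.prems(1) A, of \<kappa>] IH(3) by (simp add: e1_def)
      also have "(\<Sum>i\<in>A. (e i - e1 i)\<^sup>2) = (\<Sum>i\<in>A. (e i - f i)\<^sup>2)" using on by simp
      also have "(\<Sum>i\<in>U. (e1 i - f i)\<^sup>2) = (\<Sum>i\<in>U. (e i - f i)\<^sup>2)"
        using disj by (intro sum.cong refl) (subst off, auto)
      finally show ?thesis using fin disj by (simp add: sum.union_disjoint)
    qed
    have 4: "\<bar>residual \<kappa> e i\<bar> \<le> \<bar>e i - f i\<bar> + \<kappa> * (\<bar>e (i - 1) - f (i - 1)\<bar> + \<bar>e (Suc i) - f (Suc i)\<bar>)" if "i \<in> A \<union> U" for i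
    proof (cases "i \<in> A")
      case True
      then have "residual \<kappa> e i = e i - f i" using on by (simp add: e1_def gs_update_def residual_def)
      then show ?thesis using assms(1) by simp
    next
      case False
      then have i: "i \<in> U" using that by simp
      have "residual \<kappa> e i = residual \<kappa> e1 i - \<kappa> * ((e (i-1) - e1 (i-1)) + (e (Suc i) - e1 (Suc i)))"
        using off[OF False] by (simp add: residual_def algebra_simps)
      then have "\<bar>residual \<kappa> e i\<bar> \<le> \<bar>residual \<kappa> e1 i\<bar> + \<bar>\<kappa> * ((e (i-1) - e1 (i-1)) + (e (Suc i) - e1 (Suc i)))\<bar>"
        by linarith
      also have "\<bar>\<kappa> * ((e (i-1) - e1 (i-1)) + (e (Suc i) - e1 (Suc i)))\<bar>
          \<le> \<kappa> * (\<bar>e (i-1) - e1 (i-1)\<bar> + \<bar>e (Suc i) - e1 (Suc i)\<bar>)"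
        using assms(1) by (simp add: abs_mult mult_left_mono)
      also note IH(4)[OF i]
      finally have "\<bar>residual \<kappa> e i\<bar> \<le> \<bar>e1 i - f i\<bar> + \<kappa> * ((\<bar>e1 (i - 1) - f (i - 1)\<bar> + \<bar>e (i-1) - e1 (i-1)\<bar>)
         + (\<bar>e1 (Suc i) - f (Suc i)\<bar> + \<bar>e (Suc i) - e1 (Suc i)\<bar>))"
        by (simp add: algebra_simps)
      then show ?thesis unfolding split using off[OF False] by simp
    qed
    show ?case using IH(1,2) 3 4 off
      by (auto simp: f_def[symmetric] e1_def[symmetric] U_def)
  qed
  note * = this
  show "supported m f" using * by (rule conjunct1)
  show "f i = e i" if "i \<notin> \<Union>(set As)" for i using *[THEN conjunct2, THEN conjunct1] that by blast
  show "energy \<kappa> m e - energy \<kappa> m f = (\<Sum>i\<in>\<Union>(set As). (e i - f i)\<^sup>2)"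
    using *[THEN conjunct2, THEN conjunct2] by (rule conjunct1)
  show "\<bar>residual \<kappa> e i\<bar> \<le> \<bar>e i - f i\<bar> + \<kappa> * (\<bar>e (i - 1) - f (i - 1)\<bar> + \<bar>e (Suc i) - f (Suc i)\<bar>)"
    if "i \<in> \<Union>(set As)" for i
    using *[THEN conjunct2, THEN conjunct2, THEN conjunct2] that by blast
qed

text \<open>The energy is (1 - 2 \<kappa>) S + \<kappa> G, with S the sum of squares and G the
  Dirichlet sum. At \<kappa> = 1/2 only G is left and the Poincare bound S \<le> m^2 G decides; in
  general the two terms are bounded separately, the first by m \<ge> 1.\<close>

lemma energy_lower_bound:
  assumes \<kappa>: "0 \<le> \<kappa>" "\<kappa> \<le> 1/2" and e: "supported m e" and m: "m \<ge> 1"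
  shows "(\<Sum>i=1..m. (e i)\<^sup>2) \<le> 2 * (real m)\<^sup>2 * energy \<kappa> m e"
proof -
  define S where "S = (\<Sum>i=1..m. (e i)\<^sup>2)"
  define G where "G = (\<Sum>j=0..m. (e (Suc j) - e j)\<^sup>2)"
  have S0: "S \<ge> 0" by (simp add: S_def sum_nonneg)
  \<comment> \<open>Telescoping from the left end, where \<open>e\<close> vanishes, and
    Cauchy-Schwarz cost one factor m; summing over the knots costs the second.\<close>
  have point: "(e i)\<^sup>2 \<le> real m * G" if "i \<in> {1..m}" for i
  proof -
    have "e i = (\<Sum>j<i. 1 * (e (Suc j) - e j))"
      using supportedD(1)[OF e] by (simp add: sum_lessThan_telescope)
    then have "(e i)\<^sup>2 \<le> (\<Sum>j<i. 1\<^sup>2) * (\<Sum>j<i. (e (Suc j) - e j)\<^sup>2)"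
      using Cauchy_Schwarz_ineq_sum[of "\<lambda>_. 1" "\<lambda>j. e (Suc j) - e j" "{..<i}"] by presburger
    also have "\<dots> \<le> real m * G"
      using that unfolding G_def by (intro mult_mono sum_mono2) (auto intro: sum_nonneg)
    finally show ?thesis .
  qed
  have poincare: "S \<le> (real m)\<^sup>2 * G"
    using sum_mono[of "{1..m}" "\<lambda>i. (e i)\<^sup>2" "\<lambda>_. real m * G"] point
    by (simp add: S_def power2_eq_square)
  have nb: "(\<Sum>i=1..m. e i * (e (i - 1) + e (Suc i))) = 2 * (\<Sum>j=0..m. e j * e (Suc j))"
    using sum_neighbours[of e m e] supportedD[OF e] by (simp add: sum_distrib_left mult.commute)
  have "G = (\<Sum>j=0..m. (e (Suc j))\<^sup>2) + (\<Sum>j=0..m. (e j)\<^sup>2) - 2 * (\<Sum>j=0..m. e j * e (Suc j))"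
    unfolding G_def sum_distrib_left sum.distrib[symmetric] sum_subtractf[symmetric]
    by (rule sum.cong) (auto simp: power2_eq_square algebra_simps)
  also have "(\<Sum>j=0..m. (e (Suc j))\<^sup>2) = S"
    using supportedD[OF e] sum.shift_bounds_cl_Suc_ivl[of "\<lambda>i. (e i)\<^sup>2" 0 m] by (simp add: S_def)
  also have "(\<Sum>j=0..m. (e j)\<^sup>2) = S"
    using supportedD[OF e] by (simp add: S_def sum.atLeast_Suc_atMost)
  finally have G: "2 * (\<Sum>j=0..m. e j * e (Suc j)) = 2 * S - G" by simp
  have "energy \<kappa> m e = S - \<kappa> * (\<Sum>i=1..m. e i * (e (i - 1) + e (Suc i)))"
    unfolding energy_def S_def sum_distrib_left sum_subtractf[symmetric]
    by (rule sum.cong) (auto simp: residual_def power2_eq_square algebra_simps)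
  also have "\<dots> = S - \<kappa> * (2 * S - G)" by (simp only: nb G)
  finally have en: "energy \<kappa> m e = (1 - 2 * \<kappa>) * S + \<kappa> * G" by (simp add: algebra_simps)
  have "1 * (S * (1 - 2 * \<kappa>)) \<le> (real m)\<^sup>2 * (S * (1 - 2 * \<kappa>))"
    using m \<kappa> S0 by (intro mult_right_mono) auto
  moreover have "\<kappa> * S \<le> \<kappa> * ((real m)\<^sup>2 * G)" using poincare \<kappa> by (intro mult_left_mono)
  moreover have "0 \<le> S * (1 - 2 * \<kappa>)" using S0 \<kappa> by simp
  ultimately have "S * (1 - 2 * \<kappa>) + 2 * (\<kappa> * S) \<le> 2 * ((real m)\<^sup>2 * (S * (1 - 2 * \<kappa>))) + 2 * (\<kappa> * ((real m)\<^sup>2 * G))"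
    by linarith
  then show ?thesis unfolding en S_def[symmetric] by (simp add: algebra_simps)
qed

lemma energy_nonneg:
  assumes "0 \<le> \<kappa>" "\<kappa> \<le> 1/2" "supported m e"
  shows "0 \<le> energy \<kappa> m e"
proof (cases "m \<ge> 1")
  case True
  have "0 \<le> (\<Sum>i=1..m. (e i)\<^sup>2)" by (simp add: sum_nonneg)
  also have "\<dots> \<le> 2 * (real m)\<^sup>2 * energy \<kappa> m e" using energy_lower_bound assms True by blast
  finally show ?thesis using True by (simp add: zero_le_mult_iff)
next
  case False then show ?thesis by (auto simp: energy_def not_le)
qed

text \<open>The form has norm at most 1 + 2 \<kappa> \<le> 2. Serves to control the energy by the
  second moment of the bridge law.\<close>

lemma energy_upper_bound:
  assumes \<kappa>: "0 \<le> \<kappa>" "\<kappa> \<le> 1/2" and e: "supported m e"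
  shows "energy \<kappa> m e \<le> 2 * (\<Sum>i=1..m. (e i)\<^sup>2)"
proof -
  have "energy \<kappa> m e \<le> (\<Sum>i=1..m. (e i)\<^sup>2 + (1/2) * (e i)\<^sup>2 + (1/4) * (e (i-1))\<^sup>2 + (1/4) * (e (Suc i))\<^sup>2)"
    unfolding energy_def
  proof (rule sum_mono)
    fix i
    have "- (\<kappa> * (e i * x)) \<le> (1/4) * (e i)\<^sup>2 + (1/4) * x\<^sup>2" for x
    proof -
      have "- (\<kappa> * (e i * x)) \<le> \<kappa> * \<bar>e i * x\<bar>" using \<kappa> by (metis abs_ge_minus_self abs_mult abs_of_nonneg)
      also have "\<dots> \<le> (1/2) * \<bar>e i * x\<bar>" using \<kappa> by (intro mult_right_mono) auto
      also have "\<bar>e i * x\<bar> \<le> (1/2) * (e i)\<^sup>2 + (1/2) * x\<^sup>2"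
        using sum_squares_bound[of "\<bar>e i\<bar>" "\<bar>x\<bar>"] by (simp add: abs_mult)
      finally show ?thesis by simp
    qed
    from this[of "e (i-1)"] this[of "e (Suc i)"]
    show "e i * residual \<kappa> e i \<le> (e i)\<^sup>2 + (1/2) * (e i)\<^sup>2 + (1/4) * (e (i-1))\<^sup>2 + (1/4) * (e (Suc i))\<^sup>2"
      by (simp add: residual_def power2_eq_square algebra_simps)
  qed
  also have "\<dots> = (3/2) * (\<Sum>i=1..m. (e i)\<^sup>2) + (1/4) * (\<Sum>i=1..m. (e (i-1))\<^sup>2) + (1/4) * (\<Sum>i=1..m. (e (Suc i))\<^sup>2)"
    by (simp add: sum.distrib sum_distrib_left[symmetric] sum_divide_distrib[symmetric])
  also have "(\<Sum>i=1..m. (e (i-1))\<^sup>2) \<le> (\<Sum>i=1..m. (e i)\<^sup>2)" using e by (rule sum_squares_shift)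
  also have "(\<Sum>i=1..m. (e (Suc i))\<^sup>2) \<le> (\<Sum>i=1..m. (e i)\<^sup>2)" using e by (rule sum_squares_shift)
  finally show ?thesis by simp
qed

text \<open>Every coordinate moves exactly once in a sweep, so the energy drops by the squared
  length of the total displacement \<open>d\<close>. The residual before the sweep is controlled by \<open>d\<close>, and
  the discrete Poincare inequality turns this into a relative decrease of order \<open>1/m\<^sup>2\<close>, whatever
  the order of the updates.\<close>

lemma energy_gs_sweep:
  assumes \<kappa>: "0 \<le> \<kappa>" "\<kappa> \<le> 1/2" and e: "supported m e" and m: "m \<ge> 1"
    and As: "sorted_wrt (\<lambda>A B. A \<inter> B = {}) As" "\<forall>A\<in>set As. A \<subseteq> {1..m} \<and> independent_set A"
    and full: "\<Union>(set As) = {1..m}"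
  shows "energy \<kappa> m (fold (gs_update \<kappa>) As e) \<le> (1 - 1 / (8 * (real m)\<^sup>2)) * energy \<kappa> m e"
proof -
  define f where "f = fold (gs_update \<kappa>) As e"
  define d where "d i = e i - f i" for i
  define D where "D = (\<Sum>i=1..m. (d i)\<^sup>2)"
  note inc = gs_sweep_increments[OF \<kappa>(1) e As, folded f_def, unfolded full, folded d_def]
  have d: "supported m d" using e inc(1) by (auto simp: supported_def d_def)
  \<comment> \<open>After summation the two shifted terms are absorbed by
    \<open>sum_squares_shift\<close>, and the coefficients give 2 + 1 + 1 = 4.\<close>
  have res: "(residual \<kappa> e i)\<^sup>2 \<le> 2 * (d i)\<^sup>2 + (d (i-1))\<^sup>2 + (d (Suc i))\<^sup>2" if "i \<in> {1..m}" for i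
  proof -
    have "\<bar>residual \<kappa> e i\<bar> \<le> \<bar>d i\<bar> + \<kappa> * (\<bar>d (i - 1)\<bar> + \<bar>d (Suc i)\<bar>)" using inc(4)[OF that] .
    also have "\<dots> \<le> \<bar>d i\<bar> + (1/2) * (\<bar>d (i - 1)\<bar> + \<bar>d (Suc i)\<bar>)"
      using \<kappa> by (intro add_left_mono mult_right_mono) auto
    finally have "(residual \<kappa> e i)\<^sup>2 \<le> (\<bar>d i\<bar> + (1/2) * (\<bar>d (i - 1)\<bar> + \<bar>d (Suc i)\<bar>))\<^sup>2"
      by (metis abs_ge_zero power2_abs power_mono)
    also have "\<dots> \<le> 2 * \<bar>d i\<bar>\<^sup>2 + \<bar>d (i-1)\<bar>\<^sup>2 + \<bar>d (Suc i)\<bar>\<^sup>2"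
    proof -
      have "(a + (1/2) * (b + c))\<^sup>2 \<le> 2 * a\<^sup>2 + b\<^sup>2 + c\<^sup>2" for a b c :: real
      proof -
        have "2 * a\<^sup>2 + b\<^sup>2 + c\<^sup>2 - (a + (1/2) * (b + c))\<^sup>2 = (a - (b + c) / 2)\<^sup>2 + (b - c)\<^sup>2 / 2"
          by (simp add: power2_eq_square field_simps)
        moreover have "0 \<le> (a - (b + c) / 2)\<^sup>2 + (b - c)\<^sup>2 / 2" by simp
        ultimately show ?thesis by linarith
      qed
      then show ?thesis .
    qed
    finally show ?thesis by simp
  qed
  have "(\<Sum>i=1..m. (residual \<kappa> e i)\<^sup>2) \<le> (\<Sum>i=1..m. 2 * (d i)\<^sup>2 + (d (i-1))\<^sup>2 + (d (Suc i))\<^sup>2)"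
    using res by (rule sum_mono)
  also have "\<dots> = 2 * D + (\<Sum>i=1..m. (d (i-1))\<^sup>2) + (\<Sum>i=1..m. (d (Suc i))\<^sup>2)"
    by (simp add: sum.distrib sum_distrib_left[symmetric] D_def)
  also have "(\<Sum>i=1..m. (d (i-1))\<^sup>2) \<le> D" unfolding D_def using d by (rule sum_squares_shift)
  also have "(\<Sum>i=1..m. (d (Suc i))\<^sup>2) \<le> D" unfolding D_def using d by (rule sum_squares_shift)
  finally have R: "(\<Sum>i=1..m. (residual \<kappa> e i)\<^sup>2) \<le> 4 * D" by simp
  define E where "E = energy \<kappa> m e"
  have E0: "0 \<le> E" unfolding E_def using \<kappa> e by (rule energy_nonneg)
  \<comment> \<open>The energy pairs \<open>e\<close> with its residual. By Cauchy-Schwarz its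
    square is at most the Poincare bound 2 m^2 E times the residual bound 4 D; dividing by E gives E
    \<le> 8 m^2 D, the origin of the constant 8.\<close>
  have "E\<^sup>2 \<le> (\<Sum>i=1..m. (e i)\<^sup>2) * (\<Sum>i=1..m. (residual \<kappa> e i)\<^sup>2)"
    unfolding E_def energy_def by (rule Cauchy_Schwarz_ineq_sum)
  also have "\<dots> \<le> (2 * (real m)\<^sup>2 * E) * (4 * D)"
    using energy_lower_bound[OF \<kappa> e m] R E0 unfolding E_def
    by (intro mult_mono) (auto intro: sum_nonneg)
  finally have "E * E \<le> E * (8 * (real m)\<^sup>2 * D)" by (simp add: power2_eq_square algebra_simps)
  moreover have "0 \<le> D" by (simp add: D_def sum_nonneg)
  ultimately have "E \<le> 8 * (real m)\<^sup>2 * D"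
    using E0 by (cases "E = 0") auto
  then have "E / (8 * (real m)\<^sup>2) \<le> D" using m by (simp add: field_simps)
  moreover have "energy \<kappa> m f = E - D" using inc(3) by (simp add: E_def D_def d_def)
  ultimately show ?thesis unfolding f_def[symmetric] E_def[symmetric] by (simp add: algebra_simps)
qed

subsection \<open>Markov kernels on square-integrable functions\<close>

definition kernel_op :: "('a \<Rightarrow> 'a measure) \<Rightarrow> ('a \<Rightarrow> real) \<Rightarrow> 'a \<Rightarrow> real" where
  "kernel_op K f x = (\<integral>y. f y \<partial>K x)"

primrec kernel_ops :: "('a \<Rightarrow> 'a measure) list \<Rightarrow> ('a \<Rightarrow> real) \<Rightarrow> 'a \<Rightarrow> real" where
  "kernel_ops [] f = f"
| "kernel_ops (K # Ks) f = kernel_op K (kernel_ops Ks f)"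

definition bounded_measurable :: "'a measure \<Rightarrow> ('a \<Rightarrow> real) \<Rightarrow> bool" where
  "bounded_measurable M f \<longleftrightarrow> f \<in> borel_measurable M \<and> (\<exists>B. \<forall>x\<in>space M. \<bar>f x\<bar> \<le> B)"

text \<open>Detailed balance with nonnegative integrals, so that no integrability has to be checked
  when it is verified for the block updates.\<close>

definition reversible_kernel :: "'a measure \<Rightarrow> ('a \<Rightarrow> 'a measure) \<Rightarrow> bool" where
  "reversible_kernel M K \<longleftrightarrow> K \<in> M \<rightarrow>\<^sub>M prob_algebra M \<and>
     (\<forall>f\<in>borel_measurable M. \<forall>g\<in>borel_measurable M.
       (\<integral>\<^sup>+x. g x * (\<integral>\<^sup>+y. f y \<partial>K x) \<partial>M) = (\<integral>\<^sup>+x. f x * (\<integral>\<^sup>+y. g y \<partial>K x) \<partial>M))"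

lemma reversible_kernelD:
  assumes "reversible_kernel M K"
  shows "K \<in> M \<rightarrow>\<^sub>M prob_algebra M"
    and "f \<in> borel_measurable M \<Longrightarrow> g \<in> borel_measurable M \<Longrightarrow>
      (\<integral>\<^sup>+x. g x * (\<integral>\<^sup>+y. f y \<partial>K x) \<partial>M) = (\<integral>\<^sup>+x. f x * (\<integral>\<^sup>+y. g y \<partial>K x) \<partial>M)"
  using assms unfolding reversible_kernel_def by blast+

lemma kernel_ops_append: "kernel_ops (Ks @ Ls) f = kernel_ops Ks (kernel_ops Ls f)"
  by (induction Ks) auto

lemma markov_kernelD:
  assumes "K \<in> M \<rightarrow>\<^sub>M prob_algebra N" "x \<in> space M"
  shows "prob_space (K x)" "sets (K x) = sets N" "space (K x) = space N" "measurable (K x) L = measurable N L"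
  using measurable_space[OF assms] sets_eq_imp_space_eq[of "K x" N] measurable_cong_sets[of "K x" N L L]
  by (auto simp: space_prob_algebra)

lemma kernel_op_measurable[measurable]:
  assumes K: "K \<in> M \<rightarrow>\<^sub>M prob_algebra N" and f: "f \<in> borel_measurable N"
  shows "kernel_op K f \<in> borel_measurable M"
  unfolding kernel_op_def[abs_def]
  using measurable_compose[OF measurable_prob_algebraD[OF K] integral_measurable_subprob_algebra[OF f]] .

lemma bounded_measurable_integrable:
  assumes "bounded_measurable M f" "prob_space N" "sets N = sets M"
  shows "integrable N f"
proof -
  interpret N: prob_space N by fact
  obtain B where "f \<in> borel_measurable M" "\<And>x. x \<in> space M \<Longrightarrow> \<bar>f x\<bar> \<le> B"
    using assms by (auto simp: bounded_measurable_def)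
  then show ?thesis using assms sets_eq_imp_space_eq[OF assms(3)]
    by (intro N.integrable_const_bound[where B=B]) (auto cong: measurable_cong_sets)
qed

lemma bounded_measurable_kernel_op:
  assumes K: "K \<in> M \<rightarrow>\<^sub>M prob_algebra M" and f: "bounded_measurable M f"
  shows "bounded_measurable M (kernel_op K f)"
proof -
  obtain B where B: "f \<in> borel_measurable M" "\<And>x. x \<in> space M \<Longrightarrow> \<bar>f x\<bar> \<le> B"
    using f by (auto simp: bounded_measurable_def)
  have "\<bar>kernel_op K f x\<bar> \<le> B" if x: "x \<in> space M" for x
  proof -
    interpret Kx: prob_space "K x" using markov_kernelD[OF K x] by simp
    have int: "integrable (K x) f"
      using f markov_kernelD[OF K x] by (intro bounded_measurable_integrable)
    have "\<bar>kernel_op K f x\<bar> \<le> (\<integral>y. \<bar>f y\<bar> \<partial>K x)" unfolding kernel_op_def by (rule integral_abs_bound)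
    also have "\<dots> \<le> B"
      using int B(2) markov_kernelD[OF K x] by (intro Kx.integral_le_const) (auto)
    finally show ?thesis .
  qed
  then show ?thesis using K B(1) by (auto simp: bounded_measurable_def)
qed

lemma kernel_op_add_const:
  assumes K: "K \<in> M \<rightarrow>\<^sub>M prob_algebra M" and f: "bounded_measurable M f" and x: "x \<in> space M"
  shows "kernel_op K (\<lambda>y. f y + c) x = kernel_op K f x + c"
proof -
  interpret Kx: prob_space "K x" using markov_kernelD[OF K x] by simp
  have "integrable (K x) f" using f markov_kernelD[OF K x] by (intro bounded_measurable_integrable)
  then show ?thesis using Kx.prob_space by (simp add: kernel_op_def)
qed

lemma bounded_measurable_arith:
  assumes "bounded_measurable M f" "bounded_measurable M g"
  shows "bounded_measurable M (\<lambda>x. f x * g x)" "bounded_measurable M (\<lambda>x. f x + g x)"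
    "bounded_measurable M (\<lambda>x. f x - g x)"
proof -
  obtain B C where B: "f \<in> borel_measurable M" "\<And>x. x \<in> space M \<Longrightarrow> \<bar>f x\<bar> \<le> B"
    and C: "g \<in> borel_measurable M" "\<And>x. x \<in> space M \<Longrightarrow> \<bar>g x\<bar> \<le> C"
    using assms by (auto simp: bounded_measurable_def)
  have "\<bar>f x * g x\<bar> \<le> B * C" "\<bar>f x + g x\<bar> \<le> B + C" "\<bar>f x - g x\<bar> \<le> B + C" if "x \<in> space M" for x
    using B(2)[OF that] C(2)[OF that] by (auto simp: abs_mult intro!: mult_mono)
  then show "bounded_measurable M (\<lambda>x. f x * g x)" "bounded_measurable M (\<lambda>x. f x + g x)"
    "bounded_measurable M (\<lambda>x. f x - g x)"
    using B(1) C(1) unfolding bounded_measurable_def by (blast intro: borel_measurable_times borel_measurable_add borel_measurable_diff)+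
qed

lemma bounded_measurable_const: "bounded_measurable M (\<lambda>_. c)"
  by (auto simp: bounded_measurable_def)

text \<open>Testing detailed balance against the constant 1 gives invariance, as every
  \<open>K x\<close> has mass 1.\<close>

lemma reversible_kernel_bind:
  assumes "reversible_kernel M K" "prob_space M"
  shows "M \<bind> K = M"
proof -
  interpret prob_space M by fact
  have K: "K \<in> M \<rightarrow>\<^sub>M prob_algebra M" using assms(1) by (rule reversible_kernelD)
  show ?thesis
  proof (rule measure_eqI)
    show sets: "sets (M \<bind> K) = sets M"
      using markov_kernelD(2)[OF K] not_empty by (rule sets_bind)
    fix A assume "A \<in> sets (M \<bind> K)"
    then have A: "A \<in> sets M" by (simp add: sets)
    then have "(\<integral>\<^sup>+x. 1 * (\<integral>\<^sup>+y. indicator A y \<partial>K x) \<partial>M) = (\<integral>\<^sup>+x. indicator A x * (\<integral>\<^sup>+y. 1 \<partial>K x) \<partial>M)"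
      by (intro reversible_kernelD(2)[OF assms(1)]) auto
    also have "\<dots> = (\<integral>\<^sup>+x. indicator A x \<partial>M)"
      by (intro nn_integral_cong) (auto simp: prob_space.emeasure_space_1[OF markov_kernelD(1)[OF K]])
    finally have "(\<integral>\<^sup>+x. emeasure (K x) A \<partial>M) = emeasure M A"
      using A markov_kernelD(2)[OF K] by (simp cong: nn_integral_cong)
    then show "emeasure (M \<bind> K) A = emeasure M A"
      using emeasure_bind[OF not_empty measurable_prob_algebraD[OF K] A] by simp
  qed
qed

text \<open>Fubini for a kernel and a function of either sign. Integrability under the mixture gives
  integrability under \<open>N x\<close> for almost every x only, so positive and negative parts are
  integrated separately and then subtracted.\<close>

lemma integral_bind_integrable:
  fixes f :: "'b \<Rightarrow> real"
  assumes N[measurable]: "N \<in> M \<rightarrow>\<^sub>M subprob_algebra B" and f[measurable]: "f \<in> borel_measurable B"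
    and M: "space M \<noteq> {}" and int: "integrable (M \<bind> N) f"
  shows "AE x in M. integrable (N x) f" and "(\<integral>x. f x \<partial>(M \<bind> N)) = (\<integral>x. (\<integral>y. f y \<partial>N x) \<partial>M)"
    and "integrable M (\<lambda>x. \<integral>y. f y \<partial>N x)"
proof -
  have fN: "f \<in> borel_measurable (N x)" if "x \<in> space M" for x
    using that subprob_measurableD[OF N] by simp
  define p n where "p x = (\<integral>\<^sup>+y. ennreal (f y) \<partial>N x)" and "n x = (\<integral>\<^sup>+y. ennreal (- f y) \<partial>N x)" for x
  have [measurable]: "p \<in> borel_measurable M" "n \<in> borel_measurable M"
    unfolding p_def[abs_def] n_def[abs_def] by measurable
  have fin: "(\<integral>\<^sup>+x. (\<integral>\<^sup>+y. norm (f y) \<partial>N x) \<partial>M) < \<infinity>"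
    using int N by (subst nn_integral_bind[symmetric, where B=B]) (auto simp: integrable_iff_bounded)
  then have "AE x in M. (\<integral>\<^sup>+y. norm (f y) \<partial>N x) \<noteq> \<infinity>"
    by (intro nn_integral_PInf_AE) auto
  then show AE: "AE x in M. integrable (N x) f"
    using fN by (auto simp: integrable_iff_bounded top.not_eq_extremum)
  have P: "(\<integral>\<^sup>+x. p x \<partial>M) = (\<integral>\<^sup>+x. ennreal (f x) \<partial>(M \<bind> N))"
    and Ne: "(\<integral>\<^sup>+x. n x \<partial>M) = (\<integral>\<^sup>+x. ennreal (- f x) \<partial>(M \<bind> N))"
    unfolding p_def n_def by (subst nn_integral_bind[where B=B]; simp)+
  have "(\<integral>\<^sup>+x. p x \<partial>M) \<noteq> \<infinity>" "(\<integral>\<^sup>+x. n x \<partial>M) \<noteq> \<infinity>"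
    using int unfolding P Ne real_integrable_def by auto
  then have pn: "AE x in M. p x \<noteq> \<infinity>" "AE x in M. n x \<noteq> \<infinity>"
    and fin': "(\<integral>\<^sup>+x. p x \<partial>M) < \<infinity>" "(\<integral>\<^sup>+x. n x \<partial>M) < \<infinity>"
    using nn_integral_PInf_AE[of p M] nn_integral_PInf_AE[of n M] by (simp_all add: top.not_eq_extremum)
  have eqp: "AE x in M. p x = ennreal (enn2real (p x))" "AE x in M. n x = ennreal (enn2real (n x))"
    using pn by (auto simp: ennreal_enn2real_if)
  have I: "integrable M (\<lambda>x. enn2real (p x))" "integrable M (\<lambda>x. enn2real (n x))"
    using fin' nn_integral_cong_AE[OF eqp(1)] nn_integral_cong_AE[OF eqp(2)]
    by (auto intro!: integrableI_nonneg)
  have J: "(\<integral>x. enn2real (p x) \<partial>M) = enn2real (\<integral>\<^sup>+x. p x \<partial>M)" "(\<integral>x. enn2real (n x) \<partial>M) = enn2real (\<integral>\<^sup>+x. n x \<partial>M)"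
    using eqp by (auto intro!: enn2real_nn_integral_eq_integral[symmetric])
  have eq: "AE x in M. enn2real (p x) - enn2real (n x) = (\<integral>y. f y \<partial>N x)"
    using AE by eventually_elim (simp add: real_lebesgue_integral_def p_def n_def)
  have meas: "(\<lambda>x. \<integral>y. f y \<partial>N x) \<in> borel_measurable M" by measurable
  show "integrable M (\<lambda>x. \<integral>y. f y \<partial>N x)"
    using integrable_cong_AE[OF _ meas eq] I by auto
  have "(\<integral>x. f x \<partial>(M \<bind> N)) = (\<integral>x. enn2real (p x) - enn2real (n x) \<partial>M)"
    using int I J by (simp add: real_lebesgue_integral_def P Ne)
  also have "\<dots> = (\<integral>x. (\<integral>y. f y \<partial>N x) \<partial>M)"
    using eq meas by (intro integral_cong_AE) auto
  finally show "(\<integral>x. f x \<partial>(M \<bind> N)) = (\<integral>x. (\<integral>y. f y \<partial>N x) \<partial>M)" .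
qed

lemma Cauchy_Schwarz_integral:
  fixes f g :: "'a \<Rightarrow> real"
  assumes [simp]: "integrable M (\<lambda>x. (f x)\<^sup>2)" "integrable M (\<lambda>x. (g x)\<^sup>2)" "integrable M (\<lambda>x. f x * g x)"
  shows "(\<integral>x. f x * g x \<partial>M)\<^sup>2 \<le> (\<integral>x. (f x)\<^sup>2 \<partial>M) * (\<integral>x. (g x)\<^sup>2 \<partial>M)"
proof -
  define a b c where "a = (\<integral>x. (f x)\<^sup>2 \<partial>M)" and "b = (\<integral>x. f x * g x \<partial>M)" and "c = (\<integral>x. (g x)\<^sup>2 \<partial>M)"
  have quad: "0 \<le> a + 2 * t * b + t\<^sup>2 * c" for t
  proof -
    have "0 \<le> (\<integral>x. (f x + t * g x)\<^sup>2 \<partial>M)" by simp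
    also have "(\<lambda>x. (f x + t * g x)\<^sup>2) = (\<lambda>x. (f x)\<^sup>2 + 2 * t * (f x * g x) + t\<^sup>2 * (g x)\<^sup>2)"
      by (auto simp: power2_eq_square algebra_simps)
    also have "(\<integral>x. \<dots> x \<partial>M) = a + 2 * t * b + t\<^sup>2 * c" by (simp add: a_def b_def c_def)
    finally show ?thesis .
  qed
  have c0: "0 \<le> c" by (simp add: c_def)
  show ?thesis unfolding a_def[symmetric] b_def[symmetric] c_def[symmetric]
  proof (cases "c = 0")
    case True
    \<comment> \<open>With c = 0 the quadratic is affine in t, and this t would give it the value
      -1.\<close>
    then have "b = 0" using quad[of "- (a + 1) / (2 * b)"] by (cases "b = 0") (auto simp: field_simps)
    then show "b\<^sup>2 \<le> a * c" using True by simp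
  next
    case False
    then show "b\<^sup>2 \<le> a * c" using quad[of "- b / c"] c0 by (simp add: power2_eq_square field_simps)
  qed
qed

text \<open>Log-convexity makes the successive ratios nondecreasing, so a first ratio above s would
  force growth faster than s^j. That \<open>C\<close> disappears from the conclusion is the whole
  purpose.\<close>

lemma log_convex_ratio_bound:
  fixes v :: "nat \<Rightarrow> real"
  assumes nn: "\<And>j. 0 \<le> v j" and lc: "\<And>j. (v (Suc j))\<^sup>2 \<le> v j * v (Suc (Suc j))"
    and s: "0 < s" and bd: "\<And>j. v j \<le> C * s ^ j"
  shows "v 1 \<le> s * v 0"
proof (rule ccontr)
  assume "\<not> ?thesis"
  then have gt: "s * v 0 < v 1" by simp
  have v0: "0 < v 0"
  proof (rule ccontr)
    assume "\<not> 0 < v 0"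
    then have "v 0 = 0" using nn[of 0] by simp
    then show False using lc[of 0] gt by simp
  qed
  define t where "t = v 1 / v 0"
  have t: "s < t" using gt v0 by (simp add: t_def field_simps)
  \<comment> \<open>Positivity belongs to the induction, because \<open>v j\<close> has to be
    cancelled to compare consecutive ratios.\<close>
  have step: "0 < v j \<and> t * v j \<le> v (Suc j)" for j
  proof (induction j)
    case 0 then show ?case using v0 by (simp add: t_def)
  next
    case (Suc j)
    have pos: "0 < v (Suc j)" using Suc t s by (smt (verit) mult_pos_pos)
    have "t * v (Suc j) * v j \<le> v (Suc j) * v (Suc j)"
      using Suc pos by (simp add: mult.commute mult.left_commute)
    also have "\<dots> \<le> v (Suc (Suc j)) * v j" using lc[of j] by (simp add: power2_eq_square mult.commute)
    finally show ?case using pos Suc by simp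
  qed
  have grow: "t ^ j * v 0 \<le> v j" for j
  proof (induction j)
    case (Suc j)
    have "t ^ Suc j * v 0 \<le> t * v j" using Suc t s by (simp add: mult.assoc mult_left_mono)
    then show ?case using step[of j] by linarith
  qed simp
  have "(t / s) ^ j \<le> C / v 0" for j
    using grow[of j] bd[of j] v0 s by (simp add: power_divide field_simps)
  moreover obtain j where "C / v 0 < (t / s) ^ j"
    using real_arch_pow[of "t / s"] t s by auto
  ultimately show False by (meson not_less)
qed

context prob_space
begin

lemma bounded_measurable_integrable':
  "bounded_measurable M f \<Longrightarrow> integrable M f"
  using bounded_measurable_integrable[OF _ prob_space_axioms refl] .

lemma integral_reversible_kernel_op:
  assumes K: "reversible_kernel M K" and f: "bounded_measurable M f"
  shows "(\<integral>x. kernel_op K f x \<partial>M) = (\<integral>x. f x \<partial>M)"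
proof -
  have Km: "K \<in> M \<rightarrow>\<^sub>M prob_algebra M" using K by (rule reversible_kernelD)
  show ?thesis
    using integral_bind_integrable(2)[OF measurable_prob_algebraD[OF Km] _ not_empty, of f]
      reversible_kernel_bind[OF K prob_space_axioms] f bounded_measurable_integrable'[OF f]
    by (simp add: kernel_op_def bounded_measurable_def)
qed

text \<open>Bounded functions are made nonnegative by adding constants. The extra terms so created
  agree on both sides because the kernel preserves integrals.\<close>

lemma reversible_kernel_symmetric:
  assumes K: "reversible_kernel M K" and f: "bounded_measurable M f" and g: "bounded_measurable M g"
  shows "(\<integral>x. g x * kernel_op K f x \<partial>M) = (\<integral>x. kernel_op K g x * f x \<partial>M)"
proof -
  have Km: "K \<in> M \<rightarrow>\<^sub>M prob_algebra M" using K by (rule reversible_kernelD)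
  have nonneg: "(\<integral>x. g x * kernel_op K f x \<partial>M) = (\<integral>x. f x * kernel_op K g x \<partial>M)"
    if f: "bounded_measurable M f" "\<And>x. x \<in> space M \<Longrightarrow> 0 \<le> f x"
    and g: "bounded_measurable M g" "\<And>x. x \<in> space M \<Longrightarrow> 0 \<le> g x" for f g
  proof -
    have conv: "(\<integral>\<^sup>+x. ennreal (g x) * (\<integral>\<^sup>+y. ennreal (f y) \<partial>K x) \<partial>M) = ennreal (\<integral>x. g x * kernel_op K f x \<partial>M)"
      if f: "bounded_measurable M f" "\<And>x. x \<in> space M \<Longrightarrow> 0 \<le> f x"
      and g: "bounded_measurable M g" "\<And>x. x \<in> space M \<Longrightarrow> 0 \<le> g x" for f g
    proof -
      have k: "(\<integral>\<^sup>+y. ennreal (f y) \<partial>K x) = ennreal (kernel_op K f x)" "0 \<le> kernel_op K f x" if x: "x \<in> space M" for x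
      proof -
        have "AE y in K x. 0 \<le> f y" using f(2) markov_kernelD[OF Km x] by (intro AE_I2) auto
        then show "(\<integral>\<^sup>+y. ennreal (f y) \<partial>K x) = ennreal (kernel_op K f x)" "0 \<le> kernel_op K f x"
          using bounded_measurable_integrable[OF f(1)] markov_kernelD[OF Km x]
          by (auto simp: kernel_op_def nn_integral_eq_integral intro: integral_nonneg_AE)
      qed
      have "(\<integral>\<^sup>+x. ennreal (g x) * (\<integral>\<^sup>+y. ennreal (f y) \<partial>K x) \<partial>M) = (\<integral>\<^sup>+x. ennreal (g x * kernel_op K f x) \<partial>M)"
        using k g(2) by (intro nn_integral_cong) (simp add: ennreal_mult)
      also have "\<dots> = ennreal (\<integral>x. g x * kernel_op K f x \<partial>M)"
        using k g(2) bounded_measurable_integrable'[OF bounded_measurable_arith(1)[OF g(1) bounded_measurable_kernel_op[OF Km f(1)]]]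
        by (intro nn_integral_eq_integral) (auto intro!: AE_I2)
      finally show ?thesis .
    qed
    have "(\<lambda>x. ennreal (f x)) \<in> borel_measurable M" "(\<lambda>x. ennreal (g x)) \<in> borel_measurable M"
      using f g by (auto simp: bounded_measurable_def)
    then have "(\<integral>\<^sup>+x. ennreal (g x) * (\<integral>\<^sup>+y. ennreal (f y) \<partial>K x) \<partial>M) = (\<integral>\<^sup>+x. ennreal (f x) * (\<integral>\<^sup>+y. ennreal (g y) \<partial>K x) \<partial>M)"
      by (rule reversible_kernelD(2)[OF K])
    then have "ennreal (\<integral>x. g x * kernel_op K f x \<partial>M) = ennreal (\<integral>x. f x * kernel_op K g x \<partial>M)"
      using conv[of f g] conv[of g f] f g by simp
    moreover have nn: "0 \<le> (\<integral>x. u x * kernel_op K v x \<partial>M)" if "\<And>x. x \<in> space M \<Longrightarrow> 0 \<le> u x" "\<And>x. x \<in> space M \<Longrightarrow> 0 \<le> v x" for u v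
      using that markov_kernelD[OF Km] unfolding kernel_op_def
      by (intro integral_nonneg_AE AE_I2 mult_nonneg_nonneg) auto
    ultimately show ?thesis using ennreal_inj[OF nn[of g f] nn[of f g]] f(2) g(2) by blast
  qed
  obtain B C where B: "\<And>x. x \<in> space M \<Longrightarrow> \<bar>f x\<bar> \<le> B" and C: "\<And>x. x \<in> space M \<Longrightarrow> \<bar>g x\<bar> \<le> C"
    using f g by (auto simp: bounded_measurable_def)
  have expand: "(\<integral>x. (v x + c) * kernel_op K (\<lambda>y. u y + b) x \<partial>M) =
     (\<integral>x. v x * kernel_op K u x \<partial>M) + c * (\<integral>x. u x \<partial>M) + b * (\<integral>x. v x \<partial>M) + b * c"
    if u: "bounded_measurable M u" and v: "bounded_measurable M v" for u v b c
  proof -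
    note Ku = bounded_measurable_kernel_op[OF Km u]
    have "(\<integral>x. (v x + c) * kernel_op K (\<lambda>y. u y + b) x \<partial>M) =
        (\<integral>x. v x * kernel_op K u x + c * kernel_op K u x + b * v x + b * c \<partial>M)"
      by (intro Bochner_Integration.integral_cong refl) (subst kernel_op_add_const[OF Km u], auto simp: algebra_simps)
    also have "\<dots> = (\<integral>x. v x * kernel_op K u x \<partial>M) + c * (\<integral>x. kernel_op K u x \<partial>M) + b * (\<integral>x. v x \<partial>M) + b * c"
      using bounded_measurable_integrable'[OF bounded_measurable_arith(1)[OF v Ku]]
        bounded_measurable_integrable'[OF Ku] bounded_measurable_integrable'[OF v]
      by (simp add: prob_space)
    finally show ?thesis by (simp add: integral_reversible_kernel_op[OF K u])
  qed
  have "(\<integral>x. (g x + C) * kernel_op K (\<lambda>y. f y + B) x \<partial>M) = (\<integral>x. (f x + B) * kernel_op K (\<lambda>y. g y + C) x \<partial>M)"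
  proof (rule nonneg)
    show "bounded_measurable M (\<lambda>y. f y + B)" "bounded_measurable M (\<lambda>y. g y + C)"
      using bounded_measurable_arith(2)[OF f bounded_measurable_const]
        bounded_measurable_arith(2)[OF g bounded_measurable_const] by blast+
    show "0 \<le> f x + B" "0 \<le> g x + C" if "x \<in> space M" for x
      using B[OF that] C[OF that] by auto
  qed
  then show ?thesis unfolding expand[OF f g] expand[OF g f] by (simp add: mult.commute)
qed

lemma bounded_measurable_kernel_ops:
  assumes "\<forall>K\<in>set Ks. reversible_kernel M K" "bounded_measurable M f"
  shows "bounded_measurable M (kernel_ops Ks f)"
  using assms
proof (induction Ks)
  case (Cons K Ks)
  have "K \<in> M \<rightarrow>\<^sub>M prob_algebra M" using Cons.prems by (intro reversible_kernelD(1)) simp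
  then show ?case using Cons by (simp add: bounded_measurable_kernel_op)
qed simp

text \<open>Each factor is self-adjoint, but the factors need not commute, so passing to the adjoint
  reverses the list.\<close>

lemma kernel_ops_adjoint:
  assumes "\<forall>K\<in>set Ks. reversible_kernel M K" "bounded_measurable M f" "bounded_measurable M g"
  shows "(\<integral>x. g x * kernel_ops Ks f x \<partial>M) = (\<integral>x. kernel_ops (rev Ks) g x * f x \<partial>M)"
  using assms
proof (induction Ks arbitrary: g)
  case (Cons K Ks)
  have K: "reversible_kernel M K" using Cons by simp
  have "(\<integral>x. g x * kernel_ops (K # Ks) f x \<partial>M) = (\<integral>x. kernel_op K g x * kernel_ops Ks f x \<partial>M)"
    using Cons.prems by (simp add: reversible_kernel_symmetric bounded_measurable_kernel_ops)
  also have "\<dots> = (\<integral>x. kernel_ops (rev Ks) (kernel_op K g) x * f x \<partial>M)"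
    using Cons.prems by (intro Cons.IH) (simp_all add: bounded_measurable_kernel_op reversible_kernelD(1))
  finally show ?case by (simp add: kernel_ops_append)
qed simp

text \<open>With \<open>P\<close> the operator of the sweep and \<open>Q = P\<^sup>* P\<close>, self-adjointness makes \<open>\<parallel>Q\<^sup>j f\<parallel>\<^sup>2\<close> log-convex
  in \<open>j\<close>, so that its asymptotic rate of decay already bounds the first step.\<close>

lemma kernel_ops_contraction:
  assumes Ks: "\<forall>K\<in>set Ks. reversible_kernel M K" and f: "bounded_measurable M f" and r: "0 < r"
    and decay: "\<And>j. (\<integral>x. ((kernel_ops (rev Ks @ Ks) ^^ j) f x)\<^sup>2 \<partial>M) \<le> C * (r\<^sup>2) ^ j"
  shows "(\<integral>x. (kernel_ops Ks f x)\<^sup>2 \<partial>M) \<le> r * (\<integral>x. (f x)\<^sup>2 \<partial>M)"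
proof -
  define Q where "Q = kernel_ops (rev Ks @ Ks)"
  define v where "v j = (\<integral>x. ((Q ^^ j) f x)\<^sup>2 \<partial>M)" for j
  have all: "\<forall>K\<in>set (rev Ks @ Ks). reversible_kernel M K" using Ks by auto
  have Qb: "bounded_measurable M (Q h)" if "bounded_measurable M h" for h
    unfolding Q_def using all that by (rule bounded_measurable_kernel_ops)
  have Qj: "bounded_measurable M ((Q ^^ j) f)" for j
    by (induction j) (auto intro: f Qb)
  have Qsym: "(\<integral>x. g x * Q h x \<partial>M) = (\<integral>x. Q g x * h x \<partial>M)" if "bounded_measurable M g" "bounded_measurable M h" for g h
    using kernel_ops_adjoint[OF all that(2,1)] by (simp add: Q_def)
  have CS: "(\<integral>x. g x * h x \<partial>M)\<^sup>2 \<le> (\<integral>x. (g x)\<^sup>2 \<partial>M) * (\<integral>x. (h x)\<^sup>2 \<partial>M)"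
    if "bounded_measurable M g" "bounded_measurable M h" for g h
    using bounded_measurable_integrable'[OF bounded_measurable_arith(1)[OF that(1) that(1)]]
      bounded_measurable_integrable'[OF bounded_measurable_arith(1)[OF that(2) that(2)]]
      bounded_measurable_integrable'[OF bounded_measurable_arith(1)[OF that]]
    unfolding power2_eq_square[symmetric] by (rule Cauchy_Schwarz_integral)
  \<comment> \<open>Moving one Q across gives \<parallel>Q^(j+1) f\<parallel>^2 = <Q^j f, Q^(j+2)
    f>, and Cauchy-Schwarz applies.\<close>
  have lc: "(v (Suc j))\<^sup>2 \<le> v j * v (Suc (Suc j))" for j
  proof -
    have "v (Suc j) = (\<integral>x. Q ((Q ^^ j) f) x * (Q ^^ Suc j) f x \<partial>M)" by (simp add: v_def power2_eq_square)
    also have "\<dots> = (\<integral>x. (Q ^^ j) f x * (Q ^^ Suc (Suc j)) f x \<partial>M)"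
      using Qsym[OF Qj[of j] Qj[of "Suc j"]] by simp
    finally show ?thesis using CS[OF Qj[of j] Qj[of "Suc (Suc j)"]] by (simp add: v_def)
  qed
  have "v 1 \<le> r\<^sup>2 * v 0"
  proof (rule log_convex_ratio_bound[where C=C and v=v, OF _ lc])
    show "0 \<le> v j" for j by (simp add: v_def)
    show "0 < r\<^sup>2" using r by simp
    show "v j \<le> C * (r\<^sup>2) ^ j" for j using decay[of j] by (simp add: v_def Q_def)
  qed
  have P: "bounded_measurable M (kernel_ops Ks f)" using Ks f by (rule bounded_measurable_kernel_ops)
  \<comment> \<open>Pairing Q f with f costs one square root: the factor r^2 for the squared norm of
    Q f becomes r for the squared norm of P f.\<close>
  have "(\<integral>x. (kernel_ops Ks f x)\<^sup>2 \<partial>M) = (\<integral>x. Q f x * f x \<partial>M)"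
    using kernel_ops_adjoint[OF Ks f P] by (simp add: power2_eq_square Q_def kernel_ops_append)
  also have "\<dots> \<le> sqrt ((\<integral>x. Q f x * f x \<partial>M)\<^sup>2)" by simp
  also have "\<dots> \<le> sqrt (v 1 * v 0)"
    using CS[OF Qb[OF f] f] by (intro real_sqrt_le_mono) (simp add: v_def)
  also have "\<dots> \<le> sqrt (r\<^sup>2 * v 0 * v 0)"
    using \<open>v 1 \<le> r\<^sup>2 * v 0\<close> by (intro real_sqrt_le_mono mult_right_mono) (auto simp: v_def)
  also have "\<dots> = r * v 0"
    using r by (simp add: real_sqrt_mult v_def)
  finally show ?thesis by (simp add: v_def)
qed

end

section \<open>Square-integrable functions under an invariant kernel\<close>

definition square_integrable :: "'a measure \<Rightarrow> ('a \<Rightarrow> real) \<Rightarrow> bool" where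
  "square_integrable M f \<longleftrightarrow> f \<in> borel_measurable M \<and> integrable M (\<lambda>x. (f x)\<^sup>2)"

lemma square_integrable_add:
  assumes "square_integrable M f" "square_integrable M g"
  shows "square_integrable M (\<lambda>x. f x + g x)"
  unfolding square_integrable_def
proof
  note [measurable] = assms(1)[unfolded square_integrable_def, THEN conjunct1] assms(2)[unfolded square_integrable_def, THEN conjunct1]
  show "(\<lambda>x. f x + g x) \<in> borel_measurable M" by measurable
  show "integrable M (\<lambda>x. (f x + g x)\<^sup>2)"
  proof (rule Bochner_Integration.integrable_bound)
    show "integrable M (\<lambda>x. 2 * (f x)\<^sup>2 + 2 * (g x)\<^sup>2)"
      using assms by (auto simp: square_integrable_def)
    have "(a + b)\<^sup>2 \<le> 2 * a\<^sup>2 + 2 * b\<^sup>2" for a b :: real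
      using sum_squares_bound[of a b] by (simp add: power2_sum)
    then show "AE x in M. norm ((f x + g x)\<^sup>2) \<le> norm (2 * (f x)\<^sup>2 + 2 * (g x)\<^sup>2)" by simp
  qed measurable
qed

lemma square_integrable_uminus:
  "square_integrable M f \<Longrightarrow> square_integrable M (\<lambda>x. - f x)"
  by (auto simp: square_integrable_def)

lemma square_integrable_diff:
  assumes "square_integrable M f" "square_integrable M g"
  shows "square_integrable M (\<lambda>x. f x - g x)"
  using square_integrable_add[OF assms(1) square_integrable_uminus[OF assms(2)]] by simp

text \<open>Young's inequality. The weight of the main term tends to 1 with \<eta>, so a limit in
  \<eta> loses nothing of a contraction factor.\<close>

lemma power2_sum_le_weighted:
  fixes a b \<eta> :: real
  assumes "0 < \<eta>"
  shows "(a + b)\<^sup>2 \<le> (1 + \<eta>) * a\<^sup>2 + (1 + 1 / \<eta>) * b\<^sup>2"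
proof -
  have "(1 + \<eta>) * a\<^sup>2 + (1 + 1 / \<eta>) * b\<^sup>2 - (a + b)\<^sup>2 = (\<eta> * a - b)\<^sup>2 / \<eta>"
    using assms by (simp add: field_simps power2_eq_square)
  moreover have "0 \<le> (\<eta> * a - b)\<^sup>2 / \<eta>" using assms by simp
  ultimately show ?thesis by linarith
qed

lemma integral_power2_sum_le_weighted:
  assumes "square_integrable M f" "square_integrable M g" "0 < \<eta>"
  shows "(\<integral>x. (f x + g x)\<^sup>2 \<partial>M) \<le> (1 + \<eta>) * (\<integral>x. (f x)\<^sup>2 \<partial>M) + (1 + 1 / \<eta>) * (\<integral>x. (g x)\<^sup>2 \<partial>M)"
proof -
  have "(\<integral>x. (f x + g x)\<^sup>2 \<partial>M) \<le> (\<integral>x. (1 + \<eta>) * (f x)\<^sup>2 + (1 + 1 / \<eta>) * (g x)\<^sup>2 \<partial>M)"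
    using square_integrable_add[OF assms(1,2)] assms(1,2) power2_sum_le_weighted[OF assms(3)]
    by (intro integral_mono) (auto simp: square_integrable_def)
  also have "\<dots> = (1 + \<eta>) * (\<integral>x. (f x)\<^sup>2 \<partial>M) + (1 + 1 / \<eta>) * (\<integral>x. (g x)\<^sup>2 \<partial>M)"
    using assms(1,2) by (simp add: square_integrable_def)
  finally show ?thesis .
qed

context prob_space
begin

lemma square_integrable_const: "square_integrable M (\<lambda>_. c)"
  by (simp add: square_integrable_def)

lemma square_integrableD: "square_integrable M f \<Longrightarrow> integrable M f"
  by (auto simp: square_integrable_def intro: square_integrable_imp_integrable)

lemma bounded_measurable_square_integrable:
  "bounded_measurable M f \<Longrightarrow> square_integrable M f"
  using bounded_measurable_integrable'[OF bounded_measurable_arith(1)[of M f f]]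
  by (auto simp: square_integrable_def bounded_measurable_def power2_eq_square)

text \<open>The mean is the best constant approximation. A more convenient constant may thus take
  its place: the mean of an approximant, or the value at a fixed state.\<close>

lemma variance_le_second_moment:
  assumes "square_integrable M f"
  shows "(\<integral>x. (f x - (\<integral>y. f y \<partial>M))\<^sup>2 \<partial>M) \<le> (\<integral>x. (f x - c)\<^sup>2 \<partial>M)"
proof -
  have f: "integrable M f" "integrable M (\<lambda>x. (f x)\<^sup>2)"
    using assms square_integrableD[OF assms] by (simp_all add: square_integrable_def)
  have "(\<integral>x. (f x - c)\<^sup>2 \<partial>M) = (\<integral>x. (f x)\<^sup>2 \<partial>M) - 2 * c * (\<integral>x. f x \<partial>M) + c\<^sup>2"
    using f by (simp add: power2_diff prob_space algebra_simps)
  moreover have "(\<integral>x. (f x - (\<integral>y. f y \<partial>M))\<^sup>2 \<partial>M) = (\<integral>x. (f x)\<^sup>2 \<partial>M) - (\<integral>x. f x \<partial>M)\<^sup>2"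
    using f by (rule variance_eq)
  moreover have "0 \<le> ((\<integral>x. f x \<partial>M) - c)\<^sup>2" by simp
  ultimately show ?thesis by (simp add: power2_diff algebra_simps)
qed

context
  fixes K assumes K: "K \<in> M \<rightarrow>\<^sub>M prob_algebra M" and invariant: "M \<bind> K = M"
begin

text \<open>For unbounded f the integral under \<open>K x\<close> may fail to exist on a null set,
  where \<open>kernel_op\<close> takes the default value 0. Linearity of \<open>kernel_op\<close> is
  therefore available almost everywhere only.\<close>

lemma kernel_op_AE:
  assumes f: "integrable M f"
  shows "AE x in M. integrable (K x) f" "integrable M (kernel_op K f)"
    "(\<integral>x. kernel_op K f x \<partial>M) = (\<integral>x. f x \<partial>M)"
  using integral_bind_integrable[OF measurable_prob_algebraD[OF K] _ not_empty, of f] f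
  unfolding invariant kernel_op_def[abs_def] by auto

lemma square_integrable_kernel_op:
  assumes f: "square_integrable M f"
  shows "square_integrable M (kernel_op K f)" and "(\<integral>x. (kernel_op K f x)\<^sup>2 \<partial>M) \<le> (\<integral>x. (f x)\<^sup>2 \<partial>M)"
proof -
  have m[measurable]: "f \<in> borel_measurable M" and f2: "integrable M (\<lambda>x. (f x)\<^sup>2)"
    using f by (auto simp: square_integrable_def)
  note sq = kernel_op_AE[OF f2]
  \<comment> \<open>Jensen's inequality for the square is nonnegativity of the variance under
    \<open>K x\<close>.\<close>
  have jensen: "AE x in M. (kernel_op K f x)\<^sup>2 \<le> kernel_op K (\<lambda>x. (f x)\<^sup>2) x"
    using sq(1) kernel_op_AE(1)[OF square_integrableD[OF f]] AE_space
  proof eventually_elim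
    case (elim x)
    interpret Kx: prob_space "K x" using markov_kernelD[OF K] elim by simp
    have "0 \<le> Kx.variance f" by simp
    then show ?case using elim by (simp add: Kx.variance_eq kernel_op_def)
  qed
  have [measurable]: "kernel_op K f \<in> borel_measurable M" using K m by (rule kernel_op_measurable)
  have nn: "AE x in M. 0 \<le> kernel_op K (\<lambda>x. (f x)\<^sup>2) x" by (simp add: kernel_op_def)
  have int: "integrable M (\<lambda>x. (kernel_op K f x)\<^sup>2)"
  proof (rule Bochner_Integration.integrable_bound[OF sq(2)])
    show "AE x in M. norm ((kernel_op K f x)\<^sup>2) \<le> norm (kernel_op K (\<lambda>x. (f x)\<^sup>2) x)"
      using jensen nn by eventually_elim simp
  qed measurable
  then show "square_integrable M (kernel_op K f)" by (simp add: square_integrable_def)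
  show "(\<integral>x. (kernel_op K f x)\<^sup>2 \<partial>M) \<le> (\<integral>x. (f x)\<^sup>2 \<partial>M)"
    using integral_mono_AE[OF int sq(2) jensen] sq(3) by simp
qed

text \<open>The kernel does not increase the L^2 norm, so an approximation error is not amplified.
  An error of \<eta>^2 against the weight 1 + 1/\<eta> leaves \<eta>^2 + \<eta>, which vanishes as
  \<eta> tends to 0.\<close>

lemma variance_contraction_from_dense:
  assumes D: "\<And>g. g \<in> D \<Longrightarrow> bounded_measurable M g"
    and contr: "\<And>g. g \<in> D \<Longrightarrow> (\<integral>x. (kernel_op K g x - (\<integral>y. g y \<partial>M))\<^sup>2 \<partial>M) \<le> r * (\<integral>x. (g x - (\<integral>y. g y \<partial>M))\<^sup>2 \<partial>M)"
    and dense: "\<And>\<epsilon>. 0 < \<epsilon> \<Longrightarrow> \<exists>g\<in>D. (\<integral>x. (f x - g x)\<^sup>2 \<partial>M) < \<epsilon>"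
    and f: "square_integrable M f" and r: "0 \<le> r"
  shows "(\<integral>x. (kernel_op K f x - (\<integral>y. f y \<partial>M))\<^sup>2 \<partial>M) \<le> r * (\<integral>x. (f x - (\<integral>y. f y \<partial>M))\<^sup>2 \<partial>M)"
proof -
  define a where "a = (\<integral>x. (kernel_op K f x - (\<integral>y. f y \<partial>M))\<^sup>2 \<partial>M)"
  define V where "V = (\<integral>x. (f x - (\<integral>y. f y \<partial>M))\<^sup>2 \<partial>M)"
  have bound: "a \<le> (1 + \<eta>) * (r * ((1 + \<eta>) * V + (\<eta>\<^sup>2 + \<eta>))) + (\<eta>\<^sup>2 + \<eta>)" if \<eta>: "0 < \<eta>" for \<eta>
  proof -
    obtain g where g: "g \<in> D" and close: "(\<integral>x. (f x - g x)\<^sup>2 \<partial>M) < \<eta>\<^sup>2"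
      using dense[of "\<eta>\<^sup>2"] \<eta> by auto
    define d where "d x = f x - g x" for x
    have gs: "square_integrable M g" using D[OF g] by (rule bounded_measurable_square_integrable)
    have ds: "square_integrable M d" unfolding d_def using f gs by (rule square_integrable_diff)
    have small: "(1 + 1 / \<eta>) * (\<integral>x. (d x)\<^sup>2 \<partial>M) \<le> \<eta>\<^sup>2 + \<eta>"
    proof -
      have "(1 + 1 / \<eta>) * (\<integral>x. (d x)\<^sup>2 \<partial>M) \<le> (1 + 1 / \<eta>) * \<eta>\<^sup>2"
        using close \<eta> by (intro mult_left_mono) (auto simp: d_def)
      also have "\<dots> = \<eta>\<^sup>2 + \<eta>" using \<eta> by (simp add: field_simps power2_eq_square)
      finally show ?thesis .
    qed
    note Kd = square_integrable_kernel_op[OF ds] and Kf = square_integrable_kernel_op[OF f]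
      and Kg = square_integrable_kernel_op[OF gs]
    define c where "c = (\<integral>y. g y \<partial>M)"
    have lin: "AE x in M. kernel_op K f x - c = (kernel_op K g x - c) + kernel_op K d x"
      using kernel_op_AE(1)[OF square_integrableD[OF f]] kernel_op_AE(1)[OF square_integrableD[OF gs]]
      by eventually_elim (simp add: kernel_op_def d_def)
    have Kgc: "square_integrable M (\<lambda>x. kernel_op K g x - c)"
      using Kg(1) square_integrable_const by (rule square_integrable_diff)
    \<comment> \<open>By invariance the subtracted constant is the mean of
      \<open>kernel_op K f\<close> itself, so replacing it by the mean \<open>c\<close> of the
      approximant can only increase the integral.\<close>
    have "a = (\<integral>x. (kernel_op K f x - (\<integral>y. kernel_op K f y \<partial>M))\<^sup>2 \<partial>M)"
      using kernel_op_AE(3)[OF square_integrableD[OF f]] by (simp add: a_def)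
    also have "\<dots> \<le> (\<integral>x. (kernel_op K f x - c)\<^sup>2 \<partial>M)" using Kf(1) by (rule variance_le_second_moment)
    also have "\<dots> = (\<integral>x. ((kernel_op K g x - c) + kernel_op K d x)\<^sup>2 \<partial>M)"
    proof (rule integral_cong_AE)
      show "AE x in M. (kernel_op K f x - c)\<^sup>2 = ((kernel_op K g x - c) + kernel_op K d x)\<^sup>2"
        using lin by eventually_elim (simp only:)
    qed (use Kf(1) Kg(1) Kd(1) in \<open>auto simp: square_integrable_def\<close>)
    also have "\<dots> \<le> (1 + \<eta>) * (\<integral>x. (kernel_op K g x - c)\<^sup>2 \<partial>M) + (1 + 1 / \<eta>) * (\<integral>x. (kernel_op K d x)\<^sup>2 \<partial>M)"
      using Kgc Kd(1) \<eta> by (rule integral_power2_sum_le_weighted)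
    also have "(1 + 1 / \<eta>) * (\<integral>x. (kernel_op K d x)\<^sup>2 \<partial>M) \<le> (1 + 1 / \<eta>) * (\<integral>x. (d x)\<^sup>2 \<partial>M)"
      using Kd(2) \<eta> by (intro mult_left_mono) auto
    also note small
    also have "(\<integral>x. (kernel_op K g x - c)\<^sup>2 \<partial>M) \<le> r * (\<integral>x. (g x - c)\<^sup>2 \<partial>M)"
      unfolding c_def using g by (rule contr)
    also have "(\<integral>x. (g x - c)\<^sup>2 \<partial>M) \<le> (1 + \<eta>) * V + (\<eta>\<^sup>2 + \<eta>)"
    proof -
      have "(\<integral>x. (g x - c)\<^sup>2 \<partial>M) \<le> (\<integral>x. (g x - (\<integral>y. f y \<partial>M))\<^sup>2 \<partial>M)"
        unfolding c_def using gs by (rule variance_le_second_moment)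
      also have "\<dots> = (\<integral>x. ((f x - (\<integral>y. f y \<partial>M)) + - d x)\<^sup>2 \<partial>M)" by (simp add: d_def)
      also have "\<dots> \<le> (1 + \<eta>) * V + (1 + 1 / \<eta>) * (\<integral>x. (- d x)\<^sup>2 \<partial>M)"
        unfolding V_def using f ds \<eta>
        by (intro integral_power2_sum_le_weighted square_integrable_diff square_integrable_const square_integrable_uminus)
      finally show ?thesis using small by simp
    qed
    finally show ?thesis using \<eta> r by (simp add: mult_left_mono)
  qed
  have "((\<lambda>\<eta>. (1 + \<eta>) * (r * ((1 + \<eta>) * V + (\<eta>\<^sup>2 + \<eta>))) + (\<eta>\<^sup>2 + \<eta>)) \<longlongrightarrow>
      (1 + 0) * (r * ((1 + 0) * V + (0\<^sup>2 + 0))) + (0\<^sup>2 + 0)) (at_right 0)"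
    by (intro tendsto_intros)
  then have "a \<le> (1 + 0) * (r * ((1 + 0) * V + (0\<^sup>2 + 0))) + (0\<^sup>2 + 0)"
    by (rule tendsto_lowerbound) (auto simp: eventually_at_right_field intro!: bound exI[of _ 1])
  then show ?thesis by (simp add: a_def V_def)
qed

lemma kernel_pow_measurable: "kernel_pow M K n \<in> M \<rightarrow>\<^sub>M prob_algebra M"
proof (induction n)
  case 0
  have "kernel_pow M K 0 = return M" by (rule ext) simp
  then show ?case by (simp add: measurable_return_prob_space)
next
  case (Suc n)
  have "kernel_pow M K (Suc n) = (\<lambda>x. kernel_pow M K n x \<bind> K)" by (rule ext) simp
  then show ?case using measurable_bind_prob_space[OF Suc K] by simp
qed

lemma kernel_pow_invariant: "M \<bind> kernel_pow M K n = M"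
proof (induction n)
  case 0
  have "kernel_pow M K 0 = return M" by (rule ext) simp
  then show ?case by (simp add: bind_return'')
next
  case (Suc n)
  have "kernel_pow M K (Suc n) = (\<lambda>x. kernel_pow M K n x \<bind> K)" by (rule ext) simp
  then show ?case
    using bind_assoc[OF measurable_prob_algebraD[OF kernel_pow_measurable[of n]] measurable_prob_algebraD[OF K]] Suc invariant
    by simp
qed

text \<open>\<open>kernel_pow\<close> appends its new step at the far end, so that step can be
  absorbed into the function. This allows an induction on n over all square-integrable f, whose mean
  the kernel preserves.\<close>

lemma kernel_apply_Suc:
  assumes f: "integrable M f"
  shows "AE x in M. kernel_apply M K (Suc n) f x = kernel_apply M K n (kernel_op K f) x"
proof -
  have [measurable]: "f \<in> borel_measurable M" using f by simp
  have "AE x in M. integrable (kernel_pow M K (Suc n) x) f"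
    using integral_bind_integrable(1)[OF measurable_prob_algebraD[OF kernel_pow_measurable[of "Suc n"]] _ not_empty, of f] f
    unfolding kernel_pow_invariant by simp
  then show ?thesis using AE_space
  proof eventually_elim
    case (elim x)
    note kp = markov_kernelD[OF kernel_pow_measurable[of n] elim(2)]
    have "K \<in> kernel_pow M K n x \<rightarrow>\<^sub>M subprob_algebra M"
      using measurable_prob_algebraD[OF K] by (simp add: kp(4))
    moreover have "space (kernel_pow M K n x) \<noteq> {}" using kp(3) not_empty by simp
    ultimately show ?case
      using integral_bind_integrable(2)[of K "kernel_pow M K n x" M f] elim(1)
      by (simp add: kernel_apply_def kernel_op_def)
  qed
qed

lemma l2_rate_ok_from_variance_contraction:
  assumes r: "0 < r"
    and contr: "\<And>f. square_integrable M f \<Longrightarrow>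
      (\<integral>x. (kernel_op K f x - (\<integral>y. f y \<partial>M))\<^sup>2 \<partial>M) \<le> r * (\<integral>x. (f x - (\<integral>y. f y \<partial>M))\<^sup>2 \<partial>M)"
  shows "l2_rate_ok M K r"
proof -
  have decay: "(\<integral>\<^sup>+x. ennreal ((kernel_apply M K n f x - (\<integral>y. f y \<partial>M))\<^sup>2) \<partial>M)
      \<le> ennreal (r ^ n * (\<integral>x. (f x - (\<integral>y. f y \<partial>M))\<^sup>2 \<partial>M))" if "square_integrable M f" for n f
    using that
  proof (induction n arbitrary: f)
    case 0
    have "f \<in> borel_measurable M" using 0 by (simp add: square_integrable_def)
    then have "(\<integral>\<^sup>+x. ennreal ((kernel_apply M K 0 f x - (\<integral>y. f y \<partial>M))\<^sup>2) \<partial>M)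
      = (\<integral>\<^sup>+x. ennreal ((f x - (\<integral>y. f y \<partial>M))\<^sup>2) \<partial>M)"
      by (intro nn_integral_cong) (simp add: kernel_apply_def integral_return)
    also have "\<dots> = ennreal (\<integral>x. (f x - (\<integral>y. f y \<partial>M))\<^sup>2 \<partial>M)"
      using square_integrable_diff[OF 0 square_integrable_const]
      by (intro nn_integral_eq_integral) (auto simp: square_integrable_def)
    finally show ?case by simp
  next
    case (Suc n)
    note Kf = square_integrable_kernel_op(1)[OF Suc.prems] and int = square_integrableD[OF Suc.prems]
    have "(\<integral>\<^sup>+x. ennreal ((kernel_apply M K (Suc n) f x - (\<integral>y. f y \<partial>M))\<^sup>2) \<partial>M)
      = (\<integral>\<^sup>+x. ennreal ((kernel_apply M K n (kernel_op K f) x - (\<integral>y. kernel_op K f y \<partial>M))\<^sup>2) \<partial>M)"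
    proof (rule nn_integral_cong_AE)
      show "AE x in M. ennreal ((kernel_apply M K (Suc n) f x - (\<integral>y. f y \<partial>M))\<^sup>2)
          = ennreal ((kernel_apply M K n (kernel_op K f) x - (\<integral>y. kernel_op K f y \<partial>M))\<^sup>2)"
        using kernel_apply_Suc[OF int, of n] by eventually_elim (simp only: kernel_op_AE(3)[OF int])
    qed
    also have "\<dots> \<le> ennreal (r ^ n * (\<integral>x. (kernel_op K f x - (\<integral>y. kernel_op K f y \<partial>M))\<^sup>2 \<partial>M))"
      by (rule Suc.IH[OF Kf])
    also have "\<dots> \<le> ennreal (r ^ n * (r * (\<integral>x. (f x - (\<integral>y. f y \<partial>M))\<^sup>2 \<partial>M)))"
      using contr[OF Suc.prems] r by (intro ennreal_leI mult_left_mono) (auto simp: kernel_op_AE(3)[OF int])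
    finally show ?case by (simp add: mult_ac)
  qed
  show ?thesis unfolding l2_rate_ok_def
  proof (intro allI impI)
    fix f :: "'a \<Rightarrow> real" and r' assume f: "f \<in> borel_measurable M \<and> integrable M (\<lambda>x. (f x)\<^sup>2)" and r': "r < r'"
    define V where "V = (\<integral>x. (f x - (\<integral>y. f y \<partial>M))\<^sup>2 \<partial>M)"
    have V: "0 \<le> V" by (simp add: V_def)
    have sq: "square_integrable M f" using f by (simp add: square_integrable_def)
    show "\<exists>V>0. \<forall>n. 0 \<le> V * r' ^ n \<and>
        (\<integral>\<^sup>+x. ennreal ((kernel_apply M K n f x - (\<integral>y. f y \<partial>M))\<^sup>2) \<partial>M) \<le> ennreal (V * r' ^ n)"
    \<comment> \<open>V + 1 rather than V: a positive constant is demanded even if f is constant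
      almost everywhere.\<close>
    proof (intro exI[of _ "V + 1"] conjI allI)
      fix n
      show "0 \<le> (V + 1) * r' ^ n" using V r r' by simp
      have "r ^ n * V \<le> (V + 1) * r' ^ n"
        using V r r' by (subst mult.commute, intro mult_mono power_mono) auto
      then show "(\<integral>\<^sup>+x. ennreal ((kernel_apply M K n f x - (\<integral>y. f y \<partial>M))\<^sup>2) \<partial>M) \<le> ennreal ((V + 1) * r' ^ n)"
        using decay[OF sq, of n] unfolding V_def[symmetric] by (meson ennreal_leI order_trans)
    qed (use V in simp)
  qed
qed

end

end

text \<open>The clause \<open>0 \<le> V * r ^ n\<close> of \<open>l2_rate_ok\<close> excludes
  negative rates: \<rho>/2 would be an admissible r above \<rho> and fails at n = 1. So the infimum
  is taken over a nonempty set bounded below by 0.\<close>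

lemma l2_rate_bounds:
  assumes "l2_rate_ok M K r"
  shows "0 \<le> l2_rate M K" "l2_rate M K \<le> r"
proof -
  have nonneg: "0 \<le> \<rho>" if "l2_rate_ok M K \<rho>" for \<rho>
  proof (rule ccontr)
    assume "\<not> 0 \<le> \<rho>"
    then have "\<rho> < \<rho> / 2" "\<rho> / 2 < 0" by auto
    have "(\<lambda>_. 0::real) \<in> borel_measurable M \<and> integrable M (\<lambda>_. (0::real)\<^sup>2)" by simp
    from that[unfolded l2_rate_ok_def, THEN spec, THEN mp, OF this, THEN spec, THEN mp, OF \<open>\<rho> < \<rho> / 2\<close>]
    obtain V where "0 < V" "\<forall>n. 0 \<le> V * (\<rho> / 2) ^ n" by blast
    from this(2)[rule_format, of 1] show False using \<open>0 < V\<close> \<open>\<rho> / 2 < 0\<close>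
      by (simp add: zero_le_mult_iff)
  qed
  show "0 \<le> l2_rate M K" unfolding l2_rate_def using assms nonneg by (intro cInf_greatest) auto
  show "l2_rate M K \<le> r" unfolding l2_rate_def using assms nonneg by (intro cInf_lower bdd_belowI[of _ 0]) auto
qed

subsection \<open>Density of bounded Lipschitz functions\<close>

definition bounded_lipschitz :: "nat set \<Rightarrow> (nat \<Rightarrow> real) measure \<Rightarrow> ((nat \<Rightarrow> real) \<Rightarrow> real) \<Rightarrow> bool" where
  "bounded_lipschitz I M g \<longleftrightarrow> bounded_measurable M g \<and>
     (\<exists>C\<ge>0. \<forall>x\<in>space M. \<forall>y\<in>space M. \<bar>g x - g y\<bar> \<le> C * (\<Sum>i\<in>I. \<bar>x i - y i\<bar>))"

text \<open>Composition with a Lipschitz map of the plane, to be used for linear combinations and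
  for the maximum.\<close>

lemma bounded_lipschitz_combine:
  assumes f: "bounded_lipschitz I M f" and g: "bounded_lipschitz I M g"
    and meas: "(\<lambda>x. \<phi> (f x) (g x)) \<in> borel_measurable M"
    and \<phi>: "\<And>a b a' b'. \<bar>\<phi> a b - \<phi> a' b'\<bar> \<le> L * (\<bar>a - a'\<bar> + \<bar>b - b'\<bar>)" and L: "0 \<le> L"
  shows "bounded_lipschitz I M (\<lambda>x. \<phi> (f x) (g x))"
proof -
  obtain B C where B: "\<And>x. x \<in> space M \<Longrightarrow> \<bar>f x\<bar> \<le> B" and C: "\<And>x. x \<in> space M \<Longrightarrow> \<bar>g x\<bar> \<le> C"
    using f g by (auto simp: bounded_lipschitz_def bounded_measurable_def)
  obtain b c where b: "0 \<le> b" "\<And>x y. x \<in> space M \<Longrightarrow> y \<in> space M \<Longrightarrow> \<bar>f x - f y\<bar> \<le> b * (\<Sum>i\<in>I. \<bar>x i - y i\<bar>)"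
    and c: "0 \<le> c" "\<And>x y. x \<in> space M \<Longrightarrow> y \<in> space M \<Longrightarrow> \<bar>g x - g y\<bar> \<le> c * (\<Sum>i\<in>I. \<bar>x i - y i\<bar>)"
    using f g unfolding bounded_lipschitz_def by blast
  have "\<bar>\<phi> (f x) (g x)\<bar> \<le> L * (B + C) + \<bar>\<phi> 0 0\<bar>" if "x \<in> space M" for x
  proof -
    have "\<bar>\<phi> (f x) (g x) - \<phi> 0 0\<bar> \<le> L * (\<bar>f x\<bar> + \<bar>g x\<bar>)" using \<phi>[of "f x" "g x" 0 0] by simp
    also have "\<dots> \<le> L * (B + C)" using B[OF that] C[OF that] L by (intro mult_left_mono add_mono)
    finally show ?thesis by linarith
  qed
  moreover have "\<bar>\<phi> (f x) (g x) - \<phi> (f y) (g y)\<bar> \<le> (L * (b + c)) * (\<Sum>i\<in>I. \<bar>x i - y i\<bar>)"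
    if "x \<in> space M" "y \<in> space M" for x y
  proof -
    have "\<bar>\<phi> (f x) (g x) - \<phi> (f y) (g y)\<bar> \<le> L * (\<bar>f x - f y\<bar> + \<bar>g x - g y\<bar>)" by (rule \<phi>)
    also have "\<dots> \<le> L * (b * (\<Sum>i\<in>I. \<bar>x i - y i\<bar>) + c * (\<Sum>i\<in>I. \<bar>x i - y i\<bar>))"
      using b(2)[OF that] c(2)[OF that] L by (intro mult_left_mono add_mono)
    finally show ?thesis by (simp add: algebra_simps)
  qed
  moreover have "0 \<le> L * (b + c)" using L b c by simp
  ultimately show ?thesis using meas unfolding bounded_lipschitz_def bounded_measurable_def by blast
qed

lemma bounded_lipschitz_const: "bounded_lipschitz I M (\<lambda>_. c)"
  by (auto simp: bounded_lipschitz_def bounded_measurable_const intro!: exI[of _ 0])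

lemma bounded_lipschitz_measurable: "bounded_lipschitz I M g \<Longrightarrow> g \<in> borel_measurable M"
  by (simp add: bounded_lipschitz_def bounded_measurable_def)

lemma bounded_lipschitz_lincomb:
  assumes "bounded_lipschitz I M f" "bounded_lipschitz I M g"
  shows "bounded_lipschitz I M (\<lambda>x. a * f x + b * g x)"
proof (rule bounded_lipschitz_combine[OF assms, where \<phi>="\<lambda>u v. a * u + b * v" and L="\<bar>a\<bar> + \<bar>b\<bar>"])
  show "(\<lambda>x. a * f x + b * g x) \<in> borel_measurable M"
    using assms[THEN bounded_lipschitz_measurable] by measurable
  fix u v u' v' :: real
  have "\<bar>a * u + b * v - (a * u' + b * v')\<bar> = \<bar>a * (u - u') + b * (v - v')\<bar>" by (simp add: algebra_simps)
  also have "\<dots> \<le> \<bar>a\<bar> * \<bar>u - u'\<bar> + \<bar>b\<bar> * \<bar>v - v'\<bar>" by (metis abs_mult abs_triangle_ineq)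
  also have "\<dots> \<le> (\<bar>a\<bar> + \<bar>b\<bar>) * (\<bar>u - u'\<bar> + \<bar>v - v'\<bar>)" by (simp add: algebra_simps)
  finally show "\<bar>a * u + b * v - (a * u' + b * v')\<bar> \<le> (\<bar>a\<bar> + \<bar>b\<bar>) * (\<bar>u - u'\<bar> + \<bar>v - v'\<bar>)" .
qed simp

text \<open>Only the sigma-algebra is that of a product. \<open>M\<close> is an arbitrary
  probability on it, as the knots are correlated under the bridge law.\<close>

locale product_prob = prob_space M for M :: "(nat \<Rightarrow> real) measure" +
  fixes I :: "nat set"
  assumes finite_I: "finite I" and sets_M: "sets M = sets (Pi\<^sub>M I (\<lambda>_. borel :: real measure))"
begin

lemma space_M: "space M = (\<Pi>\<^sub>E i\<in>I. UNIV)"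
  using sets_eq_imp_space_eq[OF sets_M] by (simp add: space_PiM)

lemma component_measurable: "i \<in> I \<Longrightarrow> (\<lambda>x. x i) \<in> borel_measurable M"
  using measurable_component_singleton[of i I "\<lambda>_. borel :: real measure"]
  by (simp add: measurable_cong_sets[OF sets_M refl])

text \<open>Approximation is in L^1, where the errors of a union add up. The range [0, 1] bounds the
  squared error by the absolute error, so approximation in L^2 follows.\<close>

definition lipschitz_approximable :: "(nat \<Rightarrow> real) set \<Rightarrow> bool" where
  "lipschitz_approximable S \<longleftrightarrow> S \<in> sets M \<and>
    (\<forall>\<epsilon>>0. \<exists>g. bounded_lipschitz I M g \<and> (\<forall>x\<in>space M. 0 \<le> g x \<and> g x \<le> 1) \<and> (\<integral>x. \<bar>indicator S x - g x\<bar> \<partial>M) < \<epsilon>)"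

lemma integrable_indicator_event: "S \<in> sets M \<Longrightarrow> integrable M (indicator S :: _ \<Rightarrow> real)"
  by (simp add: integrable_real_indicator emeasure_finite top.not_eq_extremum[symmetric])

lemma integrable_indicator_diff:
  "S \<in> sets M \<Longrightarrow> bounded_lipschitz I M g \<Longrightarrow> integrable M (\<lambda>x. indicator S x - g x)"
  using bounded_measurable_integrable'[of g]
  by (auto simp: bounded_lipschitz_def intro!: Bochner_Integration.integrable_diff integrable_indicator_event)

lemma lipschitz_approximable_compl:
  assumes "lipschitz_approximable S"
  shows "lipschitz_approximable (space M - S)"
  unfolding lipschitz_approximable_def
proof (intro conjI allI impI)
  show "space M - S \<in> sets M" using assms by (auto simp: lipschitz_approximable_def)
  fix \<epsilon> :: real assume "0 < \<epsilon>"
  then obtain g where g: "bounded_lipschitz I M g" "\<forall>x\<in>space M. 0 \<le> g x \<and> g x \<le> 1"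
    "(\<integral>x. \<bar>indicator S x - g x\<bar> \<partial>M) < \<epsilon>"
    using assms unfolding lipschitz_approximable_def by blast
  have "(\<integral>x. \<bar>indicator (space M - S) x - (1 - g x)\<bar> \<partial>M) = (\<integral>x. \<bar>indicator S x - g x\<bar> \<partial>M)"
    by (intro Bochner_Integration.integral_cong) (auto simp: indicator_def)
  moreover have "bounded_lipschitz I M (\<lambda>x. 1 - g x)"
    using bounded_lipschitz_lincomb[OF bounded_lipschitz_const[of I M 1] g(1), of 1 "-1"] by simp
  ultimately show "\<exists>g. bounded_lipschitz I M g \<and> (\<forall>x\<in>space M. 0 \<le> g x \<and> g x \<le> 1) \<and>
      (\<integral>x. \<bar>indicator (space M - S) x - g x\<bar> \<partial>M) < \<epsilon>"
    using g by (intro exI[of _ "\<lambda>x. 1 - g x"]) auto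
qed

lemma lipschitz_approximable_Un:
  assumes "lipschitz_approximable S" "lipschitz_approximable S'"
  shows "lipschitz_approximable (S \<union> S')"
  unfolding lipschitz_approximable_def
proof (intro conjI allI impI)
  have meas: "S \<in> sets M" "S' \<in> sets M" using assms by (auto simp: lipschitz_approximable_def)
  then show SS: "S \<union> S' \<in> sets M" by auto
  fix \<epsilon> :: real assume "0 < \<epsilon>"
  then have "0 < \<epsilon> / 2" by simp
  obtain g where g: "bounded_lipschitz I M g" "\<forall>x\<in>space M. 0 \<le> g x \<and> g x \<le> 1"
    "(\<integral>x. \<bar>indicator S x - g x\<bar> \<partial>M) < \<epsilon> / 2"
    using assms(1) \<open>0 < \<epsilon> / 2\<close> unfolding lipschitz_approximable_def by blast
  obtain h where h: "bounded_lipschitz I M h" "\<forall>x\<in>space M. 0 \<le> h x \<and> h x \<le> 1"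
    "(\<integral>x. \<bar>indicator S' x - h x\<bar> \<partial>M) < \<epsilon> / 2"
    using assms(2) \<open>0 < \<epsilon> / 2\<close> unfolding lipschitz_approximable_def by blast
  have gh: "bounded_lipschitz I M (\<lambda>x. max (g x) (h x))"
  proof (rule bounded_lipschitz_combine[OF g(1) h(1), where L=1])
    show "(\<lambda>x. max (g x) (h x)) \<in> borel_measurable M"
      using g(1) h(1) by (intro borel_measurable_max) (auto dest: bounded_lipschitz_measurable)
  qed auto
  have int: "integrable M (\<lambda>x. \<bar>indicator S x - g x\<bar>)" "integrable M (\<lambda>x. \<bar>indicator S' x - h x\<bar>)"
    using integrable_indicator_diff meas g h by auto
  have "(\<integral>x. \<bar>indicator (S \<union> S') x - max (g x) (h x)\<bar> \<partial>M)
      \<le> (\<integral>x. \<bar>indicator S x - g x\<bar> + \<bar>indicator S' x - h x\<bar> \<partial>M)"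
  proof (rule integral_mono)
    show "integrable M (\<lambda>x. \<bar>indicator (S \<union> S') x - max (g x) (h x)\<bar>)"
      using integrable_indicator_diff[OF SS gh] by simp
    show "integrable M (\<lambda>x. \<bar>indicator S x - g x\<bar> + \<bar>indicator S' x - h x\<bar>)" using int by simp
    show "\<bar>indicator (S \<union> S') x - max (g x) (h x)\<bar> \<le> \<bar>indicator S x - g x\<bar> + \<bar>indicator S' x - h x\<bar>"
      if "x \<in> space M" for x
    proof -
      have "indicator (S \<union> S') x = max (indicator S x) (indicator S' x :: real)" by (auto simp: indicator_def)
      then show ?thesis by linarith
    qed
  qed
  also have "\<dots> < \<epsilon>" using int g(3) h(3) by simp
  finally show "\<exists>g. bounded_lipschitz I M g \<and> (\<forall>x\<in>space M. 0 \<le> g x \<and> g x \<le> 1) \<and>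
      (\<integral>x. \<bar>indicator (S \<union> S') x - g x\<bar> \<partial>M) < \<epsilon>"
    using gh g(2) h(2) by (intro exI[of _ "\<lambda>x. max (g x) (h x)"]) (auto simp: le_max_iff_disj)
qed

lemma lipschitz_approximable_UN:
  assumes A: "\<And>n::nat. lipschitz_approximable (A n)"
  shows "lipschitz_approximable (\<Union>n. A n)"
  unfolding lipschitz_approximable_def
proof (intro conjI allI impI)
  define U where "U n = (\<Union>i\<le>n. A i)" for n
  have U: "lipschitz_approximable (U n)" for n
  proof (induction n)
    case (Suc n)
    then show ?case using lipschitz_approximable_Un[OF A[of "Suc n"] Suc] by (simp add: U_def atMost_Suc)
  qed (use A[of 0] in \<open>simp add: U_def\<close>)
  have Um: "U n \<in> sets M" for n using U by (auto simp: lipschitz_approximable_def)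
  have UA: "(\<Union>n. U n) = (\<Union>n. A n)" by (auto simp: U_def)
  show meas: "(\<Union>n. A n) \<in> sets M" using Um UA by (metis sets.countable_UN range_subsetD image_subset_iff UNIV_I)
  fix \<epsilon> :: real assume "0 < \<epsilon>"
  \<comment> \<open>Continuity from below: some finite union already has nearly the full measure,
    and finite unions are approximable.\<close>
  have "incseq U" unfolding incseq_def U_def by (intro allI impI UN_mono) auto
  then have "(\<lambda>n. measure M (U n)) \<longlonglongrightarrow> measure M (\<Union>n. A n)"
    using finite_Lim_measure_incseq[of U] Um UA by auto
  then have "eventually (\<lambda>n. measure M (\<Union>n. A n) - \<epsilon> / 2 < measure M (U n)) sequentially"
    using \<open>0 < \<epsilon>\<close> by (intro order_tendstoD) auto
  then obtain n where n: "measure M (\<Union>n. A n) - \<epsilon> / 2 < measure M (U n)"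
    by (auto simp: eventually_sequentially)
  obtain g where g: "bounded_lipschitz I M g" "\<forall>x\<in>space M. 0 \<le> g x \<and> g x \<le> 1"
    "(\<integral>x. \<bar>indicator (U n) x - g x\<bar> \<partial>M) < \<epsilon> / 2"
    using U[of n] \<open>0 < \<epsilon>\<close> unfolding lipschitz_approximable_def by (metis half_gt_zero)
  have sub: "U n \<subseteq> (\<Union>n. A n)" by (auto simp: U_def)
  have int: "integrable M (\<lambda>x. \<bar>indicator (U n) x - g x\<bar>)" "integrable M (indicator (U n) :: _ \<Rightarrow> real)"
    "integrable M (indicator (\<Union>n. A n) :: _ \<Rightarrow> real)"
    using integrable_indicator_diff[OF Um[of n] g(1)] Um meas by (auto intro!: integrable_indicator_event)
  have "(\<integral>x. \<bar>indicator (\<Union>n. A n) x - g x\<bar> \<partial>M)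
      \<le> (\<integral>x. (indicator (\<Union>n. A n) x - indicator (U n) x) + \<bar>indicator (U n) x - g x\<bar> \<partial>M)"
  proof (rule integral_mono)
    show "integrable M (\<lambda>x. \<bar>indicator (\<Union>n. A n) x - g x\<bar>)"
      using integrable_indicator_diff[OF meas g(1)] by simp
    show "integrable M (\<lambda>x. (indicator (\<Union>n. A n) x - indicator (U n) x) + \<bar>indicator (U n) x - g x\<bar>)"
      using int by auto
    show "\<bar>indicator (\<Union>n. A n) x - g x\<bar> \<le> (indicator (\<Union>n. A n) x - indicator (U n) x) + \<bar>indicator (U n) x - g x\<bar>" for x
    proof -
      have "indicator (U n) x \<le> (indicator (\<Union>n. A n) x :: real)" using sub by (auto simp: indicator_def)
      then show ?thesis by linarith
    qed
  qed
  also have "\<dots> = measure M (\<Union>n. A n) - measure M (U n) + (\<integral>x. \<bar>indicator (U n) x - g x\<bar> \<partial>M)"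
    using int Um meas by simp
  also have "\<dots> < \<epsilon>" using n g(3) by linarith
  finally show "\<exists>g. bounded_lipschitz I M g \<and> (\<forall>x\<in>space M. 0 \<le> g x \<and> g x \<le> 1) \<and>
      (\<integral>x. \<bar>indicator (\<Union>n. A n) x - g x\<bar> \<partial>M) < \<epsilon>"
    using g by (intro exI[of _ g]) simp
qed

lemma lipschitz_approximable_halfspace:
  assumes i: "i \<in> I"
  shows "lipschitz_approximable {x\<in>space M. x i \<le> a}"
  unfolding lipschitz_approximable_def
proof (intro conjI allI impI)
  note [measurable] = component_measurable[OF i]
  let ?S = "{x\<in>space M. x i \<le> a}"
  show S: "?S \<in> sets M" by measurable
  fix \<epsilon> :: real assume "0 < \<epsilon>"
  \<comment> \<open>A ramp of slope k, equal to 1 on the halfspace and, at each point off it, equal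
    to 0 once k is large.\<close>
  define g where "g k x = max 0 (1 - real k * max 0 (x i - a))" for k :: nat and x :: "nat \<Rightarrow> real"
  have [measurable]: "g k \<in> borel_measurable M" for k unfolding g_def by measurable
  have g01: "0 \<le> g k x" "g k x \<le> 1" for k x by (auto simp: g_def)
  have lip: "bounded_lipschitz I M (g k)" for k
    unfolding bounded_lipschitz_def
  proof (intro conjI exI[of _ "real k"] ballI)
    show "bounded_measurable M (g k)"
      using g01[of k] by (auto simp: bounded_measurable_def intro!: exI[of _ 1])
    fix x y
    have "\<bar>g k x - g k y\<bar> \<le> \<bar>real k * max 0 (x i - a) - real k * max 0 (y i - a)\<bar>"
      unfolding g_def by linarith
    also have "\<dots> = real k * \<bar>max 0 (x i - a) - max 0 (y i - a)\<bar>"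
      by (simp add: right_diff_distrib[symmetric] abs_mult)
    also have "\<dots> \<le> real k * \<bar>x i - y i\<bar>" by (intro mult_left_mono) auto
    also have "\<dots> \<le> real k * (\<Sum>i\<in>I. \<bar>x i - y i\<bar>)"
      using i finite_I by (intro mult_left_mono member_le_sum) auto
    finally show "\<bar>g k x - g k y\<bar> \<le> real k * (\<Sum>i\<in>I. \<bar>x i - y i\<bar>)" .
  qed simp
  have "(\<lambda>k. \<integral>x. \<bar>indicator ?S x - g k x\<bar> \<partial>M) \<longlonglongrightarrow> (\<integral>x. 0 \<partial>M)"
  proof (rule integral_dominated_convergence[where w="\<lambda>_. 1"])
    show "AE x in M. (\<lambda>k. \<bar>indicator ?S x - g k x\<bar>) \<longlonglongrightarrow> 0"
    proof (rule AE_I2)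
      fix x assume x: "x \<in> space M"
      have "eventually (\<lambda>k. \<bar>indicator ?S x - g k x\<bar> = 0) sequentially"
      proof (cases "x i \<le> a")
        case True then show ?thesis using x by (auto simp: g_def)
      next
        case False
        obtain N where N: "1 / (x i - a) \<le> real N" using real_arch_simple by blast
        have "g k x = 0" if "k \<ge> N" for k
        proof -
          have "1 \<le> real N * (x i - a)" using N False by (simp add: field_simps)
          also have "\<dots> \<le> real k * (x i - a)" using that False by (intro mult_right_mono) auto
          finally show ?thesis using False by (simp add: g_def)
        qed
        then show ?thesis using False by (auto simp: eventually_sequentially indicator_def)
      qed
      then show "(\<lambda>k. \<bar>indicator ?S x - g k x\<bar>) \<longlonglongrightarrow> 0" by (rule tendsto_eventually)
    qed
    show "AE x in M. norm \<bar>indicator ?S x - g k x\<bar> \<le> 1" for k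
    proof (rule AE_I2)
      fix x show "norm \<bar>indicator ?S x - g k x\<bar> \<le> 1" using g01[of k x] by (auto simp: indicator_def)
    qed
  qed (use S in measurable)
  then have "eventually (\<lambda>k. (\<integral>x. \<bar>indicator ?S x - g k x\<bar> \<partial>M) < \<epsilon>) sequentially"
    using \<open>0 < \<epsilon>\<close> by (intro order_tendstoD) auto
  then obtain k where "(\<integral>x. \<bar>indicator ?S x - g k x\<bar> \<partial>M) < \<epsilon>" by (auto simp: eventually_sequentially)
  then show "\<exists>g. bounded_lipschitz I M g \<and> (\<forall>x\<in>space M. 0 \<le> g x \<and> g x \<le> 1) \<and>
      (\<integral>x. \<bar>indicator ?S x - g x\<bar> \<partial>M) < \<epsilon>"
    using lip[of k] g01[of k] by blast
qed

text \<open>The approximable events form a sigma-algebra. It contains the halfspaces, so every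
  coordinate is measurable for it, and the product sigma-algebra is the smallest with this
  property.\<close>

lemma lipschitz_approximable_sets:
  assumes "S \<in> sets M"
  shows "lipschitz_approximable S"
proof -
  define \<A> where "\<A> = {S. lipschitz_approximable S}"
  have sub: "\<A> \<subseteq> Pow (space M)" using sets.sets_into_space by (auto simp: \<A>_def lipschitz_approximable_def)
  have empty: "lipschitz_approximable {}"
    by (auto simp: lipschitz_approximable_def intro!: exI[of _ "\<lambda>_. 0"] bounded_lipschitz_const)
  have "sigma_algebra (space M) \<A>"
    unfolding sigma_algebra_iff2
  proof (intro conjI allI impI ballI sub)
    show "(\<Union>n. A n) \<in> \<A>" if "range A \<subseteq> \<A>" for A :: "nat \<Rightarrow> _"
    proof -
      have "lipschitz_approximable (A n)" for n using that by (auto simp: \<A>_def)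
      then show ?thesis using lipschitz_approximable_UN by (simp add: \<A>_def)
    qed
  qed (use empty lipschitz_approximable_compl in \<open>auto simp: \<A>_def\<close>)
  then have N: "sets (sigma (space M) \<A>) = \<A>" "space (sigma (space M) \<A>) = space M"
    using sub by (simp_all add: sigma_algebra.sigma_sets_eq)
  have "(\<lambda>x. x i) \<in> borel_measurable (sigma (space M) \<A>)" if "i \<in> I" for i
    unfolding borel_measurable_iff_le N
    using lipschitz_approximable_halfspace[OF that] by (auto simp: \<A>_def)
  then have "sets (Pi\<^sub>M I (\<lambda>_. borel :: real measure)) \<subseteq> sets (sigma (space M) \<A>)"
  proof (intro sets_PiM_in_sets)
    fix i and A :: "real set" assume "i \<in> I" "A \<in> sets borel"
    then have "(\<lambda>x. x i) -` A \<inter> space (sigma (space M) \<A>) \<in> sets (sigma (space M) \<A>)"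
      using \<open>\<And>i. i \<in> I \<Longrightarrow> (\<lambda>x. x i) \<in> borel_measurable (sigma (space M) \<A>)\<close> measurable_sets by blast
    also have "(\<lambda>x. x i) -` A \<inter> space (sigma (space M) \<A>) = {x \<in> space (sigma (space M) \<A>). x i \<in> A}" by auto
    finally show "{x \<in> space (sigma (space M) \<A>). x i \<in> A} \<in> sets (sigma (space M) \<A>)" .
  qed (unfold N, simp add: space_M)
  then have "S \<in> \<A>" using assms unfolding N sets_M by blast
  then show ?thesis by (simp add: \<A>_def)
qed

section \<open>From events to square-integrable functions\<close>

definition L2_approximable :: "((nat \<Rightarrow> real) \<Rightarrow> real) \<Rightarrow> bool" where
  "L2_approximable f \<longleftrightarrow> square_integrable M f \<and>
     (\<forall>\<epsilon>>0. \<exists>g. bounded_lipschitz I M g \<and> (\<integral>x. (f x - g x)\<^sup>2 \<partial>M) < \<epsilon>)"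

lemma bounded_lipschitz_square_integrable: "bounded_lipschitz I M g \<Longrightarrow> square_integrable M g"
  by (simp add: bounded_lipschitz_def bounded_measurable_square_integrable)

lemma L2_approximable_closed:
  assumes f: "square_integrable M f"
    and approx: "\<And>\<epsilon>. 0 < \<epsilon> \<Longrightarrow> \<exists>h. L2_approximable h \<and> (\<integral>x. (f x - h x)\<^sup>2 \<partial>M) < \<epsilon>"
  shows "L2_approximable f"
  unfolding L2_approximable_def
proof (intro conjI allI impI f)
  fix \<epsilon> :: real assume "0 < \<epsilon>"
  then have "0 < \<epsilon> / 4" by simp
  obtain h where h: "L2_approximable h" "(\<integral>x. (f x - h x)\<^sup>2 \<partial>M) < \<epsilon> / 4" using approx[OF \<open>0 < \<epsilon> / 4\<close>] by blast
  obtain g where g: "bounded_lipschitz I M g" "(\<integral>x. (h x - g x)\<^sup>2 \<partial>M) < \<epsilon> / 4"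
    using h(1) \<open>0 < \<epsilon> / 4\<close> unfolding L2_approximable_def by blast
  have hs: "square_integrable M h" using h by (simp add: L2_approximable_def)
  have "(\<integral>x. (f x - g x)\<^sup>2 \<partial>M) = (\<integral>x. ((f x - h x) + (h x - g x))\<^sup>2 \<partial>M)" by simp
  also have "\<dots> \<le> (1 + 1) * (\<integral>x. (f x - h x)\<^sup>2 \<partial>M) + (1 + 1 / 1) * (\<integral>x. (h x - g x)\<^sup>2 \<partial>M)"
    using square_integrable_diff[OF f hs] square_integrable_diff[OF hs bounded_lipschitz_square_integrable[OF g(1)]]
    by (intro integral_power2_sum_le_weighted) auto
  also have "\<dots> < \<epsilon>" using h(2) g(2) by simp
  finally show "\<exists>g. bounded_lipschitz I M g \<and> (\<integral>x. (f x - g x)\<^sup>2 \<partial>M) < \<epsilon>" using g(1) by blast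
qed

lemma L2_approximable_indicator:
  assumes S: "S \<in> sets M"
  shows "L2_approximable (indicator S)"
  unfolding L2_approximable_def
proof (intro conjI allI impI)
  show "square_integrable M (indicator S)"
    using S by (intro bounded_measurable_square_integrable)
      (auto simp: bounded_measurable_def indicator_def intro!: exI[of _ 1] borel_measurable_indicator)
  fix \<epsilon> :: real assume "0 < \<epsilon>"
  then obtain g where g: "bounded_lipschitz I M g" "\<forall>x\<in>space M. 0 \<le> g x \<and> g x \<le> 1"
    "(\<integral>x. \<bar>indicator S x - g x\<bar> \<partial>M) < \<epsilon>"
    using lipschitz_approximable_sets[OF S] unfolding lipschitz_approximable_def by blast
  have "(\<integral>x. (indicator S x - g x)\<^sup>2 \<partial>M) \<le> (\<integral>x. \<bar>indicator S x - g x\<bar> \<partial>M)"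
  proof (rule integral_mono)
    show "integrable M (\<lambda>x. \<bar>indicator S x - g x\<bar>)" using integrable_indicator_diff[OF S g(1)] by simp
    show "integrable M (\<lambda>x. (indicator S x - g x)\<^sup>2)"
      using square_integrable_diff[OF \<open>square_integrable M (indicator S)\<close> bounded_lipschitz_square_integrable[OF g(1)]]
      by (simp add: square_integrable_def)
    fix x assume "x \<in> space M"
    then have "\<bar>indicator S x - g x\<bar> \<le> 1" using g(2) by (auto simp: indicator_def abs_if)
    then have "\<bar>indicator S x - g x\<bar> * \<bar>indicator S x - g x\<bar> \<le> \<bar>indicator S x - g x\<bar> * 1"
      by (intro mult_left_mono) auto
    then show "(indicator S x - g x)\<^sup>2 \<le> \<bar>indicator S x - g x\<bar>" by (simp add: power2_eq_square)
  qed
  then show "\<exists>g. bounded_lipschitz I M g \<and> (\<integral>x. (indicator S x - g x)\<^sup>2 \<partial>M) < \<epsilon>"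
    using g by (intro exI[of _ g]) auto
qed

lemma L2_approximable_add_scaled:
  assumes f: "L2_approximable f" and h: "L2_approximable h"
  shows "L2_approximable (\<lambda>x. c * f x + h x)"
  unfolding L2_approximable_def
proof (intro conjI allI impI)
  have fs: "square_integrable M f" and hs: "square_integrable M h" using f h by (auto simp: L2_approximable_def)
  have "square_integrable M (\<lambda>x. c * f x)" using fs by (auto simp: square_integrable_def power_mult_distrib)
  then show "square_integrable M (\<lambda>x. c * f x + h x)" using hs by (rule square_integrable_add)
  fix \<epsilon> :: real assume "0 < \<epsilon>"
  have "0 < \<epsilon> / (4 * (c\<^sup>2 + 1))" "0 < \<epsilon> / 4" using \<open>0 < \<epsilon>\<close> by (auto intro!: divide_pos_pos add_nonneg_pos)
  obtain g where g: "bounded_lipschitz I M g" "(\<integral>x. (f x - g x)\<^sup>2 \<partial>M) < \<epsilon> / (4 * (c\<^sup>2 + 1))"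
    using f \<open>0 < \<epsilon> / (4 * (c\<^sup>2 + 1))\<close> unfolding L2_approximable_def by blast
  obtain k where k: "bounded_lipschitz I M k" "(\<integral>x. (h x - k x)\<^sup>2 \<partial>M) < \<epsilon> / 4"
    using h \<open>0 < \<epsilon> / 4\<close> unfolding L2_approximable_def by blast
  have fg: "square_integrable M (\<lambda>x. f x - g x)" using fs bounded_lipschitz_square_integrable[OF g(1)] by (rule square_integrable_diff)
  have hk: "square_integrable M (\<lambda>x. h x - k x)" using hs bounded_lipschitz_square_integrable[OF k(1)] by (rule square_integrable_diff)
  have cfg: "square_integrable M (\<lambda>x. c * (f x - g x))" using fg by (auto simp: square_integrable_def power_mult_distrib)
  have lip: "bounded_lipschitz I M (\<lambda>x. c * g x + k x)" using bounded_lipschitz_lincomb[OF g(1) k(1), of c 1] by simp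
  have "(\<integral>x. (c * f x + h x - (c * g x + k x))\<^sup>2 \<partial>M) = (\<integral>x. (c * (f x - g x) + (h x - k x))\<^sup>2 \<partial>M)"
    by (simp add: algebra_simps)
  also have "\<dots> \<le> (1 + 1) * (\<integral>x. (c * (f x - g x))\<^sup>2 \<partial>M) + (1 + 1 / 1) * (\<integral>x. (h x - k x)\<^sup>2 \<partial>M)"
    using cfg hk by (rule integral_power2_sum_le_weighted) simp
  also have "(\<integral>x. (c * (f x - g x))\<^sup>2 \<partial>M) = c\<^sup>2 * (\<integral>x. (f x - g x)\<^sup>2 \<partial>M)" by (simp add: power_mult_distrib)
  also have "\<dots> \<le> c\<^sup>2 * (\<epsilon> / (4 * (c\<^sup>2 + 1)))" using g(2) by (intro mult_left_mono) auto
  also have "\<dots> \<le> \<epsilon> / 4"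
  proof -
    have "c\<^sup>2 * \<epsilon> \<le> (c\<^sup>2 + 1) * \<epsilon>" using \<open>0 < \<epsilon>\<close> by simp
    moreover have "0 < c\<^sup>2 + 1" by (intro add_nonneg_pos) auto
    ultimately show ?thesis by (simp add: field_simps)
  qed
  finally have "(\<integral>x. (c * f x + h x - (c * g x + k x))\<^sup>2 \<partial>M) < \<epsilon>" using k(2) by simp
  then show "\<exists>g. bounded_lipschitz I M g \<and> (\<integral>x. (c * f x + h x - g x)\<^sup>2 \<partial>M) < \<epsilon>" using lip by blast
qed

lemma bounded_lipschitz_dense:
  assumes f: "square_integrable M f"
  shows "L2_approximable f"
proof (rule L2_approximable_closed[OF f])
  fix \<epsilon> :: real assume "0 < \<epsilon>"
  have [measurable]: "f \<in> borel_measurable M" and f2: "integrable M (\<lambda>x. (f x)\<^sup>2)"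
    using f by (auto simp: square_integrable_def)
  obtain F where F: "\<And>k. simple_function M (F k)" "\<And>x. x \<in> space M \<Longrightarrow> (\<lambda>k. F k x) \<longlonglongrightarrow> f x"
    "\<And>k x. x \<in> space M \<Longrightarrow> \<bar>F k x\<bar> \<le> 2 * \<bar>f x\<bar>"
    using borel_measurable_implies_sequence_metric[of f M 0] by (simp add: dist_real_def) blast
  have [measurable]: "F k \<in> borel_measurable M" for k using F(1) by (rule borel_measurable_simple_function)
  have "(\<lambda>k. \<integral>x. (f x - F k x)\<^sup>2 \<partial>M) \<longlonglongrightarrow> (\<integral>x. 0 \<partial>M)"
  \<comment> \<open>The simple functions are bounded by 2 |f|, so the error is at most 3 |f|, with
    square 9 f^2.\<close>
  proof (rule integral_dominated_convergence[where w="\<lambda>x. 9 * (f x)\<^sup>2"])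
    show "integrable M (\<lambda>x. 9 * (f x)\<^sup>2)" using f2 by simp
    show "AE x in M. (\<lambda>k. (f x - F k x)\<^sup>2) \<longlonglongrightarrow> 0"
    proof (rule AE_I2)
      fix x assume "x \<in> space M"
      then have "(\<lambda>k. (f x - F k x)\<^sup>2) \<longlonglongrightarrow> (f x - f x)\<^sup>2" by (intro tendsto_intros F)
      then show "(\<lambda>k. (f x - F k x)\<^sup>2) \<longlonglongrightarrow> 0" by simp
    qed
    show "AE x in M. norm ((f x - F k x)\<^sup>2) \<le> 9 * (f x)\<^sup>2" for k
    proof (rule AE_I2)
      fix x assume "x \<in> space M"
      then have "\<bar>f x - F k x\<bar> \<le> 3 * \<bar>f x\<bar>" using F(3)[of x k] by linarith
      then have "\<bar>f x - F k x\<bar>\<^sup>2 \<le> (3 * \<bar>f x\<bar>)\<^sup>2" by (intro power_mono) auto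
      then show "norm ((f x - F k x)\<^sup>2) \<le> 9 * (f x)\<^sup>2" by (simp add: power_mult_distrib)
    qed
  qed measurable
  then have "eventually (\<lambda>k. (\<integral>x. (f x - F k x)\<^sup>2 \<partial>M) < \<epsilon>) sequentially"
    using \<open>0 < \<epsilon>\<close> by (intro order_tendstoD) auto
  then obtain k where k: "(\<integral>x. (f x - F k x)\<^sup>2 \<partial>M) < \<epsilon>" by (auto simp: eventually_sequentially)
  have fin: "finite (F k ` space M)" using F(1) by (rule simple_functionD)
  have sum: "L2_approximable (\<lambda>x. \<Sum>y\<in>Y. y * indicator (F k -` {y} \<inter> space M) x)" if "finite Y" for Y
    using that
  proof (induction Y)
    case empty
    then show ?case by (auto simp: L2_approximable_def square_integrable_const intro!: exI[of _ "\<lambda>_. 0"] bounded_lipschitz_const)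
  next
    case (insert y Y)
    have "L2_approximable (indicator (F k -` {y} \<inter> space M))"
      by (intro L2_approximable_indicator) measurable
    from L2_approximable_add_scaled[OF this insert.IH, of y] show ?case
      unfolding sum.insert[OF insert.hyps] .
  qed
  \<comment> \<open>The canonical form of the simple function \<open>F k\<close>, which reduces its
    approximation to indicators.\<close>
  define h where "h x = (\<Sum>y\<in>F k ` space M. y * indicator (F k -` {y} \<inter> space M) x)" for x
  have "F k x = h x" if "x \<in> space M" for x
  proof -
    have "h x = (\<Sum>y\<in>F k ` space M. if y = F k x then y else 0)"
      unfolding h_def using that by (intro sum.cong) (auto simp: indicator_def)
    then show ?thesis using that fin by simp
  qed
  then have "(\<integral>x. (f x - h x)\<^sup>2 \<partial>M) = (\<integral>x. (f x - F k x)\<^sup>2 \<partial>M)"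
    by (intro Bochner_Integration.integral_cong) auto
  then show "\<exists>h. L2_approximable h \<and> (\<integral>x. (f x - h x)\<^sup>2 \<partial>M) < \<epsilon>"
    using k sum[OF fin] unfolding h_def[symmetric] by (intro exI[of _ h]) auto
qed

end

subsection \<open>Gaussian autoregressive bridges\<close>

lemma PiM_density_prod:
  fixes f :: "'i \<Rightarrow> 'a \<Rightarrow> real"
  assumes A: "finite A" and M: "\<And>i. sigma_finite_measure (M i)"
    and f[measurable]: "\<And>i. f i \<in> borel_measurable (M i)" and nn: "\<And>i x. 0 \<le> f i x"
  shows "density (Pi\<^sub>M A M) (\<lambda>y. ennreal (\<Prod>i\<in>A. f i (y i))) = Pi\<^sub>M A (\<lambda>i. density (M i) (f i))"
proof -
  interpret M: product_sigma_finite M by (simp add: product_sigma_finite_def M)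
  have "sigma_finite_measure (density (M i) (f i))" for i
    using sigma_finite_measure.sigma_finite_iff_density_finite[OF M[of i], of "f i"] by simp
  then interpret D: product_sigma_finite "\<lambda>i. density (M i) (f i)" by (simp add: product_sigma_finite_def)
  show ?thesis
  proof (rule D.PiM_eqI[OF A])
    show "sets (density (Pi\<^sub>M A M) (\<lambda>y. ennreal (\<Prod>i\<in>A. f i (y i)))) = sets (Pi\<^sub>M A (\<lambda>i. density (M i) (f i)))"
      by (simp cong: sets_PiM_cong)
    fix B assume "\<And>i. i \<in> A \<Longrightarrow> B i \<in> sets (density (M i) (f i))"
    then have B: "\<And>i. i \<in> A \<Longrightarrow> B i \<in> sets (M i)" by simp
    then have PB: "Pi\<^sub>E A B \<in> sets (Pi\<^sub>M A M)" using A by (intro sets_PiM_I_finite)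
    have fm: "(\<lambda>y. f i (y i)) \<in> borel_measurable (Pi\<^sub>M A M)" if "i \<in> A" for i
      using measurable_compose[OF measurable_component_singleton[OF that] f] .
    have "emeasure (density (Pi\<^sub>M A M) (\<lambda>y. ennreal (\<Prod>i\<in>A. f i (y i)))) (Pi\<^sub>E A B)
      = (\<integral>\<^sup>+y. ennreal (\<Prod>i\<in>A. f i (y i)) * indicator (Pi\<^sub>E A B) y \<partial>Pi\<^sub>M A M)"
      using fm PB by (intro emeasure_density) auto
    also have "\<dots> = (\<integral>\<^sup>+y. (\<Prod>i\<in>A. ennreal (f i (y i)) * indicator (B i) (y i)) \<partial>Pi\<^sub>M A M)"
    proof (rule nn_integral_cong)
      fix y assume "y \<in> space (Pi\<^sub>M A M)"
      then have "indicator (Pi\<^sub>E A B) y = (\<Prod>i\<in>A. indicator (B i) (y i) :: ennreal)"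
        using A by (auto simp: indicator_def space_PiM PiE_iff extensional_def intro!: prod_zero[symmetric] prod.neutral)
      then show "ennreal (\<Prod>i\<in>A. f i (y i)) * indicator (Pi\<^sub>E A B) y = (\<Prod>i\<in>A. ennreal (f i (y i)) * indicator (B i) (y i))"
        by (simp add: prod.distrib prod_ennreal nn)
    qed
    also have "\<dots> = (\<Prod>i\<in>A. \<integral>\<^sup>+t. ennreal (f i t) * indicator (B i) t \<partial>M i)"
      using A B by (intro M.product_nn_integral_prod) auto
    also have "\<dots> = (\<Prod>i\<in>A. emeasure (density (M i) (f i)) (B i))"
      using B by (intro prod.cong refl) (simp add: emeasure_density)
    finally show "emeasure (density (Pi\<^sub>M A M) (\<lambda>y. ennreal (\<Prod>i\<in>A. f i (y i)))) (Pi\<^sub>E A B)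
      = (\<Prod>i\<in>A. emeasure (density (M i) (f i)) (B i))" .
  qed
qed

definition normal_law :: "real \<Rightarrow> real \<Rightarrow> real measure" where
  "normal_law \<mu> s = density lborel (\<lambda>z. ennreal (normal_density \<mu> s z))"

lemma normal_law_translate:
  assumes "B \<in> sets borel"
  shows "emeasure (normal_law 0 s) {z. z + \<mu> \<in> B} = emeasure (normal_law \<mu> s) B"
proof -
  have meas: "{z. z + \<mu> \<in> B} \<in> sets borel" using measurable_sets[of "\<lambda>z. z + \<mu>" borel borel B] assms by (simp add: vimage_def)
  have "emeasure (normal_law \<mu> s) B = (\<integral>\<^sup>+z. ennreal (normal_density \<mu> s z) * indicator B z \<partial>lborel)"
    unfolding normal_law_def using assms by (intro emeasure_density) auto
  also have "\<dots> = (\<integral>\<^sup>+z. ennreal (normal_density \<mu> s (\<mu> + 1 * z)) * indicator B (\<mu> + 1 * z) \<partial>lborel)"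
    using assms by (subst nn_integral_real_affine[where c=1 and t=\<mu>]) auto
  also have "\<dots> = (\<integral>\<^sup>+z. ennreal (normal_density 0 s z) * indicator {z. z + \<mu> \<in> B} z \<partial>lborel)"
    by (intro nn_integral_cong) (auto simp: normal_density_def indicator_def add.commute)
  also have "\<dots> = emeasure (normal_law 0 s) {z. z + \<mu> \<in> B}"
    unfolding normal_law_def using meas by (intro emeasure_density[symmetric]) auto
  finally show ?thesis by simp
qed

lemma prob_space_normal_law: "0 < s \<Longrightarrow> prob_space (normal_law \<mu> s)"
  unfolding normal_law_def by (rule prob_space_normal_density)

lemma sets_normal_law[simp, measurable_cong]: "sets (normal_law \<mu> s) = sets borel"
  by (simp add: normal_law_def)

lemma space_normal_law[simp]: "space (normal_law \<mu> s) = UNIV"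
  by (simp add: normal_law_def)

text \<open>Separates the means, which will depend on the state, from a noise whose law does not.
  This is what lets two states be driven by the same noise.\<close>

lemma PiM_normal_law_translate:
  assumes A: "finite A" and s: "0 < s"
  shows "Pi\<^sub>M A (\<lambda>i. normal_law (\<mu> i) s)
    = distr (Pi\<^sub>M A (\<lambda>_. normal_law 0 s)) (Pi\<^sub>M A (\<lambda>_. lborel)) (\<lambda>z. \<lambda>i\<in>A. z i + \<mu> i)"
proof -
  have sf: "sigma_finite_measure (normal_law \<mu> s)" for \<mu>
    using prob_space_imp_sigma_finite[OF prob_space_normal_law[OF s]] .
  interpret P: product_sigma_finite "\<lambda>i. normal_law (\<mu> i) s" by (simp add: product_sigma_finite_def sf)
  interpret P0: product_sigma_finite "\<lambda>_. normal_law 0 s" by (simp add: product_sigma_finite_def sf)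
  have m: "(\<lambda>z. \<lambda>i\<in>A. z i + \<mu> i) \<in> Pi\<^sub>M A (\<lambda>_. normal_law 0 s) \<rightarrow>\<^sub>M Pi\<^sub>M A (\<lambda>_. lborel)"
    by (rule measurable_restrict) (auto intro!: borel_measurable_add measurable_component_singleton[of _ A "\<lambda>_. normal_law 0 s", simplified])
  show ?thesis
  proof (rule P.PiM_eqI[OF A, symmetric])
    show "sets (distr (Pi\<^sub>M A (\<lambda>_. normal_law 0 s)) (Pi\<^sub>M A (\<lambda>_. lborel)) (\<lambda>z. \<lambda>i\<in>A. z i + \<mu> i))
        = sets (Pi\<^sub>M A (\<lambda>i. normal_law (\<mu> i) s))"
      by (simp cong: sets_PiM_cong)
    fix B assume "\<And>i. i \<in> A \<Longrightarrow> B i \<in> sets (normal_law (\<mu> i) s)"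
    then have B: "\<And>i. i \<in> A \<Longrightarrow> B i \<in> sets borel" by simp
    then have PB: "Pi\<^sub>E A B \<in> sets (Pi\<^sub>M A (\<lambda>_. lborel))" using A by (intro sets_PiM_I_finite) auto
    have "emeasure (distr (Pi\<^sub>M A (\<lambda>_. normal_law 0 s)) (Pi\<^sub>M A (\<lambda>_. lborel)) (\<lambda>z. \<lambda>i\<in>A. z i + \<mu> i)) (Pi\<^sub>E A B)
      = emeasure (Pi\<^sub>M A (\<lambda>_. normal_law 0 s)) ((\<lambda>z. \<lambda>i\<in>A. z i + \<mu> i) -` Pi\<^sub>E A B \<inter> space (Pi\<^sub>M A (\<lambda>_. normal_law 0 s)))"
      using m PB by (rule emeasure_distr)
    also have "(\<lambda>z. \<lambda>i\<in>A. z i + \<mu> i) -` Pi\<^sub>E A B \<inter> space (Pi\<^sub>M A (\<lambda>_. normal_law 0 s)) = Pi\<^sub>E A (\<lambda>i. {z. z + \<mu> i \<in> B i})"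
      by (auto simp: space_PiM PiE_iff)
    also have "emeasure (Pi\<^sub>M A (\<lambda>_. normal_law 0 s)) (Pi\<^sub>E A (\<lambda>i. {z. z + \<mu> i \<in> B i}))
      = (\<Prod>i\<in>A. emeasure (normal_law 0 s) {z. z + \<mu> i \<in> B i})"
    proof (rule P0.emeasure_PiM[OF A])
      fix i assume "i \<in> A"
      then show "{z. z + \<mu> i \<in> B i} \<in> sets (normal_law 0 s)"
        using measurable_sets[of "\<lambda>z. z + \<mu> i" borel borel "B i"] B by (simp add: vimage_def)
    qed
    also have "\<dots> = (\<Prod>i\<in>A. emeasure (normal_law (\<mu> i) s) (B i))"
      using B by (intro prod.cong refl normal_law_translate)
    finally show "emeasure (distr (Pi\<^sub>M A (\<lambda>_. normal_law 0 s)) (Pi\<^sub>M A (\<lambda>_. lborel)) (\<lambda>z. \<lambda>i\<in>A. z i + \<mu> i)) (Pi\<^sub>E A B)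
      = (\<Prod>i\<in>A. emeasure (normal_law (\<mu> i) s) (B i))" .
  qed
qed

text \<open>Both processes have transition densities of the form \<open>N(\<alpha> a, \<tau>\<^sup>2)\<close> over one time step, with
  \<open>\<alpha> = 1\<close> for Brownian motion and \<open>\<alpha> = exp (- \<theta> \<delta>)\<close> for the Ornstein--Uhlenbeck process. Given its
  neighbours, a knot is normal with mean \<open>\<kappa>\<close> times their sum and standard deviation \<open>s\<close>.\<close>

locale ar_bridge =
  fixes \<alpha> \<tau> x0 xT :: real and m :: nat
  assumes \<alpha>: "0 < \<alpha>" "\<alpha> \<le> 1" and \<tau>: "0 < \<tau>" and m: "1 \<le> m"
begin

text \<open>Completing the square: for neighbours a and b, (x - \<alpha> a)^2 + (b - \<alpha> x)^2
  equals (1 + \<alpha>^2) (x - \<kappa> (a + b))^2 up to a term free of x. Dividing by 2 \<tau>^2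
  identifies \<kappa> and the standard deviation \<open>s\<close>.\<close>

definition \<kappa> where "\<kappa> = \<alpha> / (1 + \<alpha>\<^sup>2)"
definition s where "s = \<tau> / sqrt (1 + \<alpha>\<^sup>2)"

definition ext :: "(nat \<Rightarrow> real) \<Rightarrow> nat \<Rightarrow> real" where
  "ext x i = (if i = 0 then x0 else if i = Suc m then xT else x i)"

definition dens :: "(nat \<Rightarrow> real) \<Rightarrow> real" where
  "dens x = (\<Prod>i\<in>{0..m}. normal_density (\<alpha> * ext x i) \<tau> (ext x (Suc i)))"

text \<open>Up to the factor -2 \<tau>^2, the exponent of the joint Gaussian density along a path
  that includes its endpoints.\<close>

definition action :: "(nat \<Rightarrow> real) \<Rightarrow> real" where
  "action X = (\<Sum>j=0..m. (X (Suc j) - \<alpha> * X j)\<^sup>2)"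

definition cond_mean :: "(nat \<Rightarrow> real) \<Rightarrow> nat \<Rightarrow> real" where
  "cond_mean x i = \<kappa> * (ext x (i - 1) + ext x (Suc i))"

lemma one_plus_\<alpha>_pos: "0 < 1 + \<alpha>\<^sup>2" by (intro add_pos_nonneg) auto

lemma \<kappa>_bounds: "0 \<le> \<kappa>" "\<kappa> \<le> 1/2"
proof -
  show "0 \<le> \<kappa>" using \<alpha> one_plus_\<alpha>_pos by (simp add: \<kappa>_def)
  have "2 * \<alpha> \<le> 1 + \<alpha>\<^sup>2" using sum_squares_bound[of 1 \<alpha>] by simp
  then show "\<kappa> \<le> 1/2" using one_plus_\<alpha>_pos by (simp add: \<kappa>_def field_simps)
qed

lemma s_pos: "0 < s" using \<tau> one_plus_\<alpha>_pos by (simp add: s_def)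

lemma s_sq: "\<tau>\<^sup>2 = (1 + \<alpha>\<^sup>2) * s\<^sup>2"
  using one_plus_\<alpha>_pos by (simp add: s_def power_divide)

lemma dens_eq_exp_action: "dens x = (1 / sqrt (2 * pi * \<tau>\<^sup>2)) ^ Suc m * exp (- action (ext x) / (2 * \<tau>\<^sup>2))"
proof -
  have "dens x = (\<Prod>i\<in>{0..m}. 1 / sqrt (2 * pi * \<tau>\<^sup>2) * exp (- (ext x (Suc i) - \<alpha> * ext x i)\<^sup>2 / (2 * \<tau>\<^sup>2)))"
    by (simp add: dens_def normal_density_def)
  also have "\<dots> = (1 / sqrt (2 * pi * \<tau>\<^sup>2)) ^ Suc m * exp (\<Sum>i=0..m. - (ext x (Suc i) - \<alpha> * ext x i)\<^sup>2 / (2 * \<tau>\<^sup>2))"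
    unfolding prod.distrib exp_sum[OF finite_atLeastAtMost] by simp
  finally show ?thesis by (simp add: action_def sum_divide_distrib[symmetric] sum_negf)
qed

lemma dens_pos: "0 < dens x"
  unfolding dens_eq_exp_action using \<tau> by simp

text \<open>Each interior knot lies on two edges and receives 1 from the left one and \<alpha>^2
  from the right one, so the diagonal is constant and factors out; the coupling \<alpha> then turns
  into \<kappa>. \<open>V\<close> is left free at the ends so that it can carry the pinned
  values.\<close>

lemma action_bilinear:
  assumes U: "supported m U"
  shows "(\<Sum>j=0..m. (V (Suc j) - \<alpha> * V j) * (U (Suc j) - \<alpha> * U j)) = (1 + \<alpha>\<^sup>2) * (\<Sum>i=1..m. U i * residual \<kappa> V i)"
proof -
  have "(\<Sum>j=0..m. (V (Suc j) - \<alpha> * V j) * (U (Suc j) - \<alpha> * U j))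
    = (\<Sum>j=0..m. U (Suc j) * V (Suc j) + \<alpha>\<^sup>2 * (U j * V j) - \<alpha> * (U j * V (Suc j) + V j * U (Suc j)))"
    by (intro sum.cong refl) (simp add: power2_eq_square algebra_simps)
  also have "\<dots> = (\<Sum>j=0..m. U (Suc j) * V (Suc j)) + \<alpha>\<^sup>2 * (\<Sum>j=0..m. U j * V j)
      - \<alpha> * (\<Sum>j=0..m. U j * V (Suc j) + V j * U (Suc j))"
    by (subst sum_subtractf, subst sum.distrib) (simp only: sum_distrib_left)
  also have "(\<Sum>j=0..m. U (Suc j) * V (Suc j)) = (\<Sum>i=1..m. U i * V i)"
    using supportedD[OF U] sum.shift_bounds_cl_Suc_ivl[of "\<lambda>i. U i * V i" 0 m] by simp
  also have "(\<Sum>j=0..m. U j * V j) = (\<Sum>i=1..m. U i * V i)"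
    using supportedD[OF U] by (simp add: sum.atLeast_Suc_atMost)
  also have "(\<Sum>j=0..m. U j * V (Suc j) + V j * U (Suc j)) = (\<Sum>i=1..m. U i * (V (i - 1) + V (Suc i)))"
    using sum_neighbours[OF supportedD[OF U]] by simp
  also have "(\<Sum>i=1..m. U i * V i) + \<alpha>\<^sup>2 * (\<Sum>i=1..m. U i * V i) - \<alpha> * (\<Sum>i=1..m. U i * (V (i - 1) + V (Suc i)))
    = (\<Sum>i=1..m. (1 + \<alpha>\<^sup>2) * (U i * V i) - \<alpha> * (U i * (V (i - 1) + V (Suc i))))"
    unfolding sum_subtractf sum_distrib_left[symmetric] by (simp add: algebra_simps)
  also have "\<dots> = (\<Sum>i=1..m. (1 + \<alpha>\<^sup>2) * (U i * residual \<kappa> V i))"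
  proof (intro sum.cong refl)
    fix i
    have "\<alpha> = (1 + \<alpha>\<^sup>2) * \<kappa>" using one_plus_\<alpha>_pos by (simp add: \<kappa>_def)
    then have "\<alpha> * (U i * (V (i - 1) + V (Suc i))) = ((1 + \<alpha>\<^sup>2) * \<kappa>) * (U i * (V (i - 1) + V (Suc i)))" by simp
    then show "(1 + \<alpha>\<^sup>2) * (U i * V i) - \<alpha> * (U i * (V (i - 1) + V (Suc i))) = (1 + \<alpha>\<^sup>2) * (U i * residual \<kappa> V i)"
      by (simp only: residual_def) (simp add: algebra_simps)
  qed
  finally show ?thesis by (simp add: sum_distrib_left)
qed

lemma action_add:
  assumes U: "supported m U"
  shows "action (\<lambda>i. V i + U i) = action V + (1 + \<alpha>\<^sup>2) * (energy \<kappa> m U + 2 * (\<Sum>i=1..m. U i * residual \<kappa> V i))"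
proof -
  have "action (\<lambda>i. V i + U i) = (\<Sum>j=0..m. (V (Suc j) - \<alpha> * V j)\<^sup>2
      + ((U (Suc j) - \<alpha> * U j) * (U (Suc j) - \<alpha> * U j) + 2 * ((V (Suc j) - \<alpha> * V j) * (U (Suc j) - \<alpha> * U j))))"
    unfolding action_def by (intro sum.cong refl) (simp add: power2_eq_square algebra_simps)
  also have "\<dots> = action V + ((\<Sum>j=0..m. (U (Suc j) - \<alpha> * U j) * (U (Suc j) - \<alpha> * U j))
      + 2 * (\<Sum>j=0..m. (V (Suc j) - \<alpha> * V j) * (U (Suc j) - \<alpha> * U j)))"
    by (simp only: sum.distrib action_def sum_distrib_left)
  finally show ?thesis unfolding action_bilinear[OF U] by (simp add: energy_def algebra_simps)
qed

lemma dens_block: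
  assumes A: "A \<subseteq> {1..m}" "independent_set A"
  shows "\<exists>c>0. \<forall>y. dens (merge A ({1..m} - A) (y, x)) = c * (\<Prod>i\<in>A. normal_density (cond_mean x i) s (y i))"
proof -
  have fin: "finite A" using A(1) finite_subset by blast
  define V where "V i = (if i \<in> A then 0 else ext x i)" for i
  \<comment> \<open>In this order: the prefactor of the density, the action without the block, the
    remainder from completing the squares, and the inverse normalising constants of the conditional
    normals.\<close>
  define c where "c = (1 / sqrt (2 * pi * \<tau>\<^sup>2)) ^ Suc m * exp (- action V / (2 * \<tau>\<^sup>2))
      * exp ((\<Sum>i\<in>A. (cond_mean x i)\<^sup>2) / (2 * s\<^sup>2)) * sqrt (2 * pi * s\<^sup>2) ^ card A"
  have "c > 0" using \<tau> s_pos by (simp add: c_def)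
  moreover have "dens (merge A ({1..m} - A) (y, x)) = c * (\<Prod>i\<in>A. normal_density (cond_mean x i) s (y i))" for y
  proof -
    define U where "U i = (if i \<in> A then y i else 0)" for i
    have U: "supported m U" using A(1) by (auto simp: supported_def U_def)
    have X: "ext (merge A ({1..m} - A) (y, x)) i = V i + U i" if "i \<le> Suc m" for i
      using A(1) that by (auto simp: ext_def V_def U_def merge_def)
    have nb: "U i * (U (i - 1) + U (Suc i)) = 0" if "i \<in> {1..m}" for i
      using A(2) that unfolding independent_set_def U_def by (cases i) auto
    have en: "energy \<kappa> m U = (\<Sum>i\<in>A. (y i)\<^sup>2)"
    proof -
      have "energy \<kappa> m U = (\<Sum>i=1..m. (U i)\<^sup>2 - \<kappa> * (U i * (U (i - 1) + U (Suc i))))"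
        unfolding energy_def by (intro sum.cong refl) (simp add: residual_def power2_eq_square algebra_simps)
      also have "\<dots> = (\<Sum>i=1..m. (U i)\<^sup>2)" using nb by (intro sum.cong refl) simp
      also have "\<dots> = (\<Sum>i\<in>A. (U i)\<^sup>2)" using A(1) by (intro sum.mono_neutral_right) (auto simp: U_def)
      finally show ?thesis by (simp add: U_def)
    qed
    have cr: "(\<Sum>i=1..m. U i * residual \<kappa> V i) = - (\<Sum>i\<in>A. y i * cond_mean x i)"
    proof -
      have "(\<Sum>i=1..m. U i * residual \<kappa> V i) = (\<Sum>i\<in>A. U i * residual \<kappa> V i)"
        using A(1) by (intro sum.mono_neutral_right) (auto simp: U_def)
      also have "\<dots> = (\<Sum>i\<in>A. - (y i * cond_mean x i))"
      proof (intro sum.cong refl)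
        fix i assume i: "i \<in> A"
        then have "i - 1 \<notin> A" "Suc i \<notin> A" using A by (cases i; force simp: independent_set_def)+
        then show "U i * residual \<kappa> V i = - (y i * cond_mean x i)"
          using i by (simp add: U_def V_def residual_def cond_mean_def)
      qed
      finally show ?thesis by (simp add: sum_negf)
    qed
    have "action (ext (merge A ({1..m} - A) (y, x))) = action (\<lambda>i. V i + U i)"
      unfolding action_def by (intro sum.cong refl) (simp add: X[unfolded One_nat_def])
    also have "\<dots> = action V + (1 + \<alpha>\<^sup>2) * ((\<Sum>i\<in>A. (y i)\<^sup>2) - 2 * (\<Sum>i\<in>A. y i * cond_mean x i))"
      unfolding action_add[OF U] en cr by simp
    also have "(\<Sum>i\<in>A. (y i)\<^sup>2) - 2 * (\<Sum>i\<in>A. y i * cond_mean x i) = (\<Sum>i\<in>A. (y i - cond_mean x i)\<^sup>2) - (\<Sum>i\<in>A. (cond_mean x i)\<^sup>2)"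
      unfolding sum_distrib_left sum_subtractf[symmetric]
      by (intro sum.cong refl) (simp add: power2_eq_square algebra_simps)
    finally have act0: "action (ext (merge A ({1..m} - A) (y, x))) = action V
        + (1 + \<alpha>\<^sup>2) * ((\<Sum>i\<in>A. (y i - cond_mean x i)\<^sup>2) - (\<Sum>i\<in>A. (cond_mean x i)\<^sup>2))" .
    have scale: "- (a + k * (P - C)) / (2 * (k * t)) = - a / (2 * (k * t)) + C / (2 * t) + - P / (2 * t)"
      if "0 < k" "0 < t" for a k P C t :: real
      using that by (simp add: field_simps)
    have act: "- action (ext (merge A ({1..m} - A) (y, x))) / (2 * \<tau>\<^sup>2) = - action V / (2 * \<tau>\<^sup>2)
        + (\<Sum>i\<in>A. (cond_mean x i)\<^sup>2) / (2 * s\<^sup>2) + (\<Sum>i\<in>A. - (y i - cond_mean x i)\<^sup>2 / (2 * s\<^sup>2))"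
      unfolding s_sq sum_divide_distrib[symmetric] sum_negf act0
      using one_plus_\<alpha>_pos s_pos by (intro scale) auto
    have "(\<Prod>i\<in>A. normal_density (cond_mean x i) s (y i))
        = (1 / sqrt (2 * pi * s\<^sup>2)) ^ card A * exp (\<Sum>i\<in>A. - (y i - cond_mean x i)\<^sup>2 / (2 * s\<^sup>2))"
      unfolding normal_density_def prod.distrib exp_sum[OF fin] by simp
    then have "c * (\<Prod>i\<in>A. normal_density (cond_mean x i) s (y i)) = (1 / sqrt (2 * pi * \<tau>\<^sup>2)) ^ Suc m
        * exp (- action V / (2 * \<tau>\<^sup>2)) * exp ((\<Sum>i\<in>A. (cond_mean x i)\<^sup>2) / (2 * s\<^sup>2))
        * exp (\<Sum>i\<in>A. - (y i - cond_mean x i)\<^sup>2 / (2 * s\<^sup>2))"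
      using s_pos by (simp add: c_def power_divide)
    also have "\<dots> = dens (merge A ({1..m} - A) (y, x))"
      unfolding dens_eq_exp_action act exp_add by (simp add: mult.assoc)
    finally show ?thesis by simp
  qed
  ultimately show ?thesis by blast
qed

section \<open>The bridge law: normalisation and second moment\<close>

definition law :: "(nat \<Rightarrow> real) measure" where
  "law = normalised (knot_space m) dens"

lemma space_knot_space: "space (knot_space m) = (\<Pi>\<^sub>E i\<in>{1..m}. UNIV)"
  by (simp add: knot_space_def space_PiM)

lemma sets_knot_space: "sets (knot_space m) = sets (Pi\<^sub>M {1..m} (\<lambda>_. borel :: real measure))"
  unfolding knot_space_def by (intro sets_PiM_cong) auto

lemma knot_component_measurable: "i \<in> {1..m} \<Longrightarrow> (\<lambda>x. x i) \<in> borel_measurable (knot_space m)"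
  using measurable_component_singleton[of i "{1..m}" "\<lambda>_. lborel :: real measure"] by (simp add: knot_space_def)

lemma ext_measurable: "i \<le> Suc m \<Longrightarrow> (\<lambda>x. ext x i) \<in> borel_measurable (knot_space m)"
  using knot_component_measurable[of i] by (cases "i = 0 \<or> i = Suc m") (auto simp: ext_def)

lemma dens_measurable: "dens \<in> borel_measurable (knot_space m)"
proof -
  have "(\<lambda>x. normal_density (\<alpha> * ext x i) \<tau> (ext x (Suc i))) \<in> borel_measurable (knot_space m)" if "i \<in> {0..m}" for i
  proof -
    have [measurable]: "(\<lambda>x. ext x i) \<in> borel_measurable (knot_space m)" "(\<lambda>x. ext x (Suc i)) \<in> borel_measurable (knot_space m)"
      using that by (auto intro: ext_measurable)
    show ?thesis unfolding normal_density_def by measurable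
  qed
  then show ?thesis unfolding dens_def[abs_def] by (rule borel_measurable_prod)
qed

lemma cond_mean_measurable: "i \<in> {1..m} \<Longrightarrow> (\<lambda>x. cond_mean x i) \<in> borel_measurable (knot_space m)"
  unfolding cond_mean_def by (intro borel_measurable_times borel_measurable_add ext_measurable) auto

text \<open>The action is coercive: its quadratic part is bounded below by the Poincare inequality,
  and the part linear in the knots, caused by the endpoints, is absorbed. This yields finite mass
  and second moment without computing a covariance.\<close>

lemma dens_gaussian_bound:
  "\<exists>D b. 0 < D \<and> 0 < b \<and> (\<forall>x. dens x \<le> D * exp (- b * (\<Sum>i=1..m. (x i)\<^sup>2)))"
proof -
  define V where "V i = (if i = 0 then x0 else if i = Suc m then xT else 0)" for i
  \<comment> \<open>The energy is at least 2 \<epsilon> times the sum of squares, as 2 \<epsilon> =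
    1 / (2 m^2). One of the two \<epsilon> is spent on the linear term.\<close>
  define \<epsilon> where "\<epsilon> = 1 / (4 * (real m)\<^sup>2)"
  have \<epsilon>: "0 < \<epsilon>" using m by (simp add: \<epsilon>_def)
  define R where "R = (\<Sum>i=1..m. (residual \<kappa> V i)\<^sup>2)"
  define k where "k = 1 + \<alpha>\<^sup>2"
  have k: "0 < k" using one_plus_\<alpha>_pos by (simp add: k_def)
  have lower: "k * \<epsilon> * (\<Sum>i=1..m. (x i)\<^sup>2) - k * R / \<epsilon> \<le> action (ext x)" for x
  proof -
    define S where "S = (\<Sum>i=1..m. (x i)\<^sup>2)"
    define U where "U i = (if i \<in> {1..m} then x i else 0)" for i
    have U: "supported m U" by (auto simp: supported_def U_def)
    have X: "ext x i = V i + U i" if "i \<le> Suc m" for i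
      using that by (auto simp: ext_def V_def U_def)
    have SU: "(\<Sum>i=1..m. (U i)\<^sup>2) = S" unfolding S_def by (intro sum.cong refl) (simp add: U_def)
    have "S \<le> 2 * (real m)\<^sup>2 * energy \<kappa> m U"
      using energy_lower_bound[OF \<kappa>_bounds U m] SU by simp
    then have en: "2 * \<epsilon> * S \<le> energy \<kappa> m U" using m by (simp add: \<epsilon>_def field_simps)
    have "- (2 * (\<Sum>i=1..m. U i * residual \<kappa> V i)) \<le> (\<Sum>i=1..m. \<epsilon> * (U i)\<^sup>2 + (residual \<kappa> V i)\<^sup>2 / \<epsilon>)"
      unfolding sum_distrib_left sum_negf[symmetric]
    proof (rule sum_mono)
      fix i
      have "\<epsilon> * (U i)\<^sup>2 + (residual \<kappa> V i)\<^sup>2 / \<epsilon> + 2 * (U i * residual \<kappa> V i) = (\<epsilon> * U i + residual \<kappa> V i)\<^sup>2 / \<epsilon>"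
        using \<epsilon> by (simp add: field_simps power2_eq_square)
      moreover have "0 \<le> (\<epsilon> * U i + residual \<kappa> V i)\<^sup>2 / \<epsilon>" using \<epsilon> by simp
      ultimately show "- (2 * (U i * residual \<kappa> V i)) \<le> \<epsilon> * (U i)\<^sup>2 + (residual \<kappa> V i)\<^sup>2 / \<epsilon>" by linarith
    qed
    also have "\<dots> = \<epsilon> * S + R / \<epsilon>"
      by (simp add: sum.distrib sum_distrib_left[symmetric] sum_divide_distrib[symmetric] SU[unfolded One_nat_def] R_def)
    finally have "\<epsilon> * S - R / \<epsilon> \<le> energy \<kappa> m U + 2 * (\<Sum>i=1..m. U i * residual \<kappa> V i)" using en by linarith
    then have "k * (\<epsilon> * S - R / \<epsilon>) \<le> k * (energy \<kappa> m U + 2 * (\<Sum>i=1..m. U i * residual \<kappa> V i))"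
      using k by (intro mult_left_mono) auto
    also have "\<dots> \<le> action V + \<dots>" by (simp add: action_def sum_nonneg)
    also have "\<dots> = action (\<lambda>i. V i + U i)" by (simp add: action_add[OF U] k_def)
    also have "\<dots> = action (ext x)" unfolding action_def by (intro sum.cong refl) (simp add: X)
    finally show ?thesis by (simp add: S_def algebra_simps)
  qed
  define D where "D = (1 / sqrt (2 * pi * \<tau>\<^sup>2)) ^ Suc m * exp (k * R / \<epsilon> / (2 * \<tau>\<^sup>2))"
  define b where "b = k * \<epsilon> / (2 * \<tau>\<^sup>2)"
  show ?thesis
  proof (rule exI[of _ D], rule exI[of _ b], intro conjI allI)
    show "0 < D" using \<tau> by (simp add: D_def)
    show "0 < b" using k \<epsilon> \<tau> by (simp add: b_def)
    fix x
    have "- action (ext x) / (2 * \<tau>\<^sup>2) \<le> (k * R / \<epsilon> - k * \<epsilon> * (\<Sum>i=1..m. (x i)\<^sup>2)) / (2 * \<tau>\<^sup>2)"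
      using lower[of x] \<tau> by (intro divide_right_mono) auto
    also have "\<dots> = k * R / \<epsilon> / (2 * \<tau>\<^sup>2) + - b * (\<Sum>i=1..m. (x i)\<^sup>2)"
      by (simp add: b_def diff_divide_distrib)
    finally have "exp (- action (ext x) / (2 * \<tau>\<^sup>2)) \<le> exp (k * R / \<epsilon> / (2 * \<tau>\<^sup>2)) * exp (- b * (\<Sum>i=1..m. (x i)\<^sup>2))"
      unfolding exp_add[symmetric] by simp
    then show "dens x \<le> D * exp (- b * (\<Sum>i=1..m. (x i)\<^sup>2))"
      unfolding dens_eq_exp_action D_def mult.assoc using \<tau> by (intro mult_left_mono) auto
  qed
qed

lemma nn_integral_gaussian_finite:
  assumes b: "0 < b"
  shows "(\<integral>\<^sup>+x. ennreal (exp (- b * (\<Sum>i=1..m. (x i)\<^sup>2))) \<partial>knot_space m) < \<infinity>"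
proof -
  interpret product_sigma_finite "\<lambda>_::nat. lborel :: real measure"
    by (simp add: product_sigma_finite_def lborel.sigma_finite_measure_axioms)
  have "(\<integral>\<^sup>+x. ennreal (exp (- b * (\<Sum>i=1..m. (x i)\<^sup>2))) \<partial>knot_space m)
    = (\<integral>\<^sup>+x. (\<Prod>i\<in>{1..m}. ennreal (exp (- b * (x i)\<^sup>2))) \<partial>knot_space m)"
    by (intro nn_integral_cong) (simp add: sum_distrib_left exp_sum[symmetric] sum_negf[symmetric] prod_ennreal)
  also have "\<dots> = (\<Prod>i\<in>{1..m}. \<integral>\<^sup>+t. ennreal (exp (- b * t\<^sup>2)) \<partial>lborel)"
    unfolding knot_space_def by (rule product_nn_integral_prod) auto
  also have "\<dots> < \<infinity>"
  proof -
    define \<sigma> where "\<sigma> = 1 / sqrt (2 * b)"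
    have \<sigma>: "0 < \<sigma>" "2 * \<sigma>\<^sup>2 = 1 / b" using b by (auto simp: \<sigma>_def power_divide)
    have "exp (- b * t\<^sup>2) = sqrt (2 * pi * \<sigma>\<^sup>2) * normal_density 0 \<sigma> t" for t
      using \<sigma> by (simp add: normal_density_def)
    then have "(\<lambda>t. exp (- b * t\<^sup>2)) = (\<lambda>t. sqrt (2 * pi * \<sigma>\<^sup>2) * normal_density 0 \<sigma> t)" by (rule ext)
    then have "integrable lborel (\<lambda>t. exp (- b * t\<^sup>2))" using integrable_normal_density[OF \<sigma>(1)] by simp
    then have "(\<integral>\<^sup>+t. ennreal (exp (- b * t\<^sup>2)) \<partial>lborel) < \<infinity>"
      by (simp add: nn_integral_eq_integral)
    then show ?thesis by (simp add: power_less_top_ennreal)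
  qed
  finally show ?thesis .
qed

definition partition :: ennreal where
  "partition = (\<integral>\<^sup>+x. ennreal (dens x) \<partial>knot_space m)"

lemma partition_finite: "partition < \<infinity>"
proof -
  obtain D b where D: "0 < D" "0 < b" "\<And>x. dens x \<le> D * exp (- b * (\<Sum>i=1..m. (x i)\<^sup>2))" using dens_gaussian_bound by blast
  have [measurable]: "(\<lambda>x. exp (- b * (\<Sum>i=1..m. (x i)\<^sup>2))) \<in> borel_measurable (knot_space m)"
    using knot_component_measurable by measurable
  have "partition \<le> (\<integral>\<^sup>+x. ennreal D * ennreal (exp (- b * (\<Sum>i=1..m. (x i)\<^sup>2))) \<partial>knot_space m)"
    unfolding partition_def using D by (intro nn_integral_mono) (simp add: ennreal_mult[symmetric] ennreal_leI)
  also have "\<dots> = ennreal D * (\<integral>\<^sup>+x. ennreal (exp (- b * (\<Sum>i=1..m. (x i)\<^sup>2))) \<partial>knot_space m)"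
    by (rule nn_integral_cmult) measurable
  also have "\<dots> < \<infinity>" using nn_integral_gaussian_finite[OF D(2)] by (simp add: ennreal_mult_less_top)
  finally show ?thesis .
qed

lemma partition_nonzero: "partition \<noteq> 0"
proof
  interpret product_sigma_finite "\<lambda>_::nat. lborel :: real measure"
    by (simp add: product_sigma_finite_def lborel.sigma_finite_measure_axioms)
  assume "partition = 0"
  then have "AE x in knot_space m. ennreal (dens x) = 0"
    unfolding partition_def using dens_measurable by (subst (asm) nn_integral_0_iff_AE) auto
  then have "AE x in knot_space m. False"
  proof eventually_elim
    case (elim x) then show ?case using dens_pos[of x] by (simp add: ennreal_eq_0_iff)
  qed
  then have "emeasure (knot_space m) (space (knot_space m)) = 0"
    by (simp add: eventually_ae_filter null_sets_def) (metis emeasure_eq_0 subset_refl sets.top)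
  moreover have "emeasure (knot_space m) (space (knot_space m)) = (\<Prod>i\<in>{1..m}. emeasure lborel (UNIV :: real set))"
    unfolding space_knot_space unfolding knot_space_def by (rule emeasure_PiM) auto
  ultimately show False by simp
qed

lemma law_density: "law = density (knot_space m) (\<lambda>x. ennreal (dens x) / partition)"
  by (simp add: law_def normalised_def partition_def)

lemma sets_law[simp, measurable_cong]: "sets law = sets (knot_space m)" by (simp add: law_density)

lemma space_law[simp]: "space law = space (knot_space m)" by (simp add: law_density)

lemma nn_integral_law:
  assumes [measurable]: "f \<in> borel_measurable (knot_space m)"
  shows "(\<integral>\<^sup>+x. f x \<partial>law) = (\<integral>\<^sup>+x. ennreal (dens x) * f x \<partial>knot_space m) / partition"
proof -
  note [measurable] = dens_measurable
  have "(\<integral>\<^sup>+x. f x \<partial>law) = (\<integral>\<^sup>+x. ennreal (dens x) / partition * f x \<partial>knot_space m)"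
    unfolding law_density by (rule nn_integral_density) measurable
  also have "\<dots> = (\<integral>\<^sup>+x. ennreal (dens x) * f x / partition \<partial>knot_space m)"
    by (intro nn_integral_cong) (simp add: divide_ennreal_def mult_ac)
  also have "\<dots> = (\<integral>\<^sup>+x. ennreal (dens x) * f x \<partial>knot_space m) / partition"
    by (rule nn_integral_divide) measurable
  finally show ?thesis .
qed

lemma prob_space_law: "prob_space law"
proof
  have "emeasure law (space law) = (\<integral>\<^sup>+x. 1 \<partial>law)" by simp
  also have "\<dots> = partition / partition" by (subst nn_integral_law) (auto simp: partition_def)
  also have "\<dots> = 1" using partition_finite partition_nonzero by (simp add: ennreal_divide_self)
  finally show "emeasure law (space law) = 1" .
qed

lemma law_second_moment: "integrable law (\<lambda>x. \<Sum>i=1..m. (x i)\<^sup>2)"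
proof (rule integrableI_nonneg)
  define S where "S x = (\<Sum>i=1..m. (x i)\<^sup>2)" for x :: "nat \<Rightarrow> real"
  have S0: "0 \<le> S x" for x by (simp add: S_def sum_nonneg)
  have meas: "S \<in> borel_measurable (knot_space m)" unfolding S_def using knot_component_measurable by measurable
  then show "(\<lambda>x. \<Sum>i=1..m. (x i)\<^sup>2) \<in> borel_measurable law" by (simp add: S_def[abs_def] cong: measurable_cong_sets)
  show "AE x in law. 0 \<le> (\<Sum>i=1..m. (x i)\<^sup>2)" by (simp add: sum_nonneg)
  obtain D b where D: "0 < D" "0 < b" "\<And>x. dens x \<le> D * exp (- b * S x)" using dens_gaussian_bound unfolding S_def by blast
  \<comment> \<open>Half of the Gaussian exponent pays for the factor \<open>S x\<close>, by t \<le>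
    exp t at t = b S / 2.\<close>
  have le: "dens x * S x \<le> (2 * D / b) * exp (- (b / 2) * S x)" for x
  proof -
    have "b / 2 * S x \<le> exp (b / 2 * S x)" using exp_ge_add_one_self[of "b / 2 * S x"] by linarith
    then have "S x \<le> (2 / b) * exp (b / 2 * S x)" using D by (simp add: field_simps)
    then have "dens x * S x \<le> (D * exp (- b * S x)) * ((2 / b) * exp (b / 2 * S x))"
      using D S0 dens_pos[of x] by (intro mult_mono) auto
    also have "\<dots> = (2 * D / b) * (exp (- b * S x) * exp (b / 2 * S x))" by simp
    also have "exp (- b * S x) * exp (b / 2 * S x) = exp (- (b / 2) * S x)" unfolding exp_add[symmetric] by simp
    finally show ?thesis .
  qed
  have "(\<integral>\<^sup>+x. ennreal (dens x) * ennreal (S x) \<partial>knot_space m)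
      \<le> (\<integral>\<^sup>+x. ennreal (2 * D / b) * ennreal (exp (- (b / 2) * S x)) \<partial>knot_space m)"
  proof (rule nn_integral_mono)
    fix x
    have "ennreal (dens x) * ennreal (S x) = ennreal (dens x * S x)"
      using S0[of x] dens_pos[of x] by (intro ennreal_mult[symmetric]) auto
    also have "\<dots> \<le> ennreal ((2 * D / b) * exp (- (b / 2) * S x))" by (intro ennreal_leI le)
    also have "\<dots> = ennreal (2 * D / b) * ennreal (exp (- (b / 2) * S x))"
      using D by (intro ennreal_mult) auto
    finally show "ennreal (dens x) * ennreal (S x) \<le> ennreal (2 * D / b) * ennreal (exp (- (b / 2) * S x))" .
  qed
  also have "\<dots> = ennreal (2 * D / b) * (\<integral>\<^sup>+x. ennreal (exp (- (b / 2) * S x)) \<partial>knot_space m)"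
    using meas by (intro nn_integral_cmult) measurable
  also have "\<dots> < \<infinity>" using nn_integral_gaussian_finite[of "b / 2"] D(2) unfolding S_def by (simp add: ennreal_mult_less_top)
  finally have "(\<integral>\<^sup>+x. ennreal (S x) \<partial>law) < \<infinity>"
    using meas partition_nonzero by (subst nn_integral_law) (auto simp: ennreal_divide_eq_top_iff top.not_eq_extremum[symmetric])
  then show "(\<integral>\<^sup>+x. ennreal (\<Sum>i=1..m. (x i)\<^sup>2) \<partial>law) < \<infinity>" by (simp add: S_def)
qed

section \<open>Block updates as affine maps driven by independent noise\<close>

definition block_map :: "nat set \<Rightarrow> (nat \<Rightarrow> real) \<Rightarrow> (nat \<Rightarrow> real) \<Rightarrow> nat \<Rightarrow> real" where
  "block_map A x z = (\<lambda>i\<in>{1..m}. if i \<in> A then z i + cond_mean x i else x i)"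

definition noise :: "nat set \<Rightarrow> (nat \<Rightarrow> real) measure" where
  "noise A = Pi\<^sub>M A (\<lambda>_. normal_law 0 s)"

lemma prob_space_noise: "prob_space (noise A)"
  unfolding noise_def by (intro prob_space_PiM prob_space_normal_law s_pos)

lemma block_map_measurable:
  assumes A: "A \<subseteq> {1..m}"
  shows "(\<lambda>(x, z). block_map A x z) \<in> knot_space m \<Otimes>\<^sub>M noise A \<rightarrow>\<^sub>M knot_space m"
proof -
  have "(\<lambda>p. if i \<in> A then snd p i + cond_mean (fst p) i else fst p i) \<in> borel_measurable (knot_space m \<Otimes>\<^sub>M noise A)"
    if i: "i \<in> {1..m}" for i
  proof -
    note [measurable] = measurable_compose[OF measurable_fst cond_mean_measurable[OF i]]
      measurable_compose[OF measurable_fst knot_component_measurable[OF i]]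
    show ?thesis
    proof (cases "i \<in> A")
      case True
      then have "(\<lambda>z. z i) \<in> borel_measurable (noise A)"
        using measurable_component_singleton[of i A "\<lambda>_. normal_law 0 s"] by (simp add: noise_def)
      note [measurable] = measurable_compose[OF measurable_snd this]
      show ?thesis using True by simp
    qed simp
  qed
  then show ?thesis unfolding block_map_def[abs_def] knot_space_def[of m] split_beta
    by (intro measurable_restrict) (simp add: knot_space_def)
qed

lemma normalised_block:
  assumes A: "A \<subseteq> {1..m}" "independent_set A"
  shows "normalised (Pi\<^sub>M A (\<lambda>_. lborel)) (\<lambda>y. dens (merge A ({1..m} - A) (y, x))) = Pi\<^sub>M A (\<lambda>i. normal_law (cond_mean x i) s)"
proof -
  have fin: "finite A" using A(1) finite_subset by blast
  obtain c where c: "0 < c" "\<And>y. dens (merge A ({1..m} - A) (y, x)) = c * (\<Prod>i\<in>A. normal_density (cond_mean x i) s (y i))"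
    using dens_block[OF A, of x] by blast
  let ?P = "\<lambda>y. \<Prod>i\<in>A. normal_density (cond_mean x i) s (y i)"
  have PiM: "density (Pi\<^sub>M A (\<lambda>_. lborel)) (\<lambda>y. ennreal (?P y)) = Pi\<^sub>M A (\<lambda>i. normal_law (cond_mean x i) s)"
    unfolding normal_law_def using fin
    by (intro PiM_density_prod[where f="\<lambda>i. normal_density (cond_mean x i) s"]) (auto intro: lborel.sigma_finite_measure_axioms)
  have [measurable]: "(\<lambda>y. y i) \<in> borel_measurable (Pi\<^sub>M A (\<lambda>_. lborel :: real measure))" if "i \<in> A" for i
    using measurable_component_singleton[OF that, of "\<lambda>_. lborel :: real measure"] by simp
  have [measurable]: "?P \<in> borel_measurable (Pi\<^sub>M A (\<lambda>_. lborel))" by measurable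
  have P0: "0 \<le> ?P y" for y by (simp add: prod_nonneg)
  have "prob_space (Pi\<^sub>M A (\<lambda>i. normal_law (cond_mean x i) s))"
    by (intro prob_space_PiM prob_space_normal_law s_pos)
  then have "(\<integral>\<^sup>+y. 1 \<partial>Pi\<^sub>M A (\<lambda>i. normal_law (cond_mean x i) s)) = 1"
    by (simp add: prob_space.emeasure_space_1)
  then have one: "(\<integral>\<^sup>+y. ennreal (?P y) \<partial>Pi\<^sub>M A (\<lambda>_. lborel)) = 1"
    unfolding PiM[symmetric] by (subst (asm) nn_integral_density) auto
  have "(\<integral>\<^sup>+y. ennreal (c * ?P y) \<partial>Pi\<^sub>M A (\<lambda>_. lborel)) = (\<integral>\<^sup>+y. ennreal c * ennreal (?P y) \<partial>Pi\<^sub>M A (\<lambda>_. lborel))"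
    using c(1) P0 by (simp add: ennreal_mult)
  also have "\<dots> = ennreal c" by (subst nn_integral_cmult) (auto simp: one)
  finally have int: "(\<integral>\<^sup>+y. ennreal (c * ?P y) \<partial>Pi\<^sub>M A (\<lambda>_. lborel)) = ennreal c" .
  have "ennreal (c * ?P y) / ennreal c = ennreal (?P y)" for y
    using c(1) P0[of y] by (simp add: divide_ennreal)
  then show ?thesis unfolding normalised_def c(2) int PiM[symmetric] by simp
qed

lemma merge_measurable:
  assumes A: "A \<subseteq> {1..m}"
  shows "(\<lambda>y. merge A ({1..m} - A) (y, x)) \<in> Pi\<^sub>M A (\<lambda>_. lborel) \<rightarrow>\<^sub>M knot_space m"
proof -
  have un: "A \<union> ({1..m} - A) = {1..m}" using A by auto
  \<comment> \<open>\<open>x\<close> is arbitrary and need not be extensional. \<open>merge\<close>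
    reads it only off \<open>A\<close>, so its restriction can be used instead.\<close>
  have "restrict x ({1..m} - A) \<in> space (Pi\<^sub>M ({1..m} - A) (\<lambda>_. lborel :: real measure))"
    by (simp add: space_PiM)
  then have "(\<lambda>y. merge A ({1..m} - A) (y, restrict x ({1..m} - A))) \<in> Pi\<^sub>M A (\<lambda>_. lborel) \<rightarrow>\<^sub>M Pi\<^sub>M (A \<union> ({1..m} - A)) (\<lambda>_. lborel)"
    by (intro measurable_compose[OF _ measurable_merge] measurable_Pair) auto
  moreover have "merge A ({1..m} - A) (y, restrict x ({1..m} - A)) = merge A ({1..m} - A) (y, x)" for y
    by (auto simp: merge_def)
  ultimately show ?thesis unfolding un knot_space_def by simp
qed

text \<open>Realises the conditional law as the image of a noise law common to all states; feeding
  one noise to two states is the coupling.\<close>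

lemma block_update_eq:
  assumes A: "A \<subseteq> {1..m}" "independent_set A" and x: "x \<in> space (knot_space m)"
  shows "block_update m dens A x = distr (noise A) (knot_space m) (block_map A x)"
proof -
  have fin: "finite A" using A(1) finite_subset by blast
  have m1: "(\<lambda>z. \<lambda>i\<in>A. z i + cond_mean x i) \<in> Pi\<^sub>M A (\<lambda>_. normal_law 0 s) \<rightarrow>\<^sub>M Pi\<^sub>M A (\<lambda>_. lborel)"
    by (rule measurable_restrict) (auto intro!: borel_measurable_add measurable_component_singleton[of _ A "\<lambda>_. normal_law 0 s", simplified])
  have "block_update m dens A x = distr (distr (Pi\<^sub>M A (\<lambda>_. normal_law 0 s)) (Pi\<^sub>M A (\<lambda>_. lborel)) (\<lambda>z. \<lambda>i\<in>A. z i + cond_mean x i))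
      (knot_space m) (\<lambda>y. merge A ({1..m} - A) (y, x))"
    unfolding block_update_def normalised_block[OF A]
    by (simp only: PiM_normal_law_translate[OF fin s_pos, of "cond_mean x"])
  also have "\<dots> = distr (noise A) (knot_space m) ((\<lambda>y. merge A ({1..m} - A) (y, x)) \<circ> (\<lambda>z. \<lambda>i\<in>A. z i + cond_mean x i))"
    unfolding noise_def using merge_measurable[OF A(1)] m1 by (rule distr_distr)
  also have "(\<lambda>y. merge A ({1..m} - A) (y, x)) \<circ> (\<lambda>z. \<lambda>i\<in>A. z i + cond_mean x i) = block_map A x"
    using A by (auto simp: block_map_def merge_def fun_eq_iff restrict_def)
  finally show ?thesis .
qed

end

text \<open>Zero off the knots because both states share the pinned endpoints. Being defined at
  every index, it can be fed to \<open>gs_update\<close> and \<open>energy\<close>.\<close>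

definition state_diff :: "nat \<Rightarrow> (nat \<Rightarrow> real) \<Rightarrow> (nat \<Rightarrow> real) \<Rightarrow> nat \<Rightarrow> real" where
  "state_diff m x y i = (if i \<in> {1..m} then x i - y i else 0)"

lemma supported_state_diff: "supported m (state_diff m x y)"
  by (simp add: supported_def state_diff_def)

section \<open>Reversibility and coupling of the block updates\<close>

context ar_bridge
begin

lemma prob_algebra_law: "prob_algebra law = prob_algebra (knot_space m)"
  unfolding prob_algebra_def by (simp add: subprob_algebra_cong[OF sets_law])

lemma measurable_law: "measurable law N = measurable (knot_space m) N"
  by (rule measurable_cong_sets) auto

lemma block_update_measurable:
  assumes A: "A \<subseteq> {1..m}" "independent_set A"
  shows "block_update m dens A \<in> law \<rightarrow>\<^sub>M prob_algebra law"
proof -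
  have "(\<lambda>x. distr (noise A) (knot_space m) (block_map A x)) \<in> knot_space m \<rightarrow>\<^sub>M prob_algebra (knot_space m)"
    using prob_space_noise
    by (intro measurable_distr_prob_space2[OF _ block_map_measurable[OF A(1)]] measurable_const) (simp add: space_prob_algebra)
  then show ?thesis unfolding prob_algebra_law measurable_law
    by (subst measurable_cong[OF block_update_eq[OF A]]) auto
qed

text \<open>A conditional mean reads only neighbours, which lie off the block, so resampling the
  block leaves its own conditional law unchanged.\<close>

lemma cond_mean_merge:
  assumes "A \<subseteq> {1..m}" "independent_set A" "i \<in> A"
  shows "cond_mean (merge A ({1..m} - A) (u, v)) i = cond_mean v i"
proof -
  have "i - 1 \<notin> A" "Suc i \<notin> A" using assms by (cases i; force simp: independent_set_def)+
  moreover have "i \<in> {1..m}" using assms by auto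
  ultimately show ?thesis by (auto simp: cond_mean_def ext_def merge_def)
qed

definition block_dens :: "nat set \<Rightarrow> (nat \<Rightarrow> real) \<Rightarrow> (nat \<Rightarrow> real) \<Rightarrow> real" where
  "block_dens A x y = (\<Prod>i\<in>A. normal_density (cond_mean x i) s (y i))"

lemma block_dens_measurable: "block_dens A x \<in> borel_measurable (Pi\<^sub>M A (\<lambda>_. lborel))"
proof -
  have [measurable]: "(\<lambda>y. y i) \<in> borel_measurable (Pi\<^sub>M A (\<lambda>_. lborel :: real measure))" if "i \<in> A" for i
    using measurable_component_singleton[OF that, of "\<lambda>_. lborel :: real measure"] by simp
  show ?thesis unfolding block_dens_def[abs_def] by measurable
qed

lemma nn_integral_block_update:
  assumes A: "A \<subseteq> {1..m}" "independent_set A" and f: "f \<in> borel_measurable (knot_space m)"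
  shows "(\<integral>\<^sup>+y. f y \<partial>block_update m dens A x)
    = (\<integral>\<^sup>+y. ennreal (block_dens A x y) * f (merge A ({1..m} - A) (y, x)) \<partial>Pi\<^sub>M A (\<lambda>_. lborel))"
proof -
  have fin: "finite A" using A(1) finite_subset by blast
  have PiM: "Pi\<^sub>M A (\<lambda>i. normal_law (cond_mean x i) s) = density (Pi\<^sub>M A (\<lambda>_. lborel)) (\<lambda>y. ennreal (block_dens A x y))"
    unfolding normal_law_def block_dens_def using fin
    by (intro PiM_density_prod[where f="\<lambda>i. normal_density (cond_mean x i) s", symmetric]) (auto intro: lborel.sigma_finite_measure_axioms)
  have "(\<integral>\<^sup>+y. f y \<partial>block_update m dens A x)
    = (\<integral>\<^sup>+y. f (merge A ({1..m} - A) (y, x)) \<partial>density (Pi\<^sub>M A (\<lambda>_. lborel)) (\<lambda>y. ennreal (block_dens A x y)))"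
    unfolding block_update_def normalised_block[OF A] PiM
    using f merge_measurable[OF A(1), of x] by (intro nn_integral_distr) (auto cong: measurable_cong_sets)
  also have "\<dots> = (\<integral>\<^sup>+y. ennreal (block_dens A x y) * f (merge A ({1..m} - A) (y, x)) \<partial>Pi\<^sub>M A (\<lambda>_. lborel))"
    using block_dens_measurable measurable_compose[OF merge_measurable[OF A(1), of x] f]
    by (intro nn_integral_density) auto
  finally show ?thesis .
qed

text \<open>Given the coordinates v off \<open>A\<close>, the update draws the block afresh from its
  conditional law. Both sides are thus the integral over v of the product of the conditional
  expectations of f and g, which is symmetric in f and g.\<close>

lemma block_update_reversible:
  assumes A: "A \<subseteq> {1..m}" "independent_set A"
  shows "reversible_kernel law (block_update m dens A)"
  unfolding reversible_kernel_def
proof (intro conjI ballI)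
  let ?B = "{1..m} - A"
  let ?K = "block_update m dens A"
  show K: "?K \<in> law \<rightarrow>\<^sub>M prob_algebra law" using A by (rule block_update_measurable)
  interpret L: product_sigma_finite "\<lambda>_::nat. lborel :: real measure"
    by (simp add: product_sigma_finite_def lborel.sigma_finite_measure_axioms)
  have fin: "finite A" "finite ?B" and un: "?B \<union> A = {1..m}" "?B \<inter> A = {}" using A(1) finite_subset by auto
  have "\<forall>x. \<exists>c>0. \<forall>y. dens (merge A ?B (y, x)) = c * block_dens A x y"
    using dens_block[OF A] unfolding block_dens_def by blast
  then obtain C where C: "\<And>x. 0 < C x" "\<And>x y. dens (merge A ?B (y, x)) = C x * block_dens A x y"
    by metis
  \<comment> \<open>\<open>G h v\<close> is the conditional expectation of h given v, and
    \<open>C v\<close> is the unnormalised marginal density of v.\<close>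
  define G where "G h v = (\<integral>\<^sup>+u. ennreal (block_dens A v u) * h (merge A ?B (u, v)) \<partial>Pi\<^sub>M A (\<lambda>_. lborel))" for h :: "(nat \<Rightarrow> real) \<Rightarrow> ennreal" and v
  have sym: "(\<integral>\<^sup>+x. g x * (\<integral>\<^sup>+y. f y \<partial>?K x) \<partial>law)
      = (\<integral>\<^sup>+v. ennreal (C v) * (G g v * G f v) \<partial>Pi\<^sub>M ?B (\<lambda>_. lborel)) / partition"
    if f: "f \<in> borel_measurable (knot_space m)" and g: "g \<in> borel_measurable (knot_space m)" for f g
  proof -
    have Kf: "(\<lambda>x. \<integral>\<^sup>+y. f y \<partial>?K x) \<in> borel_measurable (knot_space m)"
      using measurable_compose[OF measurable_prob_algebraD[OF K] nn_integral_measurable_subprob_algebra, of f] f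
      by (simp add: measurable_law)
    have gKf: "(\<lambda>x. g x * (\<integral>\<^sup>+y. f y \<partial>?K x)) \<in> borel_measurable (knot_space m)" using g Kf by measurable
    have tot: "(\<lambda>x. ennreal (dens x) * (g x * (\<integral>\<^sup>+y. f y \<partial>?K x))) \<in> borel_measurable (Pi\<^sub>M (?B \<union> A) (\<lambda>_. lborel))"
      using gKf dens_measurable unfolding un knot_space_def[symmetric] by measurable
    have "(\<integral>\<^sup>+x. ennreal (dens x) * (g x * (\<integral>\<^sup>+y. f y \<partial>?K x)) \<partial>knot_space m)
      = (\<integral>\<^sup>+v. (\<integral>\<^sup>+u. ennreal (dens (merge ?B A (v, u))) * (g (merge ?B A (v, u)) * (\<integral>\<^sup>+y. f y \<partial>?K (merge ?B A (v, u))))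
          \<partial>Pi\<^sub>M A (\<lambda>_. lborel)) \<partial>Pi\<^sub>M ?B (\<lambda>_. lborel))"
      using L.product_nn_integral_fold[OF un(2) fin(2,1) tot] unfolding un knot_space_def[symmetric] .
    also have "\<dots> = (\<integral>\<^sup>+v. ennreal (C v) * (G g v * G f v) \<partial>Pi\<^sub>M ?B (\<lambda>_. lborel))"
    proof (rule nn_integral_cong)
      fix v
      have cm: "block_dens A (merge A ?B (u, v)) = block_dens A v" for u
        unfolding block_dens_def[abs_def] by (intro ext prod.cong refl) (simp only: cond_mean_merge[OF A])
      have mm: "merge A ?B (y, merge A ?B (u, v)) = merge A ?B (y, v)" for u y by (auto simp: merge_def)
      have "(\<integral>\<^sup>+y. f y \<partial>?K (merge A ?B (u, v))) = G f v" for u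
        unfolding nn_integral_block_update[OF A f] G_def cm mm ..
      then have "(\<integral>\<^sup>+u. ennreal (dens (merge ?B A (v, u))) * (g (merge ?B A (v, u)) * (\<integral>\<^sup>+y. f y \<partial>?K (merge ?B A (v, u)))) \<partial>Pi\<^sub>M A (\<lambda>_. lborel))
        = (\<integral>\<^sup>+u. (ennreal (C v) * G f v) * (ennreal (block_dens A v u) * g (merge A ?B (u, v))) \<partial>Pi\<^sub>M A (\<lambda>_. lborel))"
        unfolding merge_commute[OF un(2)] C(2)
        by (intro nn_integral_cong) (simp add: ennreal_mult' C(1) less_imp_le mult_ac)
      also have "\<dots> = (ennreal (C v) * G f v) * G g v"
        unfolding G_def[of g] using block_dens_measurable measurable_compose[OF merge_measurable[OF A(1), of v] g]
        by (intro nn_integral_cmult borel_measurable_times_ennreal measurable_compose[OF _ measurable_ennreal]) auto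
      finally show "(\<integral>\<^sup>+u. ennreal (dens (merge ?B A (v, u))) * (g (merge ?B A (v, u)) * (\<integral>\<^sup>+y. f y \<partial>?K (merge ?B A (v, u)))) \<partial>Pi\<^sub>M A (\<lambda>_. lborel))
        = ennreal (C v) * (G g v * G f v)" by (simp add: mult_ac)
    qed
    finally show ?thesis unfolding nn_integral_law[OF gKf] by simp
  qed
  fix f g :: "(nat \<Rightarrow> real) \<Rightarrow> ennreal"
  assume "f \<in> borel_measurable law" "g \<in> borel_measurable law"
  then have fg: "f \<in> borel_measurable (knot_space m)" "g \<in> borel_measurable (knot_space m)" by (simp_all add: measurable_law)
  show "(\<integral>\<^sup>+x. g x * (\<integral>\<^sup>+y. f y \<partial>?K x) \<partial>law) = (\<integral>\<^sup>+x. f x * (\<integral>\<^sup>+y. g y \<partial>?K x) \<partial>law)"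
    unfolding sym[OF fg] sym[OF fg(2,1)] by (simp add: mult_ac)
qed

text \<open>A modulus in the difference of the states instead of a Lipschitz constant. It composes
  exactly with the linear updates, so the energy has to be estimated only once per sweep.\<close>

definition dominated :: "((nat \<Rightarrow> real) \<Rightarrow> real) \<Rightarrow> ((nat \<Rightarrow> real) \<Rightarrow> real) \<Rightarrow> bool" where
  "dominated f p \<longleftrightarrow> (\<forall>x\<in>space (knot_space m). \<forall>y\<in>space (knot_space m). \<bar>f x - f y\<bar> \<le> p (state_diff m x y))"

text \<open>Running the block update from two states with the same noise maps their difference through
  the deterministic Gauss--Seidel update.\<close>

lemma dominated_block_update:
  assumes A: "A \<subseteq> {1..m}" "independent_set A" and f: "bounded_measurable law f" and p: "dominated f p"
  shows "dominated (kernel_op (block_update m dens A) f) (\<lambda>e. p (gs_update \<kappa> A e))"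
  unfolding dominated_def
proof (intro ballI)
  fix x y assume x: "x \<in> space (knot_space m)" and y: "y \<in> space (knot_space m)"
  interpret N: prob_space "noise A" by (rule prob_space_noise)
  have fm: "f \<in> borel_measurable (knot_space m)" using f by (simp add: bounded_measurable_def measurable_law)
  have bm: "block_map A x \<in> noise A \<rightarrow>\<^sub>M knot_space m" if "x \<in> space (knot_space m)" for x
    using measurable_compose[OF measurable_Pair1'[OF that] block_map_measurable[OF A(1)]] by simp
  have op: "kernel_op (block_update m dens A) f x = (\<integral>z. f (block_map A x z) \<partial>noise A)"
    if "x \<in> space (knot_space m)" for x
    unfolding kernel_op_def block_update_eq[OF A that] using bm[OF that] fm by (rule integral_distr)
  have int: "integrable (noise A) (\<lambda>z. f (block_map A x z))" if "x \<in> space (knot_space m)" for x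
  proof -
    obtain B where "\<And>x. x \<in> space (knot_space m) \<Longrightarrow> \<bar>f x\<bar> \<le> B" using f by (auto simp: bounded_measurable_def)
    then show ?thesis using measurable_compose[OF bm[OF that] fm] measurable_space[OF bm[OF that]]
      by (intro N.integrable_const_bound[where B=B]) auto
  qed
  have diff: "state_diff m (block_map A x z) (block_map A y z) = gs_update \<kappa> A (state_diff m x y)" for z
  proof
    fix i
    have d: "ext x j - ext y j = state_diff m x y j" if "j \<le> Suc m" for j
      using that by (auto simp: ext_def state_diff_def)
    have "cond_mean x i - cond_mean y i = \<kappa> * (state_diff m x y (i - 1) + state_diff m x y (Suc i))" if "i \<in> {1..m}"
    proof -
      have "cond_mean x i - cond_mean y i = \<kappa> * ((ext x (i - 1) - ext y (i - 1)) + (ext x (Suc i) - ext y (Suc i)))"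
        by (simp add: cond_mean_def algebra_simps)
      moreover have "i - 1 \<le> Suc m" "Suc i \<le> Suc m" using that by auto
      ultimately show ?thesis by (simp only: d)
    qed
    then show "state_diff m (block_map A x z) (block_map A y z) i = gs_update \<kappa> A (state_diff m x y) i"
      using A(1) by (auto simp: gs_update_def block_map_def state_diff_def)
  qed
  have "\<bar>f (block_map A x z) - f (block_map A y z)\<bar> \<le> p (gs_update \<kappa> A (state_diff m x y))" if "z \<in> space (noise A)" for z
    using p measurable_space[OF bm[OF x] that] measurable_space[OF bm[OF y] that]
    unfolding dominated_def diff[of z, symmetric] by blast
  then have "(\<integral>z. \<bar>f (block_map A x z) - f (block_map A y z)\<bar> \<partial>noise A) \<le> p (gs_update \<kappa> A (state_diff m x y))"
    using int[OF x] int[OF y] by (intro N.integral_le_const) auto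
  moreover have "kernel_op (block_update m dens A) f x - kernel_op (block_update m dens A) f y
      = (\<integral>z. f (block_map A x z) - f (block_map A y z) \<partial>noise A)"
    using int[OF x] int[OF y] by (simp add: op[OF x] op[OF y])
  ultimately show "\<bar>kernel_op (block_update m dens A) f x - kernel_op (block_update m dens A) f y\<bar>
      \<le> p (gs_update \<kappa> A (state_diff m x y))"
    using integral_abs_bound[of "noise A" "\<lambda>z. f (block_map A x z) - f (block_map A y z)"] by linarith
qed

text \<open>The first block of the list acts outermost on functions but first on states, so
  \<open>fold\<close> traverses the same list in the same order.\<close>

lemma dominated_kernel_ops:
  assumes As: "\<forall>A\<in>set As. A \<subseteq> {1..m} \<and> independent_set A" and f: "bounded_measurable law f" and p: "dominated f p"
  shows "dominated (kernel_ops (map (block_update m dens) As) f) (\<lambda>e. p (fold (gs_update \<kappa>) As e))"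
  using As
proof (induction As)
  case Nil then show ?case using p by simp
next
  case (Cons A As)
  interpret law: prob_space law by (rule prob_space_law)
  have "bounded_measurable law (kernel_ops (map (block_update m dens) As) f)"
    using Cons.prems f by (intro law.bounded_measurable_kernel_ops) (auto simp: block_update_reversible)
  then show ?case using dominated_block_update[OF _ _ _ Cons.IH] Cons.prems by simp
qed

end

section \<open>Contraction of a full sweep in L^2\<close>

locale ar_bridge_sweep = ar_bridge +
  fixes As :: "nat set list"
  assumes disjoint_blocks: "sorted_wrt (\<lambda>A B. A \<inter> B = {}) As"
    and blocks: "\<forall>A\<in>set As. A \<subseteq> {1..m} \<and> independent_set A"
    and cover: "\<Union>(set As) = {1..m}"
begin

definition r where "r = 1 - 1 / (8 * (real m)\<^sup>2)"

lemma r_pos: "0 < r"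
proof -
  have "1 \<le> (real m)\<^sup>2" using m by simp
  then have "1 / (8 * (real m)\<^sup>2) \<le> 1 / 8" using m by (intro divide_left_mono) auto
  then show ?thesis by (simp add: r_def)
qed

interpretation law: prob_space law by (rule prob_space_law)

abbreviation kernels where "kernels \<equiv> map (block_update m dens) As"

lemma kernels_reversible: "\<forall>K\<in>set kernels. reversible_kernel law K"
  using blocks by (auto simp: block_update_reversible)

text \<open>The bound of \<open>energy_gs_sweep\<close> is blind to the order of the blocks, so the
  reversed sweep supplies a second factor r.\<close>

lemma energy_symmetric_sweep:
  assumes e: "supported m e"
  shows "energy \<kappa> m (fold (gs_update \<kappa>) (rev As @ As) e) \<le> r\<^sup>2 * energy \<kappa> m e"
proof -
  have rev_disj: "sorted_wrt (\<lambda>A B. A \<inter> B = {}) (rev As)"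
    using disjoint_blocks by (simp add: sorted_wrt_rev Int_commute)
  have rb: "\<forall>A\<in>set (rev As). A \<subseteq> {1..m} \<and> independent_set A" "\<Union>(set (rev As)) = {1..m}"
    using blocks cover by auto
  let ?e = "fold (gs_update \<kappa>) (rev As) e"
  have "supported m ?e" using gs_sweep_increments(1)[OF \<kappa>_bounds(1) e rev_disj rb(1)] .
  then have "energy \<kappa> m (fold (gs_update \<kappa>) As ?e) \<le> r * energy \<kappa> m ?e"
    unfolding r_def using \<kappa>_bounds m disjoint_blocks blocks cover by (intro energy_gs_sweep)
  also have "\<dots> \<le> r * (r * energy \<kappa> m e)"
    using r_pos energy_gs_sweep[OF \<kappa>_bounds e m rev_disj rb] by (intro mult_left_mono) (auto simp: r_def)
  finally show ?thesis by (simp add: power2_eq_square)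
qed

lemma dominated_iterates:
  assumes f: "bounded_measurable law f" and p: "dominated f (\<lambda>e. c * sqrt (energy \<kappa> m e))" and c: "0 \<le> c"
  shows "bounded_measurable law ((kernel_ops (rev kernels @ kernels) ^^ j) f)
    \<and> dominated ((kernel_ops (rev kernels @ kernels) ^^ j) f) (\<lambda>e. c * r ^ j * sqrt (energy \<kappa> m e))"
proof (induction j)
  case 0 then show ?case using f p by simp
next
  case (Suc j)
  have eq: "rev kernels @ kernels = map (block_update m dens) (rev As @ As)" by (simp add: rev_map)
  let ?h = "(kernel_ops (rev kernels @ kernels) ^^ j) f"
  have bm: "bounded_measurable law (kernel_ops (rev kernels @ kernels) ?h)"
    using Suc kernels_reversible by (intro law.bounded_measurable_kernel_ops) auto
  have dom: "dominated (kernel_ops (rev kernels @ kernels) ?h) (\<lambda>e. c * r ^ j * sqrt (energy \<kappa> m (fold (gs_update \<kappa>) (rev As @ As) e)))"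
    using Suc blocks unfolding eq by (intro dominated_kernel_ops) auto
  have "c * r ^ j * sqrt (energy \<kappa> m (fold (gs_update \<kappa>) (rev As @ As) e)) \<le> c * r ^ Suc j * sqrt (energy \<kappa> m e)"
    if "supported m e" for e
  proof -
    have "sqrt (energy \<kappa> m (fold (gs_update \<kappa>) (rev As @ As) e)) \<le> sqrt (r\<^sup>2 * energy \<kappa> m e)"
      using energy_symmetric_sweep[OF that] by (rule real_sqrt_le_mono)
    also have "\<dots> = r * sqrt (energy \<kappa> m e)" using r_pos by (simp add: real_sqrt_mult)
    finally have "c * r ^ j * sqrt (energy \<kappa> m (fold (gs_update \<kappa>) (rev As @ As) e)) \<le> c * r ^ j * (r * sqrt (energy \<kappa> m e))"
      using c r_pos by (intro mult_left_mono) auto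
    then show ?thesis by (simp add: mult_ac)
  qed
  then have "dominated (kernel_ops (rev kernels @ kernels) ?h) (\<lambda>e. c * r ^ Suc j * sqrt (energy \<kappa> m e))"
    using dom supported_state_diff unfolding dominated_def by (meson order_trans)
  then show ?case using bm by simp
qed

text \<open>Cauchy-Schwarz and the Poincare bound compare the l1 distance with the energy. The
  constant grows with m, which is harmless since log-convexity discards it.\<close>

lemma bounded_lipschitz_dominated:
  assumes "bounded_lipschitz {1..m} law f"
  shows "\<exists>c\<ge>0. dominated f (\<lambda>e. c * sqrt (energy \<kappa> m e))"
proof -
  obtain C where C: "0 \<le> C" "\<And>x y. x \<in> space law \<Longrightarrow> y \<in> space law \<Longrightarrow> \<bar>f x - f y\<bar> \<le> C * (\<Sum>i\<in>{1..m}. \<bar>x i - y i\<bar>)"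
    using assms unfolding bounded_lipschitz_def by blast
  define c where "c = C * sqrt (real m * (2 * (real m)\<^sup>2))"
  have "\<bar>f x - f y\<bar> \<le> c * sqrt (energy \<kappa> m (state_diff m x y))" if "x \<in> space (knot_space m)" "y \<in> space (knot_space m)" for x y
  proof -
    let ?e = "state_diff m x y"
    have "(\<Sum>i\<in>{1..m}. \<bar>x i - y i\<bar>) = (\<Sum>i=1..m. 1 * \<bar>?e i\<bar>)" by (intro sum.cong refl) (simp add: state_diff_def)
    also have "\<dots> \<le> sqrt ((\<Sum>i=1..m. 1 * \<bar>?e i\<bar>)\<^sup>2)" by simp
    also have "\<dots> \<le> sqrt ((\<Sum>i=1..m. 1\<^sup>2) * (\<Sum>i=1..m. \<bar>?e i\<bar>\<^sup>2))"
      by (intro real_sqrt_le_mono Cauchy_Schwarz_ineq_sum)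
    also have "\<dots> \<le> sqrt (real m * (2 * (real m)\<^sup>2 * energy \<kappa> m ?e))"
      using energy_lower_bound[OF \<kappa>_bounds supported_state_diff m, of x y] by (intro real_sqrt_le_mono) (simp add: mult_left_mono)
    also have "\<dots> = sqrt (real m * (2 * (real m)\<^sup>2)) * sqrt (energy \<kappa> m ?e)"
      by (simp add: real_sqrt_mult[symmetric] mult.assoc)
    finally show ?thesis using C(2)[of x y] that C(1) unfolding c_def
      by (simp add: mult.assoc) (meson mult_left_mono order_trans)
  qed
  moreover have "0 \<le> c" using C(1) by (simp add: c_def)
  ultimately show ?thesis unfolding dominated_def by blast
qed

lemma kernel_ops_integral:
  assumes "\<forall>K\<in>set Ks. reversible_kernel law K" "bounded_measurable law f"
  shows "(\<integral>x. kernel_ops Ks f x \<partial>law) = (\<integral>x. f x \<partial>law)"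
  using assms
  by (induction Ks) (simp_all add: law.integral_reversible_kernel_op law.bounded_measurable_kernel_ops)

text \<open>The variance is at most the second moment about the value at the zero state, which the domination
  by the energy controls.\<close>

lemma iterates_second_moment:
  assumes f: "bounded_measurable law f" and p: "dominated f (\<lambda>e. c * sqrt (energy \<kappa> m e))" and c: "0 \<le> c"
    and centred: "(\<integral>x. f x \<partial>law) = 0"
  shows "(\<integral>x. ((kernel_ops (rev kernels @ kernels) ^^ j) f x)\<^sup>2 \<partial>law)
    \<le> (2 * c\<^sup>2 * (\<integral>x. (\<Sum>i=1..m. (x i)\<^sup>2) \<partial>law)) * (r\<^sup>2) ^ j"
proof -
  let ?Q = "kernel_ops (rev kernels @ kernels)"
  define h where "h = (?Q ^^ j) f"
  have h: "bounded_measurable law h" "dominated h (\<lambda>e. c * r ^ j * sqrt (energy \<kappa> m e))"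
    using dominated_iterates[OF f p c, of j] by (auto simp: h_def)
  have all: "\<forall>K\<in>set (rev kernels @ kernels). reversible_kernel law K" using kernels_reversible by auto
  have "(\<integral>x. (?Q ^^ j) f x \<partial>law) = 0"
  proof (induction j)
    case (Suc j)
    then show ?case using kernel_ops_integral[OF all] dominated_iterates[OF f p c, of j] by simp
  qed (simp add: centred)
  then have mean: "(\<integral>x. h x \<partial>law) = 0" by (simp add: h_def)
  \<comment> \<open>The restriction makes the zero state extensional, as membership in the state
    space demands.\<close>
  define o0 :: "nat \<Rightarrow> real" where "o0 = (\<lambda>i\<in>{1..m}. 0)"
  have o0: "o0 \<in> space (knot_space m)" by (auto simp: o0_def space_knot_space)
  note sq = law.bounded_measurable_square_integrable[OF h(1)]
  have "(\<integral>x. (h x)\<^sup>2 \<partial>law) \<le> (\<integral>x. (h x - h o0)\<^sup>2 \<partial>law)"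
    using law.variance_le_second_moment[OF sq, of "h o0"] mean by simp
  also have "\<dots> \<le> (\<integral>x. (c * r ^ j)\<^sup>2 * (2 * (\<Sum>i=1..m. (x i)\<^sup>2)) \<partial>law)"
  proof (rule integral_mono)
    show "integrable law (\<lambda>x. (h x - h o0)\<^sup>2)"
      using square_integrable_diff[OF sq law.square_integrable_const] by (simp add: square_integrable_def)
    show "integrable law (\<lambda>x. (c * r ^ j)\<^sup>2 * (2 * (\<Sum>i=1..m. (x i)\<^sup>2)))" using law_second_moment by simp
    fix x assume "x \<in> space law"
    then have x: "x \<in> space (knot_space m)" by simp
    let ?e = "state_diff m x o0"
    have "\<bar>h x - h o0\<bar> \<le> c * r ^ j * sqrt (energy \<kappa> m ?e)" using h(2) x o0 unfolding dominated_def by blast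
    then have "\<bar>h x - h o0\<bar>\<^sup>2 \<le> (c * r ^ j * sqrt (energy \<kappa> m ?e))\<^sup>2" by (intro power_mono) auto
    then have "(h x - h o0)\<^sup>2 \<le> (c * r ^ j)\<^sup>2 * energy \<kappa> m ?e"
      using energy_nonneg[OF \<kappa>_bounds supported_state_diff] by (simp add: power_mult_distrib)
    also have "\<dots> \<le> (c * r ^ j)\<^sup>2 * (2 * (\<Sum>i=1..m. (?e i)\<^sup>2))"
      using energy_upper_bound[OF \<kappa>_bounds supported_state_diff] by (intro mult_left_mono) auto
    also have "(\<Sum>i=1..m. (?e i)\<^sup>2) = (\<Sum>i=1..m. (x i)\<^sup>2)" by (intro sum.cong refl) (simp add: state_diff_def o0_def)
    finally show "(h x - h o0)\<^sup>2 \<le> (c * r ^ j)\<^sup>2 * (2 * (\<Sum>i=1..m. (x i)\<^sup>2))" .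
  qed
  also have "\<dots> = (2 * c\<^sup>2 * (\<integral>x. (\<Sum>i=1..m. (x i)\<^sup>2) \<partial>law)) * (r\<^sup>2) ^ j"
    by (simp add: power_mult_distrib power_mult[symmetric] mult_ac)
  finally show ?thesis by (simp add: h_def)
qed

lemma gibbs_sweep_measurable_invariant:
  assumes "\<forall>A\<in>set Bs. A \<subseteq> {1..m} \<and> independent_set A"
  shows "gibbs_sweep m dens Bs \<in> law \<rightarrow>\<^sub>M prob_algebra law \<and> law \<bind> gibbs_sweep m dens Bs = law"
  using assms
proof (induction Bs)
  case Nil
  have eq: "gibbs_sweep m dens [] = return law"
    by (rule ext) (simp, rule return_cong, simp)
  show ?case unfolding eq by (simp add: bind_return'')
next
  case (Cons A Bs)
  have A: "A \<subseteq> {1..m}" "independent_set A" using Cons.prems by auto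
  note K = block_update_measurable[OF A]
  have IH: "gibbs_sweep m dens Bs \<in> law \<rightarrow>\<^sub>M prob_algebra law" "law \<bind> gibbs_sweep m dens Bs = law"
    using Cons by auto
  have eq: "gibbs_sweep m dens (A # Bs) = (\<lambda>x. block_update m dens A x \<bind> gibbs_sweep m dens Bs)" by (rule ext) simp
  have "law \<bind> gibbs_sweep m dens (A # Bs) = (law \<bind> block_update m dens A) \<bind> gibbs_sweep m dens Bs"
    unfolding eq using bind_assoc[OF measurable_prob_algebraD[OF K] measurable_prob_algebraD[OF IH(1)]] by simp
  also have "\<dots> = law"
    using reversible_kernel_bind[OF block_update_reversible[OF A] prob_space_law] IH(2) by simp
  finally show ?case using measurable_bind_prob_space[OF K IH(1)] by (simp add: eq)
qed

text \<open>Chapman-Kolmogorov for the sweep. Boundedness of f gives the equality at every state,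
  not just almost everywhere.\<close>

lemma kernel_op_gibbs_sweep:
  assumes Bs: "\<forall>A\<in>set Bs. A \<subseteq> {1..m} \<and> independent_set A" and f: "bounded_measurable law f"
    and x: "x \<in> space law"
  shows "kernel_op (gibbs_sweep m dens Bs) f x = kernel_ops (map (block_update m dens) Bs) f x"
  using Bs x
proof (induction Bs arbitrary: x)
  case Nil
  have "f \<in> borel_measurable (knot_space m)" using f by (simp add: bounded_measurable_def measurable_law)
  then show ?case using Nil by (simp add: kernel_op_def integral_return)
next
  case (Cons A Bs)
  have A: "A \<subseteq> {1..m}" "independent_set A" using Cons.prems by auto
  note Kx = markov_kernelD[OF block_update_measurable[OF A] \<open>x \<in> space law\<close>]
  have S: "gibbs_sweep m dens Bs \<in> law \<rightarrow>\<^sub>M prob_algebra law" using Cons.prems gibbs_sweep_measurable_invariant by simp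
  have S': "gibbs_sweep m dens Bs \<in> block_update m dens A x \<rightarrow>\<^sub>M subprob_algebra law"
    using measurable_prob_algebraD[OF S] by (simp only: Kx(4))
  have ne: "space (block_update m dens A x) \<noteq> {}" using prob_space.not_empty[OF Kx(1)] .
  have pr: "prob_space (block_update m dens A x \<bind> gibbs_sweep m dens Bs)"
    using Kx S by (intro prob_space_bind'[of _ law]) (auto simp: space_prob_algebra)
  have st: "sets (block_update m dens A x \<bind> gibbs_sweep m dens Bs) = sets law"
    using ne markov_kernelD(2)[OF S] unfolding Kx(3) by (intro sets_bind) (auto simp: Kx(3))
  have "kernel_op (gibbs_sweep m dens (A # Bs)) f x = (\<integral>y. kernel_op (gibbs_sweep m dens Bs) f y \<partial>block_update m dens A x)"
    unfolding kernel_op_def using integral_bind_integrable(2)[OF S' _ ne bounded_measurable_integrable[OF f pr st]] f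
    by (simp add: bounded_measurable_def)
  also have "\<dots> = (\<integral>y. kernel_ops (map (block_update m dens) Bs) f y \<partial>block_update m dens A x)"
    using Cons.IH Cons.prems by (intro Bochner_Integration.integral_cong refl) (simp add: Kx(3))
  finally show ?case by (simp add: kernel_op_def)
qed

text \<open>The rate is r and not its square root, because \<open>l2_rate_ok\<close> measures the
  squared L^2 norm.\<close>

theorem sweep_l2_rate_ok: "l2_rate_ok law (gibbs_sweep m dens As) r"
proof -
  let ?K = "gibbs_sweep m dens As"
  have K: "?K \<in> law \<rightarrow>\<^sub>M prob_algebra law" "law \<bind> ?K = law"
    using gibbs_sweep_measurable_invariant[OF blocks] by auto
  interpret product_prob law "{1..m}"
    by unfold_locales (auto simp: sets_knot_space)
  have contr: "(\<integral>x. (kernel_op ?K g x - (\<integral>y. g y \<partial>law))\<^sup>2 \<partial>law) \<le> r * (\<integral>x. (g x - (\<integral>y. g y \<partial>law))\<^sup>2 \<partial>law)"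
    if g: "bounded_lipschitz {1..m} law g" for g
  proof -
    define a where "a = (\<integral>y. g y \<partial>law)"
    \<comment> \<open>Centring removes the constants, which every kernel fixes and on which nothing
      decays.\<close>
    define f where "f x = g x - a" for x
    have gb: "bounded_measurable law g" using g by (simp add: bounded_lipschitz_def)
    have fb: "bounded_measurable law f" unfolding f_def using gb bounded_measurable_const by (rule bounded_measurable_arith)
    obtain c where c: "0 \<le> c" "dominated g (\<lambda>e. c * sqrt (energy \<kappa> m e))" using bounded_lipschitz_dominated[OF g] by blast
    have fd: "dominated f (\<lambda>e. c * sqrt (energy \<kappa> m e))" using c(2) by (simp add: dominated_def f_def)
    have centred: "(\<integral>x. f x \<partial>law) = 0"
      using law.bounded_measurable_integrable'[OF gb] law.prob_space by (simp add: f_def a_def del: space_law)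
    have "(\<integral>x. (kernel_op ?K g x - a)\<^sup>2 \<partial>law) = (\<integral>x. (kernel_ops kernels f x)\<^sup>2 \<partial>law)"
    proof (rule Bochner_Integration.integral_cong[OF refl])
      fix x assume x: "x \<in> space law"
      show "(kernel_op ?K g x - a)\<^sup>2 = (kernel_ops kernels f x)\<^sup>2"
        using kernel_op_add_const[OF K(1) gb x, of "- a"] kernel_op_gibbs_sweep[OF blocks fb x] by (simp add: f_def[abs_def])
    qed
    also have "\<dots> \<le> r * (\<integral>x. (f x)\<^sup>2 \<partial>law)"
      using kernels_reversible fb r_pos iterates_second_moment[OF fb fd c(1) centred] by (rule law.kernel_ops_contraction)
    finally show ?thesis by (simp add: f_def a_def)
  qed
  show ?thesis
  proof (rule law.l2_rate_ok_from_variance_contraction[OF K r_pos])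
    fix f assume f: "square_integrable law f"
    show "(\<integral>x. (kernel_op ?K f x - (\<integral>y. f y \<partial>law))\<^sup>2 \<partial>law) \<le> r * (\<integral>x. (f x - (\<integral>y. f y \<partial>law))\<^sup>2 \<partial>law)"
    proof (rule law.variance_contraction_from_dense[OF K, where D="{g. bounded_lipschitz {1..m} law g}"])
      show "\<exists>g\<in>{g. bounded_lipschitz {1..m} law g}. (\<integral>x. (f x - g x)\<^sup>2 \<partial>law) < \<epsilon>" if "0 < \<epsilon>" for \<epsilon>
        using bounded_lipschitz_dense[OF f] that unfolding L2_approximable_def by blast
    qed (use f r_pos contr in \<open>auto simp: bounded_lipschitz_def\<close>)
  qed
qed

end

subsection \<open>The cost of blocking\<close>

lemma sweep_blocks_admissible:
  assumes "blocks \<in> {checkerboard_blocks, lexicographic_blocks}"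
  shows "sorted_wrt (\<lambda>A B. A \<inter> B = {}) (blocks m)"
    and "\<forall>A\<in>set (blocks m). A \<subseteq> {1..m} \<and> independent_set A"
    and "\<Union>(set (blocks m)) = {1..m}"
proof -
  have "sorted_wrt (\<lambda>A B. A \<inter> B = {}) (lexicographic_blocks m)"
    unfolding lexicographic_blocks_def sorted_wrt_map
    by (rule sorted_wrt_mono_rel[OF _ sorted_wrt_upt]) auto
  then show "sorted_wrt (\<lambda>A B. A \<inter> B = {}) (blocks m)"
    using assms by (auto simp: checkerboard_blocks_def)
  show "\<forall>A\<in>set (blocks m). A \<subseteq> {1..m} \<and> independent_set A"
    using assms by (auto simp: checkerboard_blocks_def lexicographic_blocks_def independent_set_def)
  show "\<Union>(set (blocks m)) = {1..m}"
    using assms by (auto simp: checkerboard_blocks_def lexicographic_blocks_def)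
qed

text \<open>A gap bound becomes a time bound by - ln \<rho> \<ge> 1 - \<rho> \<ge> 1 / (8
  m^2).\<close>

lemma relax_time_bounds:
  assumes p: "\<And>a b. p (knot_delta T m) a b = normal_density (\<alpha> * a) \<tau> b"
    and \<alpha>: "0 < \<alpha>" "\<alpha> \<le> 1" and \<tau>: "0 < \<tau>" and m: "1 \<le> m"
    and blocks: "blocks \<in> {checkerboard_blocks, lexicographic_blocks}"
  shows "0 \<le> relax_time p blocks x0 xT T m" "relax_time p blocks x0 xT T m \<le> 8 * (real m)\<^sup>2"
proof -
  interpret ar_bridge_sweep \<alpha> \<tau> x0 xT m "blocks m"
    using \<alpha> \<tau> m sweep_blocks_admissible[OF blocks, of m] by unfold_locales
  have dens: "bridge_dens p T m x0 xT = dens"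
    by (rule HOL.ext) (simp add: bridge_dens_def dens_def ext_def p)
  define \<rho> where "\<rho> = gibbs_rate p blocks x0 xT T m"
  have "\<rho> = l2_rate law (gibbs_sweep m dens (blocks m))"
    by (simp add: \<rho>_def gibbs_rate_def bridge_law_def dens law_def)
  then have \<rho>: "0 \<le> \<rho>" "\<rho> \<le> 1 - 1 / (8 * (real m)\<^sup>2)"
    using l2_rate_bounds[OF sweep_l2_rate_ok] by (simp_all add: r_def)
  have "0 \<le> - 1 / ln \<rho> \<and> - 1 / ln \<rho> \<le> 8 * (real m)\<^sup>2"
  \<comment> \<open>The rate is 0 for instance at m = 1, where a sweep is an exact draw. Then
    \<open>ln 0 = 0\<close> and division by zero give relaxation time 0, so the bounds still
    hold.\<close>
  proof (cases "\<rho> = 0")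
    case False
    then have "ln \<rho> \<le> \<rho> - 1" using \<rho>(1) by (intro ln_le_minus_one) simp
    then have le: "1 / (8 * (real m)\<^sup>2) \<le> - ln \<rho>" using \<rho>(2) by linarith
    have pos: "0 < 1 / (8 * (real m)\<^sup>2)" using m by simp
    have "0 < - ln \<rho>" using le pos by linarith
    moreover have "1 / (- ln \<rho>) \<le> 1 / (1 / (8 * (real m)\<^sup>2))"
      using le pos \<open>0 < - ln \<rho>\<close> by (intro divide_left_mono mult_pos_pos) auto
    ultimately show ?thesis by simp
  qed simp
  then show "0 \<le> relax_time p blocks x0 xT T m" "relax_time p blocks x0 xT T m \<le> 8 * (real m)\<^sup>2"
    by (simp_all add: relax_time_def \<rho>_def)
qed

text \<open>The number m of blocks cancels against the step length 2 T / (m + 1), which leaves 8 m^2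
  * 2 K T with m of order T^(1 + \<eta>). The linear bound on \<open>C_rej\<close> is demanded only
  at the steps that occur, and only eventually, so that both processes fit.\<close>

lemma C_blocking_bigo:
  fixes \<eta> c1 K :: real
  assumes ar: "\<And>T m. 0 < T \<Longrightarrow> 1 \<le> m \<Longrightarrow>
      \<exists>\<alpha> \<tau>. 0 < \<alpha> \<and> \<alpha> \<le> 1 \<and> 0 < \<tau> \<and> (\<forall>a b. p (knot_delta T m) a b = normal_density (\<alpha> * a) \<tau> b)"
    and blocks: "blocks \<in> {checkerboard_blocks, lexicographic_blocks}"
    and c1: "0 < c1" and \<eta>: "0 \<le> \<eta>" and K: "0 \<le> K" and C_pos: "\<forall>t>0. 0 < C_rej t"
    and C_rej: "eventually (\<lambda>T. let t = 2 * T / (real (nat \<lceil>c1 * T powr (1 + \<eta>)\<rceil>) + 1) in C_rej t \<le> K * t) at_top"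
  shows "(\<lambda>T. C_blocking C_rej p blocks x0 xT T (nat \<lceil>c1 * T powr (1 + \<eta>)\<rceil>)) \<in> O[at_top](\<lambda>T. T powr (3 + 2 * \<eta>))"
proof (rule bigoI)
  show "eventually (\<lambda>T. norm (C_blocking C_rej p blocks x0 xT T (nat \<lceil>c1 * T powr (1 + \<eta>)\<rceil>))
      \<le> (16 * K * (c1 + 1)\<^sup>2) * norm (T powr (3 + 2 * \<eta>))) at_top"
    using C_rej eventually_ge_at_top[of 1]
  proof eventually_elim
    case (elim T)
    define m where "m = nat \<lceil>c1 * T powr (1 + \<eta>)\<rceil>"
    define t where "t = 2 * T / (real m + 1)"
    have T: "0 < T" "1 \<le> T" using elim by auto
    have "0 < c1 * T powr (1 + \<eta>)" using c1 T by simp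
    then have "1 \<le> \<lceil>c1 * T powr (1 + \<eta>)\<rceil>" by linarith
    then have m: "1 \<le> m" and mi: "real m = of_int \<lceil>c1 * T powr (1 + \<eta>)\<rceil>" unfolding m_def by linarith+
    have "1 \<le> T powr (1 + \<eta>)" using T \<eta> by (intro ge_one_powr_ge_zero) auto
    \<comment> \<open>Rounding up adds at most 1, which is at most
      \<open>T powr (1 + \<eta>)\<close> as T \<ge> 1; hence c1 + 1.\<close>
    then have mle: "real m \<le> (c1 + 1) * T powr (1 + \<eta>)"
      using of_int_ceiling_le_add_one[of "c1 * T powr (1 + \<eta>)"] unfolding mi by (simp add: algebra_simps)
    have t: "0 < t" using T by (simp add: t_def)
    have Ct: "0 < C_rej t" "C_rej t \<le> K * t" using C_pos t elim by (auto simp: Let_def t_def m_def)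
    obtain \<alpha> \<tau> where ar': "0 < \<alpha>" "\<alpha> \<le> 1" "0 < \<tau>" "\<And>a b. p (knot_delta T m) a b = normal_density (\<alpha> * a) \<tau> b"
      using ar[OF T(1) m] by blast
    note rt = relax_time_bounds[where p=p and T=T, OF ar'(4,1,2,3) m blocks, of x0 xT]
    have mt: "real m * (K * t) \<le> 2 * K * T"
    proof -
      have "real m * (K * t) = 2 * K * T * (real m / (real m + 1))" by (simp add: t_def)
      also have "\<dots> \<le> 2 * K * T * 1" using K T by (intro mult_left_mono) auto
      finally show ?thesis by simp
    qed
    have "norm (C_blocking C_rej p blocks x0 xT T m) = relax_time p blocks x0 xT T m * (real m * C_rej t)"
      using rt(1) Ct by (simp add: C_blocking_def t_def abs_mult)
    also have "\<dots> \<le> (8 * (real m)\<^sup>2) * (2 * K * T)"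
    proof (rule mult_mono[OF rt(2)])
      have "real m * C_rej t \<le> real m * (K * t)" using Ct by (intro mult_left_mono) auto
      then show "real m * C_rej t \<le> 2 * K * T" using mt by linarith
    qed (use Ct in auto)
    also have "\<dots> = 16 * K * T * (real m)\<^sup>2" by simp
    also have "\<dots> \<le> 16 * K * T * ((c1 + 1) * T powr (1 + \<eta>))\<^sup>2"
      using mle K T by (intro mult_left_mono power_mono) auto
    also have "\<dots> = (16 * K * (c1 + 1)\<^sup>2) * (T powr 1 * (T powr (1 + \<eta>))\<^sup>2)"
      using T by (simp add: power_mult_distrib)
    also have "T powr 1 * (T powr (1 + \<eta>))\<^sup>2 = T powr (3 + 2 * \<eta>)"
      unfolding power2_eq_square powr_add[symmetric] by (simp add: algebra_simps)
    finally show ?case by (simp add: m_def)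
  qed
qed

theorem theorem1:
  fixes \<sigma> \<theta> x0 xT K t0 :: real and C_rej :: "real \<Rightarrow> real"
  assumes \<sigma>_pos: "\<sigma> > 0" and \<theta>_pos: "\<theta> > 0"
    and C_pos: "\<forall>t>0. C_rej t > 0"
    and K_pos: "K > 0" and t0_pos: "t0 > 0"
    and C_small: "\<forall>t. 0 < t \<and> t \<le> t0 \<longrightarrow> C_rej t \<le> K * t"
  shows
    "(\<forall>blocks \<in> {checkerboard_blocks, lexicographic_blocks}.
       \<forall>c1>0. \<forall>\<chi>1>0.
         (\<lambda>T. C_blocking C_rej (ou_trans \<theta> \<sigma>) blocks x0 xT T (nat \<lceil>c1 * T powr (1 + \<chi>1)\<rceil>))
           \<in> O[at_top](\<lambda>T. T powr (3 + 2 * \<chi>1)))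
     \<and> ((\<exists>c5>0. \<forall>t>0. C_rej t = c5 * t) \<longrightarrow>
        (\<forall>blocks \<in> {checkerboard_blocks, lexicographic_blocks}.
          \<forall>c1>0. \<forall>\<chi>1\<ge>0.
            (\<lambda>T. C_blocking C_rej (bm_trans \<sigma>) blocks x0 xT T (nat \<lceil>c1 * T powr (1 + \<chi>1)\<rceil>))
              \<in> O[at_top](\<lambda>T. T powr (3 + 2 * \<chi>1))))"
proof (intro conjI impI ballI allI)
  fix blocks :: "nat \<Rightarrow> nat set list" and c1 \<chi>1 :: real
  assume blocks: "blocks \<in> {checkerboard_blocks, lexicographic_blocks}" and c1: "0 < c1" and chi: "0 < \<chi>1"
  show "(\<lambda>T. C_blocking C_rej (ou_trans \<theta> \<sigma>) blocks x0 xT T (nat \<lceil>c1 * T powr (1 + \<chi>1)\<rceil>))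
           \<in> O[at_top](\<lambda>T. T powr (3 + 2 * \<chi>1))"
  proof (rule C_blocking_bigo[OF _ blocks c1 less_imp_le[OF chi] less_imp_le[OF K_pos] C_pos])
    fix T :: real and m :: nat assume T: "0 < T" "1 \<le> m"
    define \<delta> where "\<delta> = knot_delta T m"
    have \<delta>: "0 < \<delta>" using T by (simp add: \<delta>_def knot_delta_def)
    have "exp (- 2 * \<theta> * \<delta>) < 1" using \<theta>_pos \<delta> by simp
    then have "0 < \<sigma> * sqrt ((1 - exp (- 2 * \<theta> * \<delta>)) / (2 * \<theta>))" using \<sigma>_pos \<theta>_pos by simp
    moreover have "0 < exp (- \<theta> * \<delta>)" "exp (- \<theta> * \<delta>) \<le> 1" using \<theta>_pos \<delta> by auto
    ultimately show "\<exists>\<alpha> \<tau>. 0 < \<alpha> \<and> \<alpha> \<le> 1 \<and> 0 < \<tau> \<and>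
        (\<forall>a b. ou_trans \<theta> \<sigma> (knot_delta T m) a b = normal_density (\<alpha> * a) \<tau> b)"
      unfolding \<delta>_def[symmetric] ou_trans_def by (metis mult.commute)
  next
    \<comment> \<open>The cost is linear only up to \<open>t0\<close>. The step length is at most (2
      / c1) T^(-\<chi>1), and \<chi>1 > 0 is what drives it below \<open>t0\<close>.\<close>
    have "((\<lambda>T. 2 / c1 * T powr (- \<chi>1)) \<longlongrightarrow> 2 / c1 * 0) at_top"
      using chi by (intro tendsto_mult tendsto_const tendsto_neg_powr filterlim_ident) auto
    then have "eventually (\<lambda>T. 2 / c1 * T powr (- \<chi>1) < t0) at_top"
      using t0_pos by (intro order_tendstoD) auto
    then show "eventually (\<lambda>T. let t = 2 * T / (real (nat \<lceil>c1 * T powr (1 + \<chi>1)\<rceil>) + 1) in C_rej t \<le> K * t) at_top"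
      using eventually_gt_at_top[of 0]
    proof eventually_elim
      case (elim T)
      let ?m = "nat \<lceil>c1 * T powr (1 + \<chi>1)\<rceil>"
      have "2 * T / (real ?m + 1) \<le> 2 * T / (c1 * T powr (1 + \<chi>1))"
      proof (rule divide_left_mono)
        show "c1 * T powr (1 + \<chi>1) \<le> real ?m + 1"
          using real_nat_ceiling_ge[of "c1 * T powr (1 + \<chi>1)"] by linarith
        show "0 < (real ?m + 1) * (c1 * T powr (1 + \<chi>1))" using elim c1 by (intro mult_pos_pos add_nonneg_pos of_nat_0_le_iff) auto
      qed (use elim in auto)
      also have "\<dots> = 2 / c1 * T powr (- \<chi>1)"
        using elim c1 by (simp add: powr_add powr_minus field_simps)
      finally have "2 * T / (real ?m + 1) \<le> t0" using elim by linarith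
      moreover have "0 < 2 * T / (real ?m + 1)" using elim by (intro divide_pos_pos) auto
      ultimately show ?case using C_small unfolding Let_def by blast
    qed
  qed
next
  fix blocks :: "nat \<Rightarrow> nat set list" and c1 \<chi>1 :: real
  assume "\<exists>c5>0. \<forall>t>0. C_rej t = c5 * t"
  then obtain c5 where c5: "0 < c5" "\<And>t. 0 < t \<Longrightarrow> C_rej t = c5 * t" by blast
  assume blocks: "blocks \<in> {checkerboard_blocks, lexicographic_blocks}" and c1: "0 < c1" and chi: "0 \<le> \<chi>1"
  show "(\<lambda>T. C_blocking C_rej (bm_trans \<sigma>) blocks x0 xT T (nat \<lceil>c1 * T powr (1 + \<chi>1)\<rceil>))
           \<in> O[at_top](\<lambda>T. T powr (3 + 2 * \<chi>1))"
  proof (rule C_blocking_bigo[OF _ blocks c1 chi less_imp_le[OF c5(1)] C_pos])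
    fix T :: real and m :: nat assume "0 < T" "1 \<le> m"
    then have "0 < knot_delta T m" by (simp add: knot_delta_def)
    then show "\<exists>\<alpha> \<tau>. 0 < \<alpha> \<and> \<alpha> \<le> 1 \<and> 0 < \<tau> \<and>
        (\<forall>a b. bm_trans \<sigma> (knot_delta T m) a b = normal_density (\<alpha> * a) \<tau> b)"
      using \<sigma>_pos unfolding bm_trans_def
      by (intro exI[of _ "1::real"] exI[of _ "\<sigma> * sqrt (knot_delta T m)"]) simp
  next
    \<comment> \<open>At \<chi>1 = 0 the steps do not shrink to 0, but here the cost is linear at
      every step length.\<close>
    show "eventually (\<lambda>T. let t = 2 * T / (real (nat \<lceil>c1 * T powr (1 + \<chi>1)\<rceil>) + 1) in C_rej t \<le> c5 * t) at_top"
      using eventually_gt_at_top[of 0]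
    proof eventually_elim
      case (elim T)
      have "0 < 2 * T / (real (nat \<lceil>c1 * T powr (1 + \<chi>1)\<rceil>) + 1)" using elim by (intro divide_pos_pos) auto
      then show ?case using c5(2) by (simp add: Let_def)
    qed
  qed
qed

end
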